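(* Let $1\le p,q\le\infty$ and let $\alpha,\beta\in\mathbb{R}$ satisfy $\alpha-\frac1{p'}>0$ and $\beta-\frac1{q'}>0$. Consider locally integrable functions $f:\mathbb{R}\to\mathbb{C}$ such that $$\big\| f\,|x|^{\alpha}\big\|_{L^p(\mathbb{R})}+\big\|\widehat f\,|\xi|^{\beta}\big\|_{L^q(\mathbb{R})}<\infty. \qquad ( * )$$ Then: (1) If $(\alpha-\frac1{p'})(\beta-\frac1{q'})>\max\left(\frac1{pq},\frac1{2p}\right)$, then $\lim_N P_N(|f|)<\infty$ for every $f$ satisfying $( * )$. (2) If $(\alpha-\frac1{p'})(\beta-\frac1{q'})=\frac1{pq}$ and $(p,q)=(1,1)$, then $\lim_N P_N(|f|)<\infty$ for every $f$ satisfying $( * )$. (3) If $(\alpha-\frac1{p'})(\beta-\frac1{q'})\le\max\left(\frac1{pq},\frac1{2p}\right)$ and $(p,q)\ne(1,1)$, then there exists $f$ satisfying $( * )$ for which $\lim_N P_N(|f|)=\infty$.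
   Context: $p'$ denotes the conjugate exponent, $\frac1p+\frac1{p'}=1$, with $1/\infty=0$ (similarly $q'$). The Fourier transform of an integrable function is $\widehat f(\xi)=\int_{\mathbb{R}}f(x)e^{-2\pi i x\xi}\,dx$. For a function $g$ on $\mathbb{R}$ and a positive integer $N$, $P_N(g)=\sum_{|k|\le N}g(k)$, the sum being over integers $k$; thus $P_N(|f|)=\sum_{|k|\le N}|f(k)|$. A locally integrable $f$ with $f|x|^\alpha\in L^p$ and $\alpha>1/p'$ is integrable, so $\widehat f$ is well defined and continuous; moreover $( * )$ implies $\widehat f\in L^1(\mathbb{R})$, so $f$ agrees a.e. with a continuous function, and the values $f(k)$ are those of the continuous representative. *)

theory Defs
  imports "HOL-Analysis.Analysis" "HOL-Probability.Essential_Supremum"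
begin

text \<open>
  Exponents range over the extended nonnegative reals, where \<open>1 / \<infinity> = 0\<close>. The norm below is
  \<open>\<infinity>\<close>-valued and is meant for Lebesgue measurable \<open>h\<close>.
\<close>

definition Lp_norm :: "ennreal \<Rightarrow> (real \<Rightarrow> complex) \<Rightarrow> ennreal" where
  "Lp_norm p h =
     (if p = \<infinity> then esssup lebesgue (\<lambda>x. ennreal (norm (h x)))
      else let I = (\<integral>\<^sup>+x. ennreal (norm (h x) powr enn2real p) \<partial>lebesgue)
           in if I = \<infinity> then \<infinity> else ennreal (enn2real I powr (1 / enn2real p)))"

definition locally_integrable :: "(real \<Rightarrow> complex) \<Rightarrow> bool" where
  "locally_integrable f \<longleftrightarrow> (\<forall>K. compact K \<longrightarrow> f absolutely_integrable_on K)"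

definition fourier :: "(real \<Rightarrow> complex) \<Rightarrow> real \<Rightarrow> complex" where
  "fourier f \<xi> =
     (LINT x|lebesgue. f x * exp (- 2 * of_real pi * \<i> * of_real x * of_real \<xi>))"

definition weighted_norms_finite ::
    "ennreal \<Rightarrow> ennreal \<Rightarrow> real \<Rightarrow> real \<Rightarrow> (real \<Rightarrow> complex) \<Rightarrow> bool" where
  "weighted_norms_finite p q \<alpha> \<beta> f \<longleftrightarrow>
     Lp_norm p (\<lambda>x. f x * of_real (\<bar>x\<bar> powr \<alpha>))
       + Lp_norm q (\<lambda>\<xi>. fourier f \<xi> * of_real (\<bar>\<xi>\<bar> powr \<beta>)) < \<infinity>"

definition continuous_rep :: "(real \<Rightarrow> complex) \<Rightarrow> (real \<Rightarrow> complex) \<Rightarrow> bool" where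
  "continuous_rep f g \<longleftrightarrow> continuous_on UNIV g \<and> (AE x in lebesgue. f x = g x)"

lemma continuous_rep_unique:
  assumes "continuous_rep f g" "continuous_rep f h"
  shows "g = h"
proof -
  have "AE x in lebesgue. g x = h x"
    using assms unfolding continuous_rep_def by (auto elim: eventually_elim2)
  then have "{x. g x \<noteq> h x} \<in> null_sets lebesgue"
    by (simp add: AE_iff_null_sets completion.AE_iff_null_sets eventually_ae_filter)
       (metis (mono_tags, lifting) completion.complete2)
  then have "negligible {x. g x \<noteq> h x}"
    by (simp add: negligible_iff_null_sets)
  moreover have "open {x. g x \<noteq> h x}"
    using assms unfolding continuous_rep_def by (intro open_Collect_neq) auto
  ultimately have "{x. g x \<noteq> h x} = {}"
    using open_not_negligible by blast
  then show ?thesis by auto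
qed

definition P_N :: "nat \<Rightarrow> (real \<Rightarrow> real) \<Rightarrow> real" where
  "P_N N g = (\<Sum>k\<in>{- int N..int N}. g (of_int k))"

end

theory Submission
  imports Defs "HOL-Probability.Characteristic_Functions" "HOL-Real_Asymp.Real_Asymp"
begin

text \<open>
  Put \<open>a = \<alpha> - 1/p'\<close>, \<open>b = \<beta> - 1/q'\<close>, \<open>s = max (1/q) (1/2)\<close> and \<open>e x = exp (2 \<pi> i x)\<close>.

  Convergence. By Fourier inversion \<open>f\<close> agrees a.e. with \<open>g x = \<integral> F \<xi> e (x \<xi>) d\<xi>\<close>, \<open>F\<close> the transform of \<open>f\<close>.
  The \<open>n\<close>-th difference of \<open>g\<close> at \<open>k\<close> with step \<open>h\<close> has Fourier density \<open>F \<xi> (1 - e (h \<xi>))\<^sup>n\<close>, so averaging over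
  \<open>0 \<le> h \<le> H\<close> bounds \<open>|g k|\<close> by means of \<open>|g|\<close> over \<open>[k, k + n H]\<close> plus a high frequency term. With
  \<open>H\<close> of order \<open>k powr (-c)\<close> the means are summable for \<open>c < a p\<close> (for \<open>p = 1\<close> also for \<open>c = a\<close>). On a block of \<open>K\<close>
  integers, summing the high frequency terms against unimodular signs gives \<open>\<integral> F m A\<close> with a trigonometric
  sum \<open>A\<close> whose \<open>L\<^bsup>q'\<^esup>\<close> norm over a period is at most of order \<open>K powr s\<close>; this is summable over dyadic blocks for \<open>c > s/b\<close>.
  For \<open>q = 1\<close> one may instead sum the multipliers pointwise in \<open>\<xi>\<close> and take \<open>c = 1/b\<close>, which covers the end point.

  Divergence. Take \<open>c = s/b\<close> and sum over \<open>n\<close> the layers of Gaussian bumps of height \<open>|d n k| / (n 4\<^sup>n)\<close> and width \<open>1/R\<^sub>n\<close> at the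
  integers \<open>k\<close> in \<open>[4\<^sup>n, 4\<^bsup>n+1\<^esup>)\<close>, where \<open>R\<^sub>n = 4 powr (c n) * n powr \<theta>\<close>. The coefficients \<open>d\<close> are chosen
  so that \<open>\<Sum>\<^sub>k d n k e (-k \<xi>)\<close> has the smallest possible \<open>L\<^sup>q\<close> norm over a period: Fejer coefficients for \<open>q \<le> 2\<close>,
  Rudin--Shapiro coefficients for \<open>q > 2\<close>. Layer \<open>n\<close> contributes of order \<open>1/n\<close> to the sum over the integers, \<open>n powr (-p - \<theta>)\<close> to
  the \<open>p\<close>-th power of the spatial norm and \<open>n powr (-q (1 - b \<theta>))\<close> to the \<open>q\<close>-th power of the frequency norm;
  unless \<open>p = q = 1\<close>, some \<open>\<theta>\<close> makes the last two summable.
\<close>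

section \<open>Integrals of trigonometric sums and Gaussians\<close>

text \<open>A value at an integer is invisible to an integral norm, so \<open>|g k|\<close> has to
  be traded for means, and differences achieve this. Their order is large because near 0 the
  frequency norm controls only \<open>|xi|^beta F\<close>: the multiplier has to vanish there to
  order at least \<open>beta\<close>. The step length \<open>H\<close> balances the two sides: small
  \<open>H\<close> damps the high frequency term but makes the means harder to sum. The number
  \<open>s\<close> comes from interpolation. \<open>K\<close> unimodular coefficients give a sum
  with sup at most \<open>K\<close> and mean square \<open>K\<close>, so its \<open>L^q'\<close>
  norm over a period is at most of order \<open>K^(1/q)\<close> for \<open>q' >= 2\<close> and
  \<open>K^(1/2)\<close> otherwise. The demands \<open>c < a p\<close> and \<open>c > s / b\<close>
  are compatible exactly when \<open>a b > s / p = max (1/(p q)) (1/(2 p))\<close>, and this is the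
  threshold. At or below it, \<open>c = s / b\<close> leaves no growing power of \<open>4^n\<close>
  in either norm, so the powers of \<open>n\<close> decide. Then \<open>p = 1\<close> asks for
  \<open>theta > 0\<close> and \<open>q = 1\<close> for \<open>theta < 0\<close>; these exclude each
  other only at \<open>p = q = 1\<close>, where the end point does converge.\<close>

definition ee :: "real \<Rightarrow> complex" where
  "ee x = cis (2 * pi * x)"

lemma norm_ee [simp]: "norm (ee x) = 1"
  by (simp add: ee_def)

lemma ee_0 [simp]: "ee 0 = 1"
  by (simp add: ee_def)

lemma ee_add: "ee (x + y) = ee x * ee y"
  by (simp add: ee_def cis_mult ring_distribs)

lemma ee_of_int [simp]: "ee (of_int n) = 1"
  by (simp add: ee_def cis_multiple_2pi)

lemma ee_power: "ee x ^ n = ee (real n * x)"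
  by (simp add: ee_def Complex.DeMoivre algebra_simps)

lemma cnj_ee: "cnj (ee x) = ee (- x)"
  by (simp add: ee_def cis_cnj)

lemma continuous_on_ee [continuous_intros]:
  "continuous_on S f \<Longrightarrow> continuous_on S (\<lambda>x. ee (f x))"
  unfolding ee_def by (intro continuous_intros)

lemma measurable_ee [measurable]: "ee \<in> borel_measurable borel"
  by (intro borel_measurable_continuous_onI continuous_intros)

lemma norm_one_minus_ee_le: "norm (1 - ee x) \<le> 2 * pi * \<bar>x\<bar>"
proof -
  have "norm (1 - ee x) = 2 * \<bar>sin (pi * x)\<bar>"
  proof (rule power2_eq_imp_eq)
    have "(norm (1 - ee x))\<^sup>2 = 2 - 2 * cos (2 * (pi * x))"
      using sin_cos_squared_add[of "2 * (pi * x)"]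
      unfolding cmod_power2 ee_def by (simp add: power2_diff mult.assoc)
    then show "(norm (1 - ee x))\<^sup>2 = (2 * \<bar>sin (pi * x)\<bar>)\<^sup>2"
      using cos_double_sin[of "pi * x"] by (simp add: power_mult_distrib)
  qed auto
  also have "\<dots> \<le> 2 * \<bar>pi * x\<bar>"
    using abs_sin_x_le_abs_x by (intro mult_left_mono) auto
  finally show ?thesis by (simp add: abs_mult)
qed

text \<open>The trivial bound 2 is enlarged to 2 pi so that one constant serves both regimes. Only
  \<open>H\<close> enters the bound, so it is uniform over the steps that are averaged.\<close>

lemma norm_one_minus_ee_le_min:
  assumes "0 \<le> h" "h \<le> H"
  shows "norm (1 - ee (h * x)) \<le> 2 * pi * min 1 (H * \<bar>x\<bar>)"
proof -
  have "norm (1 - ee (h * x)) \<le> 2"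
    using norm_triangle_ineq4[of 1 "ee (h * x)"] by simp
  also have "2 \<le> 2 * pi" using pi_gt3 by simp
  finally have 1: "norm (1 - ee (h * x)) \<le> 2 * pi" .
  have "norm (1 - ee (h * x)) \<le> 2 * pi * (h * \<bar>x\<bar>)"
    using norm_one_minus_ee_le[of "h * x"] assms by (simp add: abs_mult)
  also have "\<dots> \<le> 2 * pi * (H * \<bar>x\<bar>)"
    using assms by (intro mult_left_mono mult_right_mono) auto
  finally show ?thesis using 1 by (simp add: min_def)
qed

lemma has_integral_ee_unit_interval:
  fixes m l :: int
  shows "((\<lambda>x. ee (of_int m * x)) has_integral of_bool (m = 0)) {of_int l..of_int l + 1}"
proof (cases "m = 0")
  case True
  then show ?thesis
    using has_integral_const_real[of "1 :: complex" "of_int l" "of_int l + 1"] by simp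
next
  case False
  define c where "c = 2 * pi * of_int m * \<i>"
  have "c \<noteq> 0" using False by (simp add: c_def)
  have ee: "ee (of_int m * x) = exp (c * of_real x)" for x
    by (simp add: ee_def c_def cis_conv_exp mult_ac)
  have "((\<lambda>x. exp (c * of_real x)) has_integral
         (exp (c * of_real (of_int l + 1)) / c - exp (c * of_real (of_int l)) / c))
        {of_int l..of_int l + 1}"
  proof (rule fundamental_theorem_of_calculus)
    fix x :: real
    have "((\<lambda>z. exp (c * z) / c) has_field_derivative exp (c * of_real x)) (at (of_real x))"
      using \<open>c \<noteq> 0\<close> by (auto intro!: derivative_eq_intros)
    then show "((\<lambda>x. exp (c * of_real x) / c) has_vector_derivative exp (c * of_real x))
         (at x within {of_int l..of_int l + 1})"
      by (intro has_vector_derivative_real_field has_vector_derivative_at_within)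
        (simp add: has_vector_derivative_real_field)
  qed simp
  also have "exp (c * of_real (of_int l + 1)) = 1"
    using ee[of "of_int l + 1"] ee_of_int[of "m * (l + 1)"] by simp
  also have "exp (c * of_real (of_int l)) = 1"
    using ee[of "of_int l"] ee_of_int[of "m * l"] by simp
  finally show ?thesis using False by (simp add: ee)
qed

section \<open>Parseval over a period, and periodic functions against decaying weights\<close>

text \<open>Parseval's identity by orthogonality of the characters. The period is
  \<open>[l, l + 1]\<close> for every integer \<open>l\<close> because the line is later cut into
  unit intervals.\<close>

lemma nn_integral_norm_square_trig_sum:
  fixes a :: "int \<Rightarrow> complex" and l :: int
  assumes "finite B"
  shows "(\<integral>\<^sup>+x. ennreal ((norm (\<Sum>k\<in>B. a k * ee (of_int k * x)))\<^sup>2) * indicator {of_int l..of_int l + 1} x \<partial>lborel)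
         = ennreal (\<Sum>k\<in>B. (norm (a k))\<^sup>2)"
proof (rule nn_integral_has_integral_lebesgue')
  let ?A = "\<lambda>x. \<Sum>k\<in>B. a k * ee (of_int k * x)"
  have "((\<lambda>x. \<Sum>k\<in>B. \<Sum>m\<in>B. (a k * cnj (a m)) * ee (of_int (k - m) * x)) has_integral
        (\<Sum>k\<in>B. \<Sum>m\<in>B. (a k * cnj (a m)) * of_bool (k - m = 0))) {of_int l..of_int l + 1}"
    by (intro has_integral_sum assms has_integral_mult_right has_integral_ee_unit_interval)
  moreover have "(\<Sum>k\<in>B. \<Sum>m\<in>B. (a k * cnj (a m)) * ee (of_int (k - m) * x)) = of_real ((norm (?A x))\<^sup>2)" for x
  proof -
    have "of_real ((norm (?A x))\<^sup>2) = ?A x * cnj (?A x)"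
      by (rule complex_norm_square)
    also have "\<dots> = (\<Sum>k\<in>B. \<Sum>m\<in>B. (a k * cnj (a m)) * ee (of_int (k - m) * x))"
    proof -
      have "ee (of_int (k - m) * x) = ee (of_int k * x) * ee (- (of_int m * x))" for k m
        by (simp add: left_diff_distrib flip: ee_add)
      then show ?thesis by (simp add: sum_product cnj_ee mult_ac)
    qed
    finally show ?thesis ..
  qed
  moreover have "(\<Sum>k\<in>B. \<Sum>m\<in>B. (a k * cnj (a m)) * of_bool (k - m = 0)) = of_real (\<Sum>k\<in>B. (norm (a k))\<^sup>2)"
  proof -
    have "(\<Sum>m\<in>B. (a k * cnj (a m)) * of_bool (k - m = 0)) = of_real ((norm (a k))\<^sup>2)" if "k \<in> B" for k
    proof -
      have "(\<Sum>m\<in>B. (a k * cnj (a m)) * of_bool (k - m = 0)) = (\<Sum>m\<in>B. if m = k then a k * cnj (a k) else 0)"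
        by (intro sum.cong) auto
      then show ?thesis using that assms by (simp add: complex_norm_square del: of_real_power)
    qed
    then show ?thesis by simp
  qed
  ultimately have "((\<lambda>x. complex_of_real ((norm (?A x))\<^sup>2)) has_integral of_real (\<Sum>k\<in>B. (norm (a k))\<^sup>2)) {of_int l..of_int l + 1}"
    by simp
  from has_integral_Re[OF this] show "((\<lambda>x. (norm (?A x))\<^sup>2) has_integral (\<Sum>k\<in>B. (norm (a k))\<^sup>2)) {of_int l..of_int l + 1}"
    by simp
qed auto

text \<open>Reduces an integral over the line to bounds over single periods: on
  \<open>[n, n + 1]\<close> and \<open>[- n - 1, - n]\<close> the weight is at most
  \<open>w n\<close>, and these two intervals account for the factor 2.\<close>

lemma nn_integral_weight_le:
  fixes \<Phi> w :: "real \<Rightarrow> real"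
  assumes [measurable]: "\<Phi> \<in> borel_measurable borel"
    and \<Phi>: "\<And>x. 0 \<le> \<Phi> x" and I: "0 \<le> I"
    and le: "\<And>l::int. (\<integral>\<^sup>+x. ennreal (\<Phi> x) * indicator {of_int l..of_int l + 1} x \<partial>lborel) \<le> ennreal I"
    and w: "\<And>x. 0 \<le> x \<Longrightarrow> 0 \<le> w x" "\<And>x y. 0 \<le> x \<Longrightarrow> x \<le> y \<Longrightarrow> w y \<le> w x"
    and summ: "summable (\<lambda>n. w (real n))"
  shows "(\<integral>\<^sup>+x. ennreal (\<Phi> x * w \<bar>x\<bar>) \<partial>lborel) \<le> ennreal (2 * I * (\<Sum>n. w (real n)))"
proof -
  define J where "J = (\<lambda>l x. ennreal (\<Phi> x) * indicator {real_of_int l..of_int l + 1} x)"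
  have [measurable]: "J l \<in> borel_measurable borel" for l unfolding J_def by measurable
  have "(\<integral>\<^sup>+x. ennreal (\<Phi> x * w \<bar>x\<bar>) \<partial>lborel) \<le>
        (\<integral>\<^sup>+x. (\<Sum>n. ennreal (w (real n)) * (J (int n) x + J (- int n - 1) x)) \<partial>lborel)"
  proof (rule nn_integral_mono)
    fix x :: real
    define n where "n = nat \<lfloor>\<bar>x\<bar>\<rfloor>"
    have n: "real n \<le> \<bar>x\<bar>" "\<bar>x\<bar> \<le> real n + 1"
      unfolding n_def by linarith+
    have "ennreal (\<Phi> x * w \<bar>x\<bar>) \<le> ennreal (w (real n)) * ennreal (\<Phi> x)"
      using n w \<Phi> by (subst ennreal_mult[symmetric]) (auto intro!: ennreal_leI mult_left_mono simp: mult.commute)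
    also have "ennreal (\<Phi> x) \<le> J (int n) x + J (- int n - 1) x"
      using n by (cases "x \<ge> 0") (auto simp: J_def indicator_def)
    finally have "ennreal (\<Phi> x * w \<bar>x\<bar>) \<le> ennreal (w (real n)) * (J (int n) x + J (- int n - 1) x)"
      by (simp add: mult_left_mono)
    also have "\<dots> \<le> (\<Sum>n. ennreal (w (real n)) * (J (int n) x + J (- int n - 1) x))"
      using sum_le_suminf[of "\<lambda>n. ennreal (w (real n)) * (J (int n) x + J (- int n - 1) x)" "{n}"] by simp
    finally show "ennreal (\<Phi> x * w \<bar>x\<bar>) \<le> \<dots>" .
  qed
  also have "\<dots> = (\<Sum>n. ennreal (w (real n)) * ((\<integral>\<^sup>+x. J (int n) x \<partial>lborel) + (\<integral>\<^sup>+x. J (- int n - 1) x \<partial>lborel)))"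
    by (subst nn_integral_suminf) (auto simp: nn_integral_cmult nn_integral_add)
  also have "\<dots> \<le> (\<Sum>n. ennreal (w (real n)) * (ennreal I + ennreal I))"
  proof (intro suminf_le mult_left_mono add_mono)
    show "(\<integral>\<^sup>+x. J (int n) x \<partial>lborel) \<le> ennreal I" for n
      unfolding J_def by (rule le)
    show "(\<integral>\<^sup>+x. J (- int n - 1) x \<partial>lborel) \<le> ennreal I" for n
      unfolding J_def by (rule le)
  qed auto
  also have "\<dots> = (\<Sum>n. ennreal (2 * I * w (real n)))"
    using I w by (simp add: ennreal_mult'' mult_ac flip: ennreal_plus)
  also have "\<dots> = ennreal (\<Sum>n. 2 * I * w (real n))"
    using I w summ by (intro suminf_ennreal2) auto
  also have "(\<Sum>n. 2 * I * w (real n)) = 2 * I * (\<Sum>n. w (real n))"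
    by (rule suminf_mult[OF summ])
  finally show ?thesis .
qed

text \<open>Comparison with the telescoping series of \<open>R^2 / (R + n)\<close>. The order
  \<open>R\<close> is the price of integrating a periodic function against an envelope of width
  \<open>R\<close>.\<close>

lemma suminf_shifted_square_le:
  fixes R :: real
  assumes "R \<ge> 1"
  shows "summable (\<lambda>n. 1 / (1 + real n / R)\<^sup>2)" "(\<Sum>n. 1 / (1 + real n / R)\<^sup>2) \<le> 2 * R"
proof -
  define b where "b = (\<lambda>n. R\<^sup>2 / (R + real n))"
  have le: "1 / (1 + real (Suc n) / R)\<^sup>2 \<le> b n - b (Suc n)" for n
  proof -
    have pos: "R + real n > 0" "R + real (Suc n) > 0" using assms by auto
    have "1 / (1 + real (Suc n) / R)\<^sup>2 = R\<^sup>2 / ((R + real (Suc n)) * (R + real (Suc n)))"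
      using assms by (simp add: field_simps power2_eq_square)
    also have "\<dots> \<le> R\<^sup>2 / ((R + real n) * (R + real (Suc n)))"
      using pos by (intro divide_left_mono mult_right_mono mult_pos_pos) auto
    also have "\<dots> = b n - b (Suc n)"
      using pos by (simp add: b_def field_simps)
    finally show ?thesis .
  qed
  have "b \<longlonglongrightarrow> 0" unfolding b_def by real_asymp
  then have S: "(\<lambda>n. b n - b (Suc n)) sums (b 0 - 0)"
    by (rule telescope_sums')
  have 1: "summable (\<lambda>n. 1 / (1 + real (Suc n) / R)\<^sup>2)"
    by (rule summable_comparison_test'[OF sums_summable[OF S], of 0]) (use le in simp)
  show 2: "summable (\<lambda>n. 1 / (1 + real n / R)\<^sup>2)"
    using 1 by (subst (asm) summable_Suc_iff)
  have "(\<Sum>n. 1 / (1 + real n / R)\<^sup>2) = 1 + (\<Sum>n. 1 / (1 + real (Suc n) / R)\<^sup>2)"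
    using suminf_split_head[OF 2] by simp
  also have "(\<Sum>n. 1 / (1 + real (Suc n) / R)\<^sup>2) \<le> b 0 - 0"
    using suminf_le[OF le 1 sums_summable[OF S]] sums_unique[OF S] by simp
  also have "b 0 = R" using assms by (simp add: b_def power2_eq_square)
  finally show "(\<Sum>n. 1 / (1 + real n / R)\<^sup>2) \<le> 2 * R" using assms by simp
qed

lemma nn_integral_powr_tail_finite:
  fixes g :: real
  assumes "g > 1"
  shows "(\<integral>\<^sup>+x. ennreal ((1 + \<bar>x\<bar>) powr (- g)) \<partial>lborel) < \<infinity>"
proof -
  have "summable (\<lambda>n. real (Suc n) powr (- g))"
    using assms by (subst summable_Suc_iff) (simp add: summable_real_powr_iff)
  then have s: "summable (\<lambda>n. (1 + real n) powr (- g))" by (simp add: add.commute)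
  have "(\<integral>\<^sup>+x. ennreal (1 * (1 + \<bar>x\<bar>) powr (- g)) \<partial>lborel)
      \<le> ennreal (2 * 1 * (\<Sum>n. (1 + real n) powr (- g)))"
    using s assms by (intro nn_integral_weight_le) (auto intro!: powr_mono2')
  then show ?thesis by (auto simp: le_less_trans)
qed

section \<open>The self-dual Gaussian\<close>

definition gauss :: "real \<Rightarrow> real" where
  "gauss t = exp (- (pi * t\<^sup>2))"

lemma gauss_nonneg [simp]: "gauss t \<ge> 0" and gauss_le_1: "gauss t \<le> 1"
  and gauss_minus [simp]: "gauss (- t) = gauss t" and gauss_0 [simp]: "gauss 0 = 1"
  by (auto simp: gauss_def)

lemma continuous_on_gauss [continuous_intros]:
  "continuous_on S f \<Longrightarrow> continuous_on S (\<lambda>x. gauss (f x))"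
  unfolding gauss_def by (intro continuous_intros)

lemma measurable_gauss [measurable]: "gauss \<in> borel_measurable borel"
  by (intro borel_measurable_continuous_onI continuous_intros)

text \<open>Rescaling by \<open>sqrt (2 * pi)\<close> turns the characteristic function of the
  standard normal law into this transform. The constant pi in \<open>gauss\<close> is the one for
  which the transform is again \<open>gauss\<close>.\<close>

lemma has_bochner_integral_gauss: "has_bochner_integral lborel (\<lambda>x. gauss x * ee (x * y)) (gauss y)"
  and integrable_gauss: "integrable lborel gauss"
proof -
  have d: "std_normal_density (sqrt (2 * pi) * x) = gauss x / sqrt (2 * pi)" for x
    by (simp add: std_normal_density_def gauss_def power_mult_distrib)
  have "integrable lborel std_normal_density" by simp
  then have "integrable lborel (\<lambda>x. sqrt (2 * pi) * std_normal_density (0 + sqrt (2 * pi) * x))"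
    by (intro integrable_mult_right lborel_integrable_real_affine) auto
  then show i: "integrable lborel gauss" by (simp add: d)
  have int: "integrable lborel (\<lambda>x. gauss x * ee (x * y))"
    by (rule Bochner_Integration.integrable_bound[OF i]) (auto simp: norm_mult)
  have "complex_of_real (exp (- ((sqrt (2 * pi) * y)\<^sup>2) / 2)) = char std_normal_distribution (sqrt (2 * pi) * y)"
    by (simp add: char_std_normal_distribution)
  also have "\<dots> = (\<integral>x. std_normal_density x *\<^sub>R iexp (sqrt (2 * pi) * y * x) \<partial>lborel)"
    unfolding char_def by (subst integral_density) (auto simp: normal_density_nonneg)
  also have "\<dots> = sqrt (2 * pi) *\<^sub>R (\<integral>x. std_normal_density (0 + sqrt (2 * pi) * x) *\<^sub>R
      iexp (sqrt (2 * pi) * y * (0 + sqrt (2 * pi) * x)) \<partial>lborel)"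
    by (subst lborel_integral_real_affine[where c = "sqrt (2 * pi)" and t = 0]) auto
  also have "\<dots> = (\<integral>x. gauss x * ee (x * y) \<partial>lborel)"
  proof -
    have "sqrt (2 * pi) * y * (sqrt (2 * pi) * x) = 2 * pi * (x * y)" for x
      by (simp add: algebra_simps)
    then have e: "iexp (sqrt (2 * pi) * y * (0 + sqrt (2 * pi) * x)) = ee (x * y)" for x
      by (simp only: add_0) (simp add: ee_def cis_conv_exp)
    have "std_normal_density (0 + sqrt (2 * pi) * x) *\<^sub>R iexp (sqrt (2 * pi) * y * (0 + sqrt (2 * pi) * x))
        = (gauss x * ee (x * y)) /\<^sub>R sqrt (2 * pi)" for x
      unfolding e by (simp add: d) (simp add: scaleR_conv_of_real field_simps)
    then show ?thesis by (simp add: integral_scaleR_right)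
  qed
  finally have "(\<integral>x. gauss x * ee (x * y) \<partial>lborel) = gauss y"
    by (simp add: gauss_def power_mult_distrib)
  then show "has_bochner_integral lborel (\<lambda>x. gauss x * ee (x * y)) (gauss y)"
    using int by (simp add: has_bochner_integral_iff)
qed

section \<open>Fourier inversion\<close>

text \<open>The closed intervals generate the Borel sets and are stable under intersection, so a
  pi-lambda induction carries vanishing integrals to all Borel sets. Vanishing outside
  \<open>{c..d}\<close> makes the integral over the whole line an interval integral, which the
  complement step needs.\<close>

lemma AE_eq_0_of_interval_integrals:
  fixes h :: "real \<Rightarrow> complex"
  assumes h: "integrable lborel h"
    and int: "\<And>a b. (LINT x:{a..b}|lborel. h x) = 0"
    and outside: "\<And>x. x \<notin> {c..d} \<Longrightarrow> h x = 0"
  shows "AE x in lborel. h x = 0"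
proof (rule sigma_finite_measure.density_zero[OF lborel.sigma_finite_measure_axioms h])
  fix A :: "real set" assume "A \<in> sets lborel"
  then have A: "A \<in> sigma_sets UNIV (range (\<lambda>(a, b). {a..b}))"
    by (simp add: borel_eq_atLeastAtMost)
  have sets: "B \<in> sets lborel" if "B \<in> sigma_sets UNIV (range (\<lambda>(a::real, b). {a..b}))" for B
    using that by (simp add: borel_eq_atLeastAtMost)
  have si: "set_integrable lborel B h" if "B \<in> sets lborel" for B
    unfolding set_integrable_def using that h by (intro integrable_mult_indicator) auto
  have stable: "Int_stable (range (\<lambda>(a::real, b). {a..b}))"
    by (auto simp: Int_stable_def)
  have sub: "range (\<lambda>(a::real, b). {a..b}) \<subseteq> Pow UNIV" by simp
  from stable sub A show "(LINT x:A|lborel. h x) = 0"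
  proof (induct rule: sigma_sets_induct_disjoint)
    case (basic A)
    then show ?case using int by auto
  next
    case (compl A)
    have "(LINT x:UNIV|lborel. h x) = (LINT x:{c..d}|lborel. h x)"
      unfolding set_lebesgue_integral_def
      by (intro Bochner_Integration.integral_cong) (use outside in \<open>auto simp: indicator_def\<close>)
    moreover have "(LINT x:A \<union> (UNIV - A)|lborel. h x) = (LINT x:A|lborel. h x) + (LINT x:UNIV - A|lborel. h x)"
      using compl sets by (intro set_integral_Un si) auto
    ultimately show ?case using int compl by simp
  next
    case (union A)
    have "(LINT x:(\<Union>i. A i)|lborel. h x) = (\<Sum>i. (LINT x:(A i)|lborel. h x))"
    proof -
      have "A i \<in> sets lborel" for i
        using union(2) sets by blast
      then show ?thesis
        using union(1) by (intro lebesgue_integral_countable_add si sets.countable_UN)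
          (auto simp: disjoint_family_on_def)
    qed
    then show ?case using union by simp
  qed (auto simp: set_lebesgue_integral_def)
qed

text \<open>The transform \<open>fourier\<close>, but over \<open>lborel\<close>, where Borel
  measurability and Fubini on the product measure are at hand; \<open>fourier_eq_ft\<close> connects
  the two.\<close>

definition ft :: "(real \<Rightarrow> complex) \<Rightarrow> real \<Rightarrow> complex" where
  "ft f \<xi> = (\<integral>x. f x * ee (- (x * \<xi>)) \<partial>lborel)"

definition ift :: "(real \<Rightarrow> complex) \<Rightarrow> real \<Rightarrow> complex" where
  "ift F x = (\<integral>\<xi>. F \<xi> * ee (x * \<xi>) \<partial>lborel)"

lemma integrable_times_ee:
  assumes "integrable lborel f"
  shows "integrable lborel (\<lambda>x. f x * ee (c * x))" "integrable lborel (\<lambda>x. f x * ee (- (x * c)))"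
proof -
  have [measurable]: "f \<in> borel_measurable borel" using assms by auto
  show "integrable lborel (\<lambda>x. f x * ee (c * x))" "integrable lborel (\<lambda>x. f x * ee (- (x * c)))"
    by (rule Bochner_Integration.integrable_bound[OF assms]; simp add: norm_mult)+
qed

lemma norm_ift_le: "norm (ift F x) \<le> (\<integral>\<xi>. norm (F \<xi>) \<partial>lborel)"
  using integral_norm_bound[of lborel "\<lambda>\<xi>. F \<xi> * ee (x * \<xi>)"] by (simp add: ift_def norm_mult)

lemma continuous_ift:
  assumes "integrable lborel F"
  shows "continuous_on UNIV (ift F)"
  unfolding continuous_on_sequentially comp_def ift_def
proof safe
  fix X :: "nat \<Rightarrow> real" and x assume X: "X \<longlonglongrightarrow> x"
  have [measurable]: "F \<in> borel_measurable borel" using assms by auto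
  show "(\<lambda>n. \<integral>\<xi>. F \<xi> * ee (X n * \<xi>) \<partial>lborel) \<longlonglongrightarrow> (\<integral>\<xi>. F \<xi> * ee (x * \<xi>) \<partial>lborel)"
  proof (rule integral_dominated_convergence[where w = "\<lambda>\<xi>. norm (F \<xi>)"])
    show "AE \<xi> in lborel. (\<lambda>n. F \<xi> * ee (X n * \<xi>)) \<longlonglongrightarrow> F \<xi> * ee (x * \<xi>)"
      using X unfolding ee_def cis_conv_exp by (intro AE_I2 tendsto_intros)
  qed (use assms in \<open>auto simp: norm_mult\<close>)
qed

lemma ft_conv_ift: "ft f \<xi> = ift f (- \<xi>)"
  by (simp add: ft_def ift_def mult.commute)

lemma continuous_ft:
  assumes "integrable lborel f"
  shows "continuous_on UNIV (ft f)"
proof -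
  have "continuous_on UNIV (\<lambda>\<xi>. ift f (- \<xi>))"
    by (rule continuous_on_compose2[OF continuous_ift[OF assms]]) (auto intro: continuous_intros)
  then show ?thesis by (simp add: ft_conv_ift[abs_def])
qed

lemma measurable_ift [measurable]: "integrable lborel F \<Longrightarrow> ift F \<in> borel_measurable borel"
  by (intro borel_measurable_continuous_onI continuous_ift)

lemma measurable_ft [measurable]: "integrable lborel F \<Longrightarrow> ft F \<in> borel_measurable borel"
  by (intro borel_measurable_continuous_onI continuous_ft)

lemma integral_gauss_scaled:
  assumes "\<epsilon> > 0"
  shows "(\<integral>\<xi>. gauss (\<epsilon> * \<xi>) * ee (\<xi> * y) \<partial>lborel) = gauss (y / \<epsilon>) / \<epsilon>"
proof -
  have "complex_of_real (gauss (y / \<epsilon>)) = (\<integral>x. gauss x * ee (x * (y / \<epsilon>)) \<partial>lborel)"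
    using has_bochner_integral_gauss[of "y / \<epsilon>"] by (simp add: has_bochner_integral_iff)
  also have "\<dots> = \<epsilon> *\<^sub>R (\<integral>\<xi>. gauss (0 + \<epsilon> * \<xi>) * ee ((0 + \<epsilon> * \<xi>) * (y / \<epsilon>)) \<partial>lborel)"
    using assms by (subst lborel_integral_real_affine[where c = \<epsilon> and t = 0]) auto
  finally show ?thesis using assms by (simp add: scaleR_conv_of_real field_simps)
qed

lemma integrable_gauss_scaled:
  assumes "\<epsilon> \<noteq> 0"
  shows "integrable lborel (\<lambda>x. gauss (t + \<epsilon> * x))"
  using lborel_integrable_real_affine[OF integrable_gauss assms] .

lemma integral_gauss: "(\<integral>x. gauss x \<partial>lborel) = 1"
  using has_bochner_integral_gauss[of 0]
  by (simp add: has_bochner_integral_iff)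

text \<open>The product majorant that justifies the exchanges of integrals in the mollification and
  the inversion below.\<close>

lemma integrable_product_bound:
  fixes f :: "real \<Rightarrow> complex" and g :: "real \<Rightarrow> real" and K :: "real \<Rightarrow> real \<Rightarrow> complex"
  assumes f: "integrable lborel f" and g: "integrable lborel g"
    and [measurable]: "case_prod K \<in> borel_measurable (lborel \<Otimes>\<^sub>M lborel)"
    and K: "\<And>x y. norm (K x y) \<le> norm (f x) * g y"
  shows "integrable (lborel \<Otimes>\<^sub>M lborel) (case_prod K)"
proof (rule Bochner_Integration.integrable_bound)
  have [measurable]: "f \<in> borel_measurable borel" "g \<in> borel_measurable borel"
    using f g by auto
  show "integrable (lborel \<Otimes>\<^sub>M lborel) (\<lambda>(x, y). norm (f x) * g y)"
  proof (rule lborel_pair.Fubini_integrable)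
    show "integrable lborel (\<lambda>x. \<integral>y. norm (case (x, y) of (x, y) \<Rightarrow> norm (f x) * g y) \<partial>lborel)"
      using f by (simp add: abs_mult)
    show "AE x in lborel. integrable lborel (\<lambda>y. case (x, y) of (x, y) \<Rightarrow> norm (f x) * g y)"
      using g by simp
  qed measurable
  have "norm (K x y) \<le> norm (norm (f x) * g y)" for x y
    using K[of x y] by simp
  then show "AE x in lborel \<Otimes>\<^sub>M lborel. norm (case_prod K x) \<le> norm (case x of (x, y) \<Rightarrow> norm (f x) * g y)"
    by (intro AE_I2) auto
qed simp

text \<open>Damping the inverse transform by a Gaussian makes the double integral absolutely
  convergent; exchanging the order leaves the convolution of \<open>f\<close> with a Gaussian of
  width \<open>\<epsilon>\<close>.\<close>

lemma gauss_mollify: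
  assumes f: "integrable lborel f" and "\<epsilon> > 0"
  shows "(\<integral>\<xi>. ft f \<xi> * gauss (\<epsilon> * \<xi>) * ee (x * \<xi>) \<partial>lborel)
       = (\<integral>y. f y * (gauss ((x - y) / \<epsilon>) / \<epsilon>) \<partial>lborel)"
proof -
  have [measurable]: "f \<in> borel_measurable borel" using f by auto
  define K where "K = (\<lambda>y \<xi>. f y * ee (- (y * \<xi>)) * gauss (\<epsilon> * \<xi>) * ee (x * \<xi>))"
  have g: "integrable lborel (\<lambda>\<xi>. gauss (\<epsilon> * \<xi>))"
    using integrable_gauss_scaled[of \<epsilon> 0] assms by simp
  have K: "integrable (lborel \<Otimes>\<^sub>M lborel) (case_prod K)"
    by (rule integrable_product_bound[OF f g]) (auto simp: K_def norm_mult)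
  have "(\<integral>\<xi>. ft f \<xi> * gauss (\<epsilon> * \<xi>) * ee (x * \<xi>) \<partial>lborel) = (\<integral>\<xi>. (\<integral>y. K y \<xi> \<partial>lborel) \<partial>lborel)"
    unfolding K_def ft_def
    by (intro Bochner_Integration.integral_cong refl) simp
  also have "\<dots> = (\<integral>y. (\<integral>\<xi>. K y \<xi> \<partial>lborel) \<partial>lborel)"
    by (rule lborel_pair.Fubini_integral[OF K])
  also have "\<dots> = (\<integral>y. f y * (gauss ((x - y) / \<epsilon>) / \<epsilon>) \<partial>lborel)"
  proof (intro Bochner_Integration.integral_cong refl)
    fix y
    have e: "ee (- (y * \<xi>)) * ee (x * \<xi>) = ee (\<xi> * (x - y))" for \<xi>
      by (simp add: algebra_simps flip: ee_add)
    have "K y \<xi> = f y * (gauss (\<epsilon> * \<xi>) * ee (\<xi> * (x - y)))" for \<xi>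
      by (simp add: K_def mult_ac flip: e)
    then show "(\<integral>\<xi>. K y \<xi> \<partial>lborel) = f y * (gauss ((x - y) / \<epsilon>) / \<epsilon>)"
      using integral_gauss_scaled[OF assms(2), of "x - y"] by simp
  qed
  finally show ?thesis .
qed

text \<open>The end points are excluded because the limit there is in general one half rather than
  the indicator; they form a null set.\<close>

lemma LIMSEQ_gauss_average:
  assumes y: "y \<noteq> a" "y \<noteq> b"
  shows "(\<lambda>n. \<integral>t. indicat_real {a..b} (y + t / real (Suc n)) * gauss t \<partial>lborel) \<longlonglongrightarrow> indicat_real {a..b} y"
proof -
  have "(\<lambda>n. \<integral>t. indicat_real {a..b} (y + t / real (Suc n)) * gauss t \<partial>lborel)
      \<longlonglongrightarrow> (\<integral>t. indicat_real {a..b} y * gauss t \<partial>lborel)"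
  proof (rule integral_dominated_convergence[where w = gauss])
    show "AE t in lborel. (\<lambda>n. indicat_real {a..b} (y + t / real (Suc n)) * gauss t)
        \<longlonglongrightarrow> indicat_real {a..b} y * gauss t"
    proof (intro AE_I2 tendsto_mult tendsto_const)
      fix t
      have lim: "(\<lambda>n. y + t / real (Suc n)) \<longlonglongrightarrow> y" by real_asymp
      have "y \<in> {a<..<b} \<or> y \<in> - {a..b}" using y by auto
      then have "\<forall>\<^sub>F n in sequentially. indicat_real {a..b} (y + t / real (Suc n)) = indicat_real {a..b} y"
      proof
        assume "y \<in> {a<..<b}"
        with topological_tendstoD[OF lim open_greaterThanLessThan this] show ?thesis
          by (auto elim!: eventually_mono)
      next
        assume y: "y \<in> - {a..b}"
        have "open (- {a..b})" by auto
        with topological_tendstoD[OF lim this y] y show ?thesis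
          by (auto elim!: eventually_mono)
      qed
      then show "(\<lambda>n. indicat_real {a..b} (y + t / real (Suc n))) \<longlonglongrightarrow> indicat_real {a..b} y"
        by (rule tendsto_eventually)
    qed
  qed (auto simp: integrable_gauss indicator_def)
  then show ?thesis by (simp add: integral_gauss)
qed

lemma integral_gauss_average:
  assumes "\<epsilon> > 0"
  shows "(\<integral>x. indicat_real {a..b} x * (gauss ((x - y) / \<epsilon>) / \<epsilon>) \<partial>lborel)
    = (\<integral>t. indicat_real {a..b} (y + \<epsilon> * t) * gauss t \<partial>lborel)"
  using assms by (subst lborel_integral_real_affine[where c = \<epsilon> and t = y]) (auto simp: mult.commute)

text \<open>The damped inverse integrals \<open>G n\<close> converge pointwise to
  \<open>ift (ft f)\<close>. Testing them against an interval moves the Gaussian from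
  \<open>f\<close>, which is only integrable, to the indicator, where its limit is elementary. So
  \<open>f\<close> and \<open>ift (ft f)\<close> have equal integrals over all intervals.\<close>

theorem fourier_inversion:
  assumes f: "integrable lborel f" and F: "integrable lborel (ft f)"
  shows "AE x in lborel. f x = ift (ft f) x"
proof -
  have [measurable]: "f \<in> borel_measurable borel" using f by auto
  have [measurable]: "ft f \<in> borel_measurable borel" "ift (ft f) \<in> borel_measurable borel" using f F by auto
  define G where "G = (\<lambda>n x. \<integral>\<xi>. ft f \<xi> * gauss ((1 / real (Suc n)) * \<xi>) * ee (x * \<xi>) \<partial>lborel)"
  have [measurable]: "G n \<in> borel_measurable borel" for n
    unfolding G_def by measurable
  have Gbound: "norm (G n x) \<le> (\<integral>\<xi>. norm (ft f \<xi>) \<partial>lborel)" for n x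
    unfolding G_def
    by (rule order_trans[OF integral_norm_bound integral_mono'])
      (use F in \<open>auto simp: norm_mult gauss_le_1 intro!: mult_left_le\<close>)
  have Glim: "(\<lambda>n. G n x) \<longlonglongrightarrow> ift (ft f) x" for x
    unfolding G_def ift_def
  proof (rule integral_dominated_convergence[where w = "\<lambda>\<xi>. norm (ft f \<xi>)"])
    show "AE \<xi> in lborel. (\<lambda>n. ft f \<xi> * gauss (1 / real (Suc n) * \<xi>) * ee (x * \<xi>)) \<longlonglongrightarrow> ft f \<xi> * ee (x * \<xi>)"
    proof (rule AE_I2)
      fix \<xi> :: real
      have "(\<lambda>n. 1 / real (Suc n) * \<xi>) \<longlonglongrightarrow> 0" by real_asymp
      then have "(\<lambda>n. gauss (1 / real (Suc n) * \<xi>)) \<longlonglongrightarrow> gauss 0"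
        unfolding gauss_def by (intro tendsto_intros)
      then have "(\<lambda>n. ft f \<xi> * gauss (1 / real (Suc n) * \<xi>) * ee (x * \<xi>)) \<longlonglongrightarrow> ft f \<xi> * of_real (gauss 0) * ee (x * \<xi>)"
        by (intro tendsto_intros)
      then show "(\<lambda>n. ft f \<xi> * gauss (1 / real (Suc n) * \<xi>) * ee (x * \<xi>)) \<longlonglongrightarrow> ft f \<xi> * ee (x * \<xi>)" by simp
    qed
  qed (use F in \<open>auto simp: norm_mult gauss_le_1 intro!: mult_left_le\<close>)
  have main: "(\<integral>x. indicat_real {a..b} x *\<^sub>R f x \<partial>lborel) = (\<integral>x. indicat_real {a..b} x *\<^sub>R ift (ft f) x \<partial>lborel)" for a b
  proof (rule LIMSEQ_unique)
    define J where "J = (\<lambda>n. \<integral>x. indicat_real {a..b} x *\<^sub>R G n x \<partial>lborel)"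
    show "J \<longlonglongrightarrow> (\<integral>x. indicat_real {a..b} x *\<^sub>R ift (ft f) x \<partial>lborel)"
      unfolding J_def
    proof (rule integral_dominated_convergence[where w = "\<lambda>x. indicat_real {a..b} x *\<^sub>R (\<integral>\<xi>. norm (ft f \<xi>) \<partial>lborel)"])
      show "AE x in lborel. (\<lambda>n. indicat_real {a..b} x *\<^sub>R G n x) \<longlonglongrightarrow> indicat_real {a..b} x *\<^sub>R ift (ft f) x"
        using Glim by (intro AE_I2 tendsto_intros)
      show "AE x in lborel. norm (indicat_real {a..b} x *\<^sub>R G n x) \<le> indicat_real {a..b} x *\<^sub>R (\<integral>\<xi>. norm (ft f \<xi>) \<partial>lborel)" for n
        using Gbound by (intro AE_I2) (auto simp: indicator_def)
      show "integrable lborel (\<lambda>x. indicat_real {a..b} x *\<^sub>R (\<integral>\<xi>. norm (ft f \<xi>) \<partial>lborel))"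
        using integrable_real_indicator[of "{a..b}" lborel] by (simp add: emeasure_lborel_Icc_eq)
    qed auto
    have J: "J n = (\<integral>y. f y * of_real (\<integral>t. indicat_real {a..b} (y + t / real (Suc n)) * gauss t \<partial>lborel) \<partial>lborel)" for n
    proof -
      define e where "e = 1 / real (Suc n)"
      have e: "e > 0" by (simp add: e_def)
      define K where "K = (\<lambda>y x. f y * of_real (indicat_real {a..b} x * (gauss ((x - y) / e) / e)))"
      have K: "integrable (lborel \<Otimes>\<^sub>M lborel) (case_prod K)"
      proof (rule integrable_product_bound[OF f])
        show "integrable lborel (\<lambda>x. indicat_real {a..b} x * (1 / e))"
          using integrable_real_indicator[of "{a..b}" lborel] by (simp add: emeasure_lborel_Icc_eq)
        show "norm (K y x) \<le> norm (f y) * (indicat_real {a..b} x * (1 / e))" for y x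
          using gauss_le_1[of "(x - y) / e"] e
          by (auto simp: K_def norm_mult norm_divide indicator_def divide_simps mult_left_le)
      qed (simp add: K_def)
      have "J n = (\<integral>x. (\<integral>y. K y x \<partial>lborel) \<partial>lborel)"
        unfolding J_def
      proof (intro Bochner_Integration.integral_cong refl)
        fix x
        have "G n x = (\<integral>y. f y * (gauss ((x - y) / e) / e) \<partial>lborel)"
          unfolding G_def e_def[symmetric] by (rule gauss_mollify[OF f e])
        also have "indicat_real {a..b} x *\<^sub>R \<dots> = (\<integral>y. K y x \<partial>lborel)"
          by (simp add: K_def indicator_def)
        finally show "indicat_real {a..b} x *\<^sub>R G n x = (\<integral>y. K y x \<partial>lborel)" .
      qed
      also have "\<dots> = (\<integral>y. (\<integral>x. K y x \<partial>lborel) \<partial>lborel)"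
        by (rule lborel_pair.Fubini_integral[OF K])
      also have "\<dots> = (\<integral>y. f y * of_real (\<integral>t. indicat_real {a..b} (y + t / real (Suc n)) * gauss t \<partial>lborel) \<partial>lborel)"
      proof (intro Bochner_Integration.integral_cong refl)
        fix y
        have "(\<integral>x. K y x \<partial>lborel) = f y * of_real (\<integral>x. indicat_real {a..b} x * (gauss ((x - y) / e) / e) \<partial>lborel)"
          unfolding K_def by (subst integral_mult_right_zero, subst integral_complex_of_real) (rule refl)
        then show "(\<integral>x. K y x \<partial>lborel) = f y * of_real (\<integral>t. indicat_real {a..b} (y + t / real (Suc n)) * gauss t \<partial>lborel)"
          unfolding integral_gauss_average[OF e, of a b] by (simp add: e_def)
      qed
      finally show ?thesis .
    qed
    have "J \<longlonglongrightarrow> (\<integral>y. f y * of_real (indicat_real {a..b} y) \<partial>lborel)"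
      unfolding J[abs_def]
    proof (rule integral_dominated_convergence[where w = "\<lambda>y. norm (f y)"])
      show "AE y in lborel. (\<lambda>n. f y * complex_of_real (\<integral>t. indicat_real {a..b} (y + t / real (Suc n)) * gauss t \<partial>lborel))
          \<longlonglongrightarrow> f y * of_real (indicat_real {a..b} y)"
        using AE_lborel_singleton[of a] AE_lborel_singleton[of b]
        by eventually_elim (intro tendsto_mult tendsto_const tendsto_of_real LIMSEQ_gauss_average)
      show "AE y in lborel. norm (f y * complex_of_real (\<integral>t. indicat_real {a..b} (y + t / real (Suc n)) * gauss t \<partial>lborel)) \<le> norm (f y)" for n
      proof (rule AE_I2)
        fix y
        have "\<bar>\<integral>t. indicat_real {a..b} (y + t / real (Suc n)) * gauss t \<partial>lborel\<bar> \<le> (\<integral>t. gauss t \<partial>lborel)"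
          by (rule order_trans[OF integral_abs_bound integral_mono'])
            (auto simp: integrable_gauss indicator_def)
        then show "norm (f y * complex_of_real (\<integral>t. indicat_real {a..b} (y + t / real (Suc n)) * gauss t \<partial>lborel)) \<le> norm (f y)"
          by (simp add: norm_mult integral_gauss mult_left_le)
      qed
    qed (use f in auto)
    then show "J \<longlonglongrightarrow> (\<integral>x. indicat_real {a..b} x *\<^sub>R f x \<partial>lborel)"
      by (simp add: scaleR_conv_of_real mult.commute)
  qed
  \<comment> \<open>\<open>ift (ft f)\<close> is bounded and continuous but not known to be
    integrable, so the difference is cut to \<open>[- n, n]\<close> before the interval criterion is
    applied.\<close>
  have "AE x in lborel. indicat_real {- real n..real n} x *\<^sub>R (f x - ift (ft f) x) = 0" for n
  proof (rule AE_eq_0_of_interval_integrals[where c = "- real n" and d = "real n"])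
    have i1: "integrable lborel (\<lambda>x. indicat_real {c..d} x *\<^sub>R f x)" for c d
      using f by (intro integrable_mult_indicator) auto
    have i2: "integrable lborel (\<lambda>x. indicat_real {c..d} x *\<^sub>R ift (ft f) x)" for c d
      using borel_integrable_atLeastAtMost'[OF continuous_on_subset[OF continuous_ift[OF F]], of c d]
      by (simp add: set_integrable_def)
    show "integrable lborel (\<lambda>x. indicat_real {- real n..real n} x *\<^sub>R (f x - ift (ft f) x))"
      using i1[of "- real n" "real n"] i2[of "- real n" "real n"] by (simp add: scaleR_diff_right)
    show "(LINT x:{a..b}|lborel. indicat_real {- real n..real n} x *\<^sub>R (f x - ift (ft f) x)) = 0" for a b
    proof -
      define c d where "c = max a (- real n)" and "d = min b (real n)"
      have "(LINT x:{a..b}|lborel. indicat_real {- real n..real n} x *\<^sub>R (f x - ift (ft f) x))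
          = (\<integral>x. indicat_real {c..d} x *\<^sub>R f x - indicat_real {c..d} x *\<^sub>R ift (ft f) x \<partial>lborel)"
        unfolding set_lebesgue_integral_def c_def d_def
        by (intro Bochner_Integration.integral_cong refl) (auto simp: indicator_def)
      also have "\<dots> = 0"
        using i1[of c d] i2[of c d] main[of c d] by simp
      finally show ?thesis .
    qed
  qed auto
  then have "AE x in lborel. \<forall>n. indicat_real {- real n..real n} x *\<^sub>R (f x - ift (ft f) x) = 0"
    by (subst AE_all_countable) simp
  then show ?thesis
  proof eventually_elim
    case (elim x)
    obtain n where "\<bar>x\<bar> \<le> real n" using real_arch_simple by blast
    then show ?case using elim[rule_format, of n] by (auto simp: indicator_def)
  qed
qed

section \<open>Convergence of the sums\<close>

text \<open>Here \<open>r\<close> is the reciprocal of the exponent, so \<open>r = 0\<close> is the supremum norm.\<close>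

definition wfin :: "real \<Rightarrow> real \<Rightarrow> (real \<Rightarrow> complex) \<Rightarrow> bool" where
  "wfin r \<alpha> u \<longleftrightarrow>
     (if r = 0 then \<exists>M. AE x in lborel. norm (u x) * \<bar>x\<bar> powr \<alpha> \<le> M
      else (\<integral>\<^sup>+x. ennreal ((norm (u x) * \<bar>x\<bar> powr \<alpha>) powr (1 / r)) \<partial>lborel) < \<infinity>)"

text \<open>Young's inequality with its coefficients \<open>r\<close> and \<open>1 - r\<close>
  bounded by 1. Only finiteness is at stake below, so this pointwise bound takes the place of
  Hoelder's inequality.\<close>

lemma young_powr:
  fixes a b r :: real
  assumes "0 < r" "r < 1" "0 \<le> a" "0 \<le> b"
  shows "a * b \<le> a powr (1 / r) + b powr (1 / (1 - r))"
proof -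
  have "a * b \<le> a powr (1 / r) / (1 / r) + b powr (1 / (1 - r)) / (1 / (1 - r))"
    using assms by (intro Youngs_inequality) auto
  also have "\<dots> = a powr (1 / r) * r + b powr (1 / (1 - r)) * (1 - r)" by simp
  also have "\<dots> \<le> a powr (1 / r) + b powr (1 / (1 - r))"
    using assms by (intro add_mono mult_left_le) auto
  finally show ?thesis .
qed

lemma powr_minus_le_shift:
  fixes x g :: real
  assumes "x \<ge> 1" "g \<ge> 0"
  shows "x powr (- g) \<le> 2 powr g * (1 + x) powr (- g)"
proof -
  have "(1 + x) powr g \<le> (2 * x) powr g" using assms by (intro powr_mono2) auto
  then have "(1 + x) powr g \<le> 2 powr g * x powr g" using assms by (simp add: powr_mult)
  then show ?thesis using assms by (simp add: powr_minus field_simps)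
qed

text \<open>Near 0 the weight is small, so integrability there is a hypothesis. Away from 0, Young's
  inequality splits \<open>|u|\<close> into the integrable weighted power and
  \<open>|x| powr (- alpha / (1 - r))\<close>, whose exponent exceeds 1 precisely when
  \<open>alpha > 1 - r\<close>.\<close>

lemma integrable_of_wfin:
  fixes u :: "real \<Rightarrow> complex"
  assumes [measurable]: "u \<in> borel_measurable borel"
    and loc: "(\<integral>\<^sup>+x. ennreal (norm (u x)) * indicator {-1..1} x \<partial>lborel) < \<infinity>"
    and r: "0 \<le> r" "r \<le> 1" and \<alpha>: "\<alpha> > 1 - r" and w: "wfin r \<alpha> u"
  shows "integrable lborel u"
proof -
  \<comment> \<open>One form for the three ranges of the exponent: an integrable \<open>Y\<close>
    plus a power tail. For \<open>r = 0\<close> the first part is zero; for \<open>r = 1\<close> the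
    second is, since the weight is at least 1 outside \<open>[- 1, 1]\<close>.\<close>
  have "\<exists>Y g c. Y \<in> borel_measurable borel \<and> (\<integral>\<^sup>+x. Y x \<partial>lborel) < \<infinity> \<and> g > 1 \<and> c \<ge> 0 \<and>
      (AE x in lborel. \<bar>x\<bar> > 1 \<longrightarrow> ennreal (norm (u x)) \<le> Y x + ennreal (c * (1 + \<bar>x\<bar>) powr (- g)))"
  proof -
    consider "r = 0" | "r = 1" | "0 < r" "r < 1" using r by linarith
    then show ?thesis
    proof cases
      case 1
      then obtain M where M: "AE x in lborel. norm (u x) * \<bar>x\<bar> powr \<alpha> \<le> M"
        using w by (auto simp: wfin_def)
      have "AE x in lborel. \<bar>x\<bar> > 1 \<longrightarrow> ennreal (norm (u x)) \<le> 0 + ennreal (\<bar>M\<bar> * 2 powr \<alpha> * (1 + \<bar>x\<bar>) powr (- \<alpha>))"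
        using M
      proof eventually_elim
        case (elim x)
        show ?case
        proof
          assume x: "\<bar>x\<bar> > 1"
          have "norm (u x) = (norm (u x) * \<bar>x\<bar> powr \<alpha>) * \<bar>x\<bar> powr (- \<alpha>)"
            using x by (simp add: powr_minus)
          also have "\<dots> \<le> \<bar>M\<bar> * (2 powr \<alpha> * (1 + \<bar>x\<bar>) powr (- \<alpha>))"
            using x \<alpha> 1 elim by (intro mult_mono powr_minus_le_shift) auto
          finally show "ennreal (norm (u x)) \<le> 0 + ennreal (\<bar>M\<bar> * 2 powr \<alpha> * (1 + \<bar>x\<bar>) powr (- \<alpha>))"
            by (simp add: mult.assoc ennreal_leI)
        qed
      qed
      then show ?thesis using \<alpha> 1 by (intro exI[of _ "\<lambda>x. 0"] exI[of _ \<alpha>] exI[of _ "\<bar>M\<bar> * 2 powr \<alpha>"]) auto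
    next
      case 2
      have "\<bar>x\<bar> > 1 \<longrightarrow> ennreal (norm (u x)) \<le> ennreal ((norm (u x) * \<bar>x\<bar> powr \<alpha>) powr (1 / r)) + ennreal (0 * (1 + \<bar>x\<bar>) powr (- 2))" for x
        using 2 \<alpha> by (auto intro!: ennreal_leI mult_left_le simp: ge_one_powr_ge_zero mult_le_cancel_left1)
      then show ?thesis using 2 w
        by (intro exI[of _ "\<lambda>x. ennreal ((norm (u x) * \<bar>x\<bar> powr \<alpha>) powr (1 / r))"] exI[of _ 2] exI[of _ 0])
          (auto simp: wfin_def)
    next
      case 3
      define g where "g = \<alpha> / (1 - r)"
      have "g > 1" using 3 \<alpha> by (simp add: g_def field_simps)
      have "\<bar>x\<bar> > 1 \<longrightarrow> ennreal (norm (u x)) \<le> ennreal ((norm (u x) * \<bar>x\<bar> powr \<alpha>) powr (1 / r)) + ennreal (2 powr g * (1 + \<bar>x\<bar>) powr (- g))" for x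
      proof
        assume x: "\<bar>x\<bar> > 1"
        have "norm (u x) = (norm (u x) * \<bar>x\<bar> powr \<alpha>) * \<bar>x\<bar> powr (- \<alpha>)"
          using x by (simp add: powr_minus)
        also have "\<dots> \<le> (norm (u x) * \<bar>x\<bar> powr \<alpha>) powr (1 / r) + (\<bar>x\<bar> powr (- \<alpha>)) powr (1 / (1 - r))"
          using 3 by (intro young_powr) auto
        also have "(\<bar>x\<bar> powr (- \<alpha>)) powr (1 / (1 - r)) = \<bar>x\<bar> powr (- g)"
          by (simp add: powr_powr g_def)
        also have "\<dots> \<le> 2 powr g * (1 + \<bar>x\<bar>) powr (- g)"
          using x \<open>g > 1\<close> by (intro powr_minus_le_shift) auto
        finally show "ennreal (norm (u x)) \<le> ennreal ((norm (u x) * \<bar>x\<bar> powr \<alpha>) powr (1 / r)) + ennreal (2 powr g * (1 + \<bar>x\<bar>) powr (- g))"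
          by (simp add: ennreal_leI flip: ennreal_plus)
      qed
      then show ?thesis using 3 w \<open>g > 1\<close>
        by (intro exI[of _ "\<lambda>x. ennreal ((norm (u x) * \<bar>x\<bar> powr \<alpha>) powr (1 / r))"] exI[of _ g] exI[of _ "2 powr g"])
          (auto simp: wfin_def)
    qed
  qed
  then obtain Y g c where [measurable]: "Y \<in> borel_measurable borel"
    and Y: "(\<integral>\<^sup>+x. Y x \<partial>lborel) < \<infinity>" and g: "g > 1" and c: "c \<ge> 0"
    and le: "AE x in lborel. \<bar>x\<bar> > 1 \<longrightarrow> ennreal (norm (u x)) \<le> Y x + ennreal (c * (1 + \<bar>x\<bar>) powr (- g))"
    by blast
  have "(\<integral>\<^sup>+x. ennreal (norm (u x)) \<partial>lborel) \<le>
      (\<integral>\<^sup>+x. ennreal (norm (u x)) * indicator {-1..1} x + (Y x + ennreal c * ennreal ((1 + \<bar>x\<bar>) powr (- g))) \<partial>lborel)"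
  proof (rule nn_integral_mono_AE)
    show "AE x in lborel. ennreal (norm (u x)) \<le> ennreal (norm (u x)) * indicator {-1..1} x + (Y x + ennreal c * ennreal ((1 + \<bar>x\<bar>) powr (- g)))"
      using le
    proof eventually_elim
      case (elim x)
      then show ?case using c by (cases "\<bar>x\<bar> > 1") (auto simp: indicator_def ennreal_mult)
    qed
  qed
  also have "\<dots> = (\<integral>\<^sup>+x. ennreal (norm (u x)) * indicator {-1..1} x \<partial>lborel) +
      ((\<integral>\<^sup>+x. Y x \<partial>lborel) + ennreal c * (\<integral>\<^sup>+x. ennreal ((1 + \<bar>x\<bar>) powr (- g)) \<partial>lborel))"
    by (simp add: nn_integral_add nn_integral_cmult)
  also have "\<dots> < \<infinity>"
    using loc Y nn_integral_powr_tail_finite[OF g] by (auto simp: ennreal_mult_less_top less_top)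
  finally show ?thesis by (intro integrableI_bounded) auto
qed

section \<open>Finite differences averaged over the step\<close>

text \<open>By the binomial theorem this is the alternating \<open>n\<close>-th difference of
  \<open>ift F\<close> at \<open>x\<close> with step \<open>h\<close>, normalised so that the value
  at \<open>x\<close> itself has coefficient 1.\<close>

abbreviation difference_ift :: "(real \<Rightarrow> complex) \<Rightarrow> real \<Rightarrow> nat \<Rightarrow> real \<Rightarrow> complex" where
  "difference_ift F h n x \<equiv> \<integral>\<xi>. F \<xi> * (1 - ee (h * \<xi>)) ^ n * ee (x * \<xi>) \<partial>lborel"

text \<open>All nodes \<open>k + i h\<close> with \<open>i <= n\<close> and
  \<open>0 <= h <= H\<close> lie in this interval. The division is by \<open>H\<close> and not by
  the length \<open>n H\<close> because the average is taken over \<open>h\<close>.\<close>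

abbreviation scaled_mean :: "(real \<Rightarrow> complex) \<Rightarrow> nat \<Rightarrow> real \<Rightarrow> nat \<Rightarrow> ennreal" where
  "scaled_mean g n H k \<equiv>
     \<integral>\<^sup>+x. ennreal (norm (g x) / H) * indicator {real k..real k + real n * H} x \<partial>lborel"

lemma finite_difference_ift:
  assumes F: "integrable lborel F"
  shows "(\<Sum>i\<le>n. (-1) ^ i * of_nat (n choose i) * ift F (x + real i * h))
       = difference_ift F h n x"
proof -
  have *: "F \<xi> * (1 - ee (h * \<xi>)) ^ n * ee (x * \<xi>)
      = (\<Sum>i\<le>n. ((-1) ^ i * of_nat (n choose i)) * (F \<xi> * ee ((x + real i * h) * \<xi>)))" for \<xi>
  proof -
    have "(1 - ee (h * \<xi>)) ^ n = (\<Sum>i\<le>n. of_nat (n choose i) * (- ee (h * \<xi>)) ^ i)"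
      using binomial_ring[of "- ee (h * \<xi>)" 1 n] by simp
    moreover have "ee ((x + real i * h) * \<xi>) = ee (x * \<xi>) * ee (h * \<xi>) ^ i" for i
      by (simp add: ee_power ring_distribs mult.assoc flip: ee_add)
    moreover have "(- ee (h * \<xi>)) ^ i = (-1) ^ i * ee (h * \<xi>) ^ i" for i
      by (rule power_minus)
    ultimately show ?thesis
      by (simp only: sum_distrib_left sum_distrib_right) (intro sum.cong refl, simp only: mult_ac)
  qed
  show ?thesis
    unfolding * ift_def
    by (subst Bochner_Integration.integral_sum) (auto intro!: integrable_times_ee F)
qed

text \<open>Solving the difference for its term \<open>i = 0\<close> bounds the value at
  \<open>k\<close> by the difference and the values at \<open>k + i h\<close> with
  \<open>i >= 1\<close>. Averaging over \<open>h\<close> turns the latter into integrals.\<close>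

lemma averaged_difference_bound:
  assumes F: "integrable lborel F" and "finite B" and H: "H > 0" and E: "E \<ge> 0"
    and bound: "\<And>h. 0 \<le> h \<Longrightarrow> h \<le> H \<Longrightarrow>
      (\<Sum>k\<in>B. norm (difference_ift F h n (real k))) \<le> E"
  shows "ennreal (\<Sum>k\<in>B. norm (ift F (real k))) \<le> ennreal E + 2 ^ n * (\<Sum>k\<in>B. scaled_mean (ift F) n H k)"
proof -
  define g where "g = ift F"
  have [measurable]: "g \<in> borel_measurable borel" unfolding g_def using F by measurable
  define S where "S = (\<Sum>k\<in>B. norm (g (real k)))"
  define L where "L = (\<lambda>k. scaled_mean g n H k)"
  have le: "S \<le> E + (\<Sum>k\<in>B. \<Sum>i=1..n. real (n choose i) * norm (g (real k + real i * h)))" if "0 \<le> h" "h \<le> H" for h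
  proof -
    have "norm (g (real k)) \<le> norm (difference_ift F h n (real k))
        + (\<Sum>i=1..n. real (n choose i) * norm (g (real k + real i * h)))" for k
    proof -
      have "g (real k) = difference_ift F h n (real k)
          - (\<Sum>i=1..n. (-1) ^ i * of_nat (n choose i) * g (real k + real i * h))"
      proof -
        have split: "{..n} = insert 0 {1..n}" by auto
        have "(\<Sum>i\<le>n. (-1) ^ i * of_nat (n choose i) * g (real k + real i * h))
          = g (real k) + (\<Sum>i=1..n. (-1) ^ i * of_nat (n choose i) * g (real k + real i * h))"
          unfolding split by (subst sum.insert) auto
        then show ?thesis
          using finite_difference_ift[OF F, of n "real k" h] by (simp add: g_def algebra_simps)
      qed
      then have "norm (g (real k)) \<le> norm (difference_ift F h n (real k))
          + norm (\<Sum>i=1..n. (-1) ^ i * of_nat (n choose i) * g (real k + real i * h))"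
        by (simp only: norm_triangle_ineq4)
      also have "norm (\<Sum>i=1..n. (-1) ^ i * of_nat (n choose i) * g (real k + real i * h))
          \<le> (\<Sum>i=1..n. real (n choose i) * norm (g (real k + real i * h)))"
        by (rule order_trans[OF norm_sum]) (simp add: norm_mult norm_power)
      finally show ?thesis by simp
    qed
    then have "S \<le> (\<Sum>k\<in>B. norm (difference_ift F h n (real k))
        + (\<Sum>i=1..n. real (n choose i) * norm (g (real k + real i * h))))"
      unfolding S_def by (intro sum_mono)
    then show ?thesis using bound[OF that] by (simp add: sum.distrib)
  qed
  \<comment> \<open>Substituting \<open>x = k + i h\<close> turns the average over \<open>h\<close>
    into an integral over \<open>[k, k + i H]\<close>; the Jacobian \<open>1 / i\<close> is at most
    1.\<close>
  have tm: "(\<integral>\<^sup>+h. ennreal (norm (g (real k + real i * h)) / H) * indicator {0..H} h \<partial>lborel) \<le> L k"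
    if i: "1 \<le> i" "i \<le> n" for k i
  proof -
    have "(\<integral>\<^sup>+h. ennreal (norm (g (real k + real i * h)) / H) * indicator {0..H} h \<partial>lborel)
      = (\<integral>\<^sup>+h. ennreal (norm (g (real k + real i * h)) / H) * indicator {real k..real k + real i * H} (real k + real i * h) \<partial>lborel)"
      using i by (intro nn_integral_cong) (auto simp: indicator_def zero_le_mult_iff)
    also have "\<dots> \<le> ennreal \<bar>real i\<bar> * \<dots>"
    proof -
      have "1 \<le> ennreal \<bar>real i\<bar>" using i ennreal_leI[of 1 "\<bar>real i\<bar>"] by simp
      from mult_right_mono[OF this] show ?thesis by simp
    qed
    also have "\<dots> = (\<integral>\<^sup>+x. ennreal (norm (g x) / H) * indicator {real k..real k + real i * H} x \<partial>lborel)"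
      using i by (intro nn_integral_real_affine[symmetric]) auto
    also have "\<dots> \<le> L k"
      unfolding L_def using i H by (intro nn_integral_mono mult_left_mono) (auto simp: indicator_def intro: order_trans mult_right_mono)
    finally show ?thesis .
  qed
  have S0: "S \<ge> 0" unfolding S_def by (intro sum_nonneg) auto
  \<comment> \<open>The left side does not depend on \<open>h\<close>, so it equals its own mean
    over \<open>[0, H]\<close>.\<close>
  have "ennreal S = (\<integral>\<^sup>+h. ennreal (S / H) * indicator {0..H} h \<partial>lborel)"
    using H S0 by (simp add: nn_integral_cmult ennreal_mult[symmetric])
  also have "\<dots> \<le> (\<integral>\<^sup>+h. ennreal (E / H) * indicator {0..H} h + (\<Sum>k\<in>B. \<Sum>i=1..n. of_nat (n choose i) *
        (ennreal (norm (g (real k + real i * h)) / H) * indicator {0..H} h)) \<partial>lborel)"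
  proof (rule nn_integral_mono)
    fix h
    show "ennreal (S / H) * indicator {0..H} h \<le> ennreal (E / H) * indicator {0..H} h + (\<Sum>k\<in>B. \<Sum>i=1..n. of_nat (n choose i) *
        (ennreal (norm (g (real k + real i * h)) / H) * indicator {0..H} h))"
    proof (cases "h \<in> {0..H}")
      case True
      have "S / H \<le> E / H + (\<Sum>k\<in>B. \<Sum>i=1..n. real (n choose i) * (norm (g (real k + real i * h)) / H))"
      proof -
        have "S / H \<le> (E + (\<Sum>k\<in>B. \<Sum>i=1..n. real (n choose i) * norm (g (real k + real i * h)))) / H"
          using le[of h] True H by (intro divide_right_mono) auto
        then show ?thesis by (simp add: add_divide_distrib sum_divide_distrib)
      qed
      then have "ennreal (S / H) \<le> ennreal (E / H + (\<Sum>k\<in>B. \<Sum>i=1..n. real (n choose i) * (norm (g (real k + real i * h)) / H)))"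
        by (rule ennreal_leI)
      also have "\<dots> = ennreal (E / H) + (\<Sum>k\<in>B. \<Sum>i=1..n. of_nat (n choose i) * ennreal (norm (g (real k + real i * h)) / H))"
        using H E by (simp add: sum_nonneg ennreal_mult ennreal_of_nat_eq_real_of_nat del: times_divide_eq_right flip: sum_ennreal)
      finally show ?thesis using True by simp
    qed simp
  qed
  also have "\<dots> = ennreal E + (\<Sum>k\<in>B. \<Sum>i=1..n. of_nat (n choose i) *
        (\<integral>\<^sup>+h. ennreal (norm (g (real k + real i * h)) / H) * indicator {0..H} h \<partial>lborel))"
    using H E by (simp add: nn_integral_add nn_integral_sum nn_integral_cmult ennreal_mult[symmetric])
  also have "\<dots> \<le> ennreal E + (\<Sum>k\<in>B. \<Sum>i=1..n. of_nat (n choose i) * L k)"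
    using tm by (intro add_left_mono sum_mono mult_left_mono) auto
  also have "(\<Sum>k\<in>B. \<Sum>i=1..n. of_nat (n choose i) * L k) = (\<Sum>k\<in>B. of_nat (\<Sum>i=1..n. n choose i) * L k)"
    by (simp add: sum_distrib_right)
  also have "\<dots> \<le> (\<Sum>k\<in>B. 2 ^ n * L k)"
  proof (intro sum_mono mult_right_mono)
    have "(\<Sum>i=1..n. n choose i) \<le> (\<Sum>i\<le>n. n choose i)" by (intro sum_mono2) auto
    also have "\<dots> = 2 ^ n" by (rule choose_row_sum)
    finally have "of_nat (\<Sum>i=1..n. n choose i) \<le> (of_nat (2 ^ n) :: ennreal)" by (rule of_nat_mono)
    then show "of_nat (\<Sum>i=1..n. n choose i) \<le> (2 ^ n :: ennreal)" by simp
  qed auto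
  finally show ?thesis
    unfolding S_def L_def g_def by (simp add: sum_distrib_left add_left_mono)
qed

section \<open>Summability of the means\<close>

text \<open>\<open>H\<close> is only bounded below, so that one \<open>Z\<close> serves a block of
  integers with a common \<open>H\<close>. The condition \<open>n H < 1\<close> keeps the interval
  of \<open>k\<close> inside the cell \<open>[k, k + 1)\<close>; these cells are disjoint, so the
  weighted powers over them add up to at most the whole integral.\<close>

lemma low_part_summable:
  fixes g :: "real \<Rightarrow> complex"
  assumes [measurable]: "g \<in> borel_measurable borel" and r: "0 \<le> r" "r \<le> 1"
    and w: "wfin r \<alpha> g" and \<alpha>: "\<alpha> > 0" and \<eta>: "\<eta> > 0"
    and c1: "r < 1 \<Longrightarrow> \<alpha> > 1 - r + c * r" and c2: "r = 1 \<Longrightarrow> c \<le> \<alpha>"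
  shows "\<exists>Z :: nat \<Rightarrow> ennreal. (\<Sum>k. Z (Suc k)) < \<infinity> \<and> (\<forall>k H. k \<ge> 1 \<longrightarrow> \<eta> * real k powr (- c) \<le> H \<longrightarrow> real n * H < 1 \<longrightarrow>
     scaled_mean g n H k \<le> Z k)"
proof -
  define Y where "Y = (\<lambda>x. ennreal ((norm (g x) * \<bar>x\<bar> powr \<alpha>) powr (1 / r)))"
  have [measurable]: "Y \<in> borel_measurable borel" unfolding Y_def by measurable
  define V where "V = (\<lambda>k::nat. \<integral>\<^sup>+x. Y x * indicator {real k..<real k + 1} x \<partial>lborel)"
  have V: "(\<Sum>k. V (Suc k)) < \<infinity>" if "r \<noteq> 0"
  proof -
    have "(\<Sum>k. V (Suc k)) = (\<integral>\<^sup>+x. (\<Sum>k. Y x * indicator {real (Suc k)..<real (Suc k) + 1} x) \<partial>lborel)"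
      unfolding V_def by (subst nn_integral_suminf) auto
    also have "\<dots> \<le> (\<integral>\<^sup>+x. Y x \<partial>lborel)"
    proof (rule nn_integral_mono)
      fix x
      have "disjoint_family (\<lambda>k. {real (Suc k)..<real (Suc k) + 1})"
        by (auto simp: disjoint_family_on_def)
      from suminf_indicator[OF this, of x] have "(\<Sum>k. indicator {real (Suc k)..<real (Suc k) + 1} x :: ennreal) \<le> 1"
        by (simp add: indicator_def)
      then show "(\<Sum>k. Y x * indicator {real (Suc k)..<real (Suc k) + 1} x) \<le> Y x"
        using mult_left_mono[of _ 1 "Y x"] by simp
    qed
    also have "\<dots> < \<infinity>" using w that by (simp add: wfin_def Y_def)
    finally show ?thesis .
  qed
  have ind: "indicator {real k..real k + real n * H} x \<le> (indicator {real k..<real k + 1} x :: ennreal)"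
    if "real n * H < 1" for k H x
    using that by (auto simp: indicator_def)
  have powr_summable: "(\<Sum>k. ennreal (C * real (Suc k) powr (- d))) < \<infinity>" if "d > 1" "C \<ge> 0" for C d
  proof -
    have "summable (\<lambda>k. C * real (Suc k) powr (- d))"
      using that by (intro summable_mult) (subst summable_Suc_iff, simp add: summable_real_powr_iff)
    then show ?thesis using that by (subst suminf_ennreal2) auto
  qed
  consider "r = 0" | "r = 1" | "0 < r" "r < 1" using r by linarith
  then show ?thesis
  proof cases
    case 1
    then obtain M where M: "AE x in lborel. norm (g x) * \<bar>x\<bar> powr \<alpha> \<le> M"
      using w by (auto simp: wfin_def)
    show ?thesis
    proof (intro exI[of _ "\<lambda>k. ennreal (\<bar>M\<bar> * real n * real k powr (- \<alpha>))"] conjI allI impI)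
      show "(\<Sum>k. ennreal (\<bar>M\<bar> * real n * real (Suc k) powr - \<alpha>)) < \<infinity>"
        using c1 1 by (intro powr_summable) auto
      fix k :: nat and H assume k: "1 \<le> k" and H: "\<eta> * real k powr (- c) \<le> H" "real n * H < 1"
      have "0 < \<eta> * real k powr (- c)" using k \<eta> by auto
      then have H0: "H > 0" using H by linarith
      have "scaled_mean g n H k
          \<le> (\<integral>\<^sup>+x. ennreal (\<bar>M\<bar> * real k powr (- \<alpha>) / H) * indicator {real k..real k + real n * H} x \<partial>lborel)"
        using M
      proof (intro nn_integral_mono_AE, eventually_elim)
        case (elim x)
        have "norm (g x) \<le> \<bar>M\<bar> * real k powr (- \<alpha>)" if x: "x \<ge> real k"
        proof -
          have "norm (g x) = (norm (g x) * \<bar>x\<bar> powr \<alpha>) * \<bar>x\<bar> powr (- \<alpha>)"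
            using x k by (simp add: powr_minus)
          also have "\<dots> \<le> \<bar>M\<bar> * real k powr (- \<alpha>)"
            using elim x k \<alpha> by (intro mult_mono powr_mono2') auto
          finally show ?thesis .
        qed
        then show ?case using H0 by (auto simp: indicator_def intro!: ennreal_leI divide_right_mono)
      qed
      also have "\<dots> = ennreal (\<bar>M\<bar> * real k powr (- \<alpha>) / H) * ennreal (real n * H)"
        using H0 by (simp add: nn_integral_cmult)
      also have "\<dots> = ennreal (\<bar>M\<bar> * real n * real k powr (- \<alpha>))"
        using H0 by (simp add: ennreal_mult[symmetric])
      finally show "scaled_mean g n H k
          \<le> ennreal (\<bar>M\<bar> * real n * real k powr (- \<alpha>))" .
    qed
  next
    case 2
    show ?thesis
    proof (intro exI[of _ "\<lambda>k. ennreal (1 / \<eta>) * V k"] conjI allI impI)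
      show "(\<Sum>k. ennreal (1 / \<eta>) * V (Suc k)) < \<infinity>"
        using V 2 by (simp add: ennreal_mult_less_top less_top)
      fix k :: nat and H assume k: "1 \<le> k" and H: "\<eta> * real k powr (- c) \<le> H" "real n * H < 1"
      have "0 < \<eta> * real k powr (- c)" using k \<eta> by auto
      then have H0: "H > 0" using H by linarith
      have "scaled_mean g n H k
          \<le> (\<integral>\<^sup>+x. ennreal (1 / \<eta>) * (Y x * indicator {real k..<real k + 1} x) \<partial>lborel)"
      proof (rule nn_integral_mono)
        fix x
        have "norm (g x) / H \<le> 1 / \<eta> * (norm (g x) * \<bar>x\<bar> powr \<alpha>)" if x: "x \<ge> real k"
        proof -
          have "1 \<le> real k powr (\<alpha> - c)" using c2 2 k by (intro ge_one_powr_ge_zero) auto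
          also have "\<dots> = real k powr \<alpha> * real k powr (- c)" by (simp flip: powr_add)
          also have "\<dots> \<le> x powr \<alpha> * (H / \<eta>)"
            using x k \<alpha> H \<eta> by (intro mult_mono powr_mono2) (auto simp: field_simps)
          finally have "1 / H \<le> x powr \<alpha> / \<eta>" using H0 by (simp add: field_simps)
          then have "norm (g x) * (1 / H) \<le> norm (g x) * (x powr \<alpha> / \<eta>)" by (intro mult_left_mono) auto
          then show ?thesis using x k by (simp add: mult_ac)
        qed
        then have "ennreal (norm (g x) / H) * indicator {real k..real k + real n * H} x
            \<le> ennreal (1 / \<eta> * (norm (g x) * \<bar>x\<bar> powr \<alpha>)) * indicator {real k..real k + real n * H} x"
          by (auto simp: indicator_def intro!: ennreal_leI)
        also have "\<dots> = ennreal (1 / \<eta>) * (Y x * indicator {real k..real k + real n * H} x)"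
          using \<eta> 2 by (simp add: Y_def ennreal_mult[symmetric] mult.assoc[symmetric])
        also have "\<dots> \<le> ennreal (1 / \<eta>) * (Y x * indicator {real k..<real k + 1} x)"
          using ind[OF H(2)] by (intro mult_left_mono) auto
        finally show "ennreal (norm (g x) / H) * indicator {real k..real k + real n * H} x
            \<le> ennreal (1 / \<eta>) * (Y x * indicator {real k..<real k + 1} x)" .
      qed
      also have "\<dots> = ennreal (1 / \<eta>) * V k" unfolding V_def by (subst nn_integral_cmult) auto
      finally show "scaled_mean g n H k
          \<le> ennreal (1 / \<eta>) * V k" .
    qed
  next
    case 3
    define P where "P = 1 / (1 - r)"
    have P: "P > 1" using 3 by (simp add: P_def)
    \<comment> \<open>Young's inequality leaves the constant
      \<open>(k powr (- alpha) / H) powr P\<close> on an interval of length \<open>n H\<close>. As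
      \<open>P > 1\<close>, this is largest for the smallest \<open>H\<close>, of order
      \<open>k powr (- c)\<close>, and then has order \<open>k powr (- d)\<close>.\<close>
    define d where "d = \<alpha> * P - c * (P - 1)"
    have d: "d > 1"
    proof -
      have "P * (1 - r) = 1" using 3 by (simp add: P_def)
      moreover have "P * \<alpha> > P * (1 - r + c * r)" using c1 3 P by (intro mult_strict_left_mono) auto
      ultimately have "P * \<alpha> > 1 + c * (P * r)" by (simp add: algebra_simps)
      moreover have "P * r = P - 1" using 3 by (simp add: P_def field_simps)
      ultimately show ?thesis by (simp add: d_def algebra_simps)
    qed
    define C where "C = real n * \<eta> powr (1 - P)"
    have C: "C \<ge> 0" by (simp add: C_def)
    show ?thesis
    proof (intro exI[of _ "\<lambda>k. V k + ennreal (C * real k powr (- d))"] conjI allI impI)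
      show "(\<Sum>k. V (Suc k) + ennreal (C * real (Suc k) powr (- d))) < \<infinity>"
        using V 3 powr_summable[OF d C] by (subst suminf_add[symmetric]) auto
      fix k :: nat and H assume k: "1 \<le> k" and H: "\<eta> * real k powr (- c) \<le> H" "real n * H < 1"
      have pos: "0 < \<eta> * real k powr (- c)" using k \<eta> by auto
      then have H0: "H > 0" using H by linarith
      define v where "v = (real k powr (- \<alpha>) / H) powr P"
      have "scaled_mean g n H k
          \<le> (\<integral>\<^sup>+x. Y x * indicator {real k..<real k + 1} x + ennreal v * indicator {real k..real k + real n * H} x \<partial>lborel)"
      proof (rule nn_integral_mono)
        fix x
        have "norm (g x) / H \<le> (norm (g x) * \<bar>x\<bar> powr \<alpha>) powr (1 / r) + v" if x: "x \<ge> real k"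
        proof -
          have "1 = \<bar>x\<bar> powr \<alpha> * \<bar>x\<bar> powr (- \<alpha>)" using x k by (simp add: powr_minus)
          also have "\<dots> \<le> \<bar>x\<bar> powr \<alpha> * real k powr (- \<alpha>)"
            using x k \<alpha> by (intro mult_left_mono powr_mono2') auto
          finally have "norm (g x) / H * 1 \<le> norm (g x) / H * (\<bar>x\<bar> powr \<alpha> * real k powr (- \<alpha>))"
            using H0 by (intro mult_left_mono) auto
          also have "\<dots> = (norm (g x) * \<bar>x\<bar> powr \<alpha>) * (real k powr (- \<alpha>) / H)" by simp
          also have "\<dots> \<le> (norm (g x) * \<bar>x\<bar> powr \<alpha>) powr (1 / r) + v"
            unfolding v_def P_def using 3 H0 by (intro young_powr) auto
          finally show ?thesis by simp
        qed
        then have "ennreal (norm (g x) / H) * indicator {real k..real k + real n * H} x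
            \<le> (Y x + ennreal v) * indicator {real k..real k + real n * H} x"
          by (auto simp: indicator_def Y_def v_def intro!: ennreal_leI simp flip: ennreal_plus)
        also have "\<dots> \<le> Y x * indicator {real k..<real k + 1} x + ennreal v * indicator {real k..real k + real n * H} x"
          using ind[OF H(2)] by (simp add: distrib_right mult_left_mono add_right_mono)
        finally show "ennreal (norm (g x) / H) * indicator {real k..real k + real n * H} x
            \<le> Y x * indicator {real k..<real k + 1} x + ennreal v * indicator {real k..real k + real n * H} x" .
      qed
      also have "\<dots> = V k + ennreal v * ennreal (real n * H)"
        unfolding V_def using H0 by (simp add: nn_integral_add nn_integral_cmult)
      also have "ennreal v * ennreal (real n * H) = ennreal (v * (real n * H))"
        using H0 by (simp add: v_def ennreal_mult)
      also have "v * (real n * H) \<le> C * real k powr (- d)"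
      proof -
        have "v * (real n * H) = real n * (real k powr (- \<alpha> * P) * H powr (1 - P))"
          using H0 by (simp add: v_def powr_divide powr_powr powr_diff)
        also have "\<dots> \<le> real n * (real k powr (- \<alpha> * P) * (\<eta> * real k powr (- c)) powr (1 - P))"
          using pos H P by (intro mult_left_mono powr_mono2') auto
        also have "\<dots> = C * real k powr (- d)"
          using \<eta> by (simp add: C_def powr_mult powr_powr d_def algebra_simps flip: powr_add)
        finally show ?thesis .
      qed
      finally show "scaled_mean g n H k
          \<le> V k + ennreal (C * real k powr (- d))"
        by (simp add: add_left_mono ennreal_leI)
    qed
  qed
qed

section \<open>Dual norms of trigonometric sums and the high frequency term\<close>

text \<open>\<open>Q = 1 / (1 - t)\<close> is the exponent conjugate to \<open>1 / t\<close>. For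
  \<open>Q >= 2\<close>, Parseval is interpolated with the sup bound \<open>K = card B\<close>. For
  \<open>Q < 2\<close> the sum is normalised by \<open>sqrt K\<close> and
  \<open>y powr Q <= 1 + y^2\<close> is used; the factor 2 comes from there.\<close>

lemma nn_integral_trig_sum_powr:
  fixes a :: "nat \<Rightarrow> complex" and l :: int
  assumes "finite B" "B \<noteq> {}" and a: "\<And>k. norm (a k) \<le> 1" and t: "0 \<le> t" "t < 1"
  shows "(\<integral>\<^sup>+x. ennreal (norm (\<Sum>k\<in>B. a k * ee (real k * x)) powr (1 / (1 - t))) * indicator {of_int l..of_int l + 1} x \<partial>lborel)
     \<le> ennreal (2 * (real (card B) powr max t (1 / 2)) powr (1 / (1 - t)))"
proof -
  define A where "A = (\<lambda>x. \<Sum>k\<in>B. a k * ee (real k * x))"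
  define K where "K = real (card B)"
  define Q where "Q = 1 / (1 - t)"
  have Q: "Q \<ge> 1" using t by (simp add: Q_def)
  have K: "K \<ge> 1" using assms by (simp add: K_def Suc_le_eq card_gt_0_iff)
  have [measurable]: "A \<in> borel_measurable borel" unfolding A_def by measurable
  have A_le: "norm (A x) \<le> K" for x
    unfolding A_def K_def
    by (rule order_trans[OF norm_sum], rule order_trans[OF sum_bounded_above[where K = 1]])
      (auto simp: norm_mult a)
  have sq: "(\<integral>\<^sup>+x. ennreal ((norm (A x))\<^sup>2) * indicator {of_int l..of_int l + 1} x \<partial>lborel) \<le> ennreal K"
  proof -
    have "A x = (\<Sum>k\<in>int ` B. a (nat k) * ee (of_int k * x))" for x
      unfolding A_def by (subst sum.reindex) auto
    then have "(\<integral>\<^sup>+x. ennreal ((norm (A x))\<^sup>2) * indicator {of_int l..of_int l + 1} x \<partial>lborel)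
       = ennreal (\<Sum>k\<in>int ` B. (norm (a (nat k)))\<^sup>2)"
      using nn_integral_norm_square_trig_sum[of "int ` B" "\<lambda>k. a (nat k)" l] assms by simp
    also have "(\<Sum>k\<in>int ` B. (norm (a (nat k)))\<^sup>2) \<le> real (card (int ` B)) * 1"
      using a by (intro sum_bounded_above) (auto simp: power_le_one)
    also have "\<dots> = K" by (simp add: K_def card_image)
    finally show ?thesis by (simp add: ennreal_leI)
  qed
  show ?thesis
  proof (cases "t \<ge> 1 / 2")
    case True
    then have Q2: "Q \<ge> 2" using t by (simp add: Q_def field_simps)
    have "(\<integral>\<^sup>+x. ennreal (norm (A x) powr Q) * indicator {of_int l..of_int l + 1} x \<partial>lborel)
      \<le> (\<integral>\<^sup>+x. ennreal (K powr (Q - 2)) * (ennreal ((norm (A x))\<^sup>2) * indicator {of_int l..of_int l + 1} x) \<partial>lborel)"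
    proof (rule nn_integral_mono)
      fix x
      have "norm (A x) powr Q = norm (A x) powr (Q - 2) * norm (A x) powr 2"
        by (subst powr_add[symmetric]) simp
      also have "\<dots> \<le> K powr (Q - 2) * norm (A x) powr 2"
        using A_le Q2 by (intro mult_right_mono powr_mono2) auto
      finally have "ennreal (norm (A x) powr Q) \<le> ennreal (K powr (Q - 2)) * ennreal ((norm (A x))\<^sup>2)"
        by (simp add: ennreal_leI flip: ennreal_mult)
      then show "ennreal (norm (A x) powr Q) * indicator {of_int l..of_int l + 1} x
          \<le> ennreal (K powr (Q - 2)) * (ennreal ((norm (A x))\<^sup>2) * indicator {of_int l..of_int l + 1} x)"
        by (auto simp: indicator_def)
    qed
    also have "\<dots> \<le> ennreal (K powr (Q - 2)) * ennreal K"
      using sq by (subst nn_integral_cmult) (auto intro: mult_left_mono)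
    also have "\<dots> = ennreal (K powr (Q - 1))"
      using K by (simp flip: ennreal_mult) (simp add: powr_diff power2_eq_square)
    also have "K powr (Q - 1) = (K powr max t (1 / 2)) powr Q"
      using True t by (simp add: powr_powr Q_def field_simps)
    also have "ennreal \<dots> \<le> ennreal (2 * \<dots>)" by (intro ennreal_leI) simp
    finally show ?thesis unfolding A_def K_def Q_def .
  next
    case False
    then have Q2: "Q \<le> 2" using t by (simp add: Q_def field_simps)
    have "(\<integral>\<^sup>+x. ennreal (norm (A x) powr Q) * indicator {of_int l..of_int l + 1} x \<partial>lborel)
      \<le> (\<integral>\<^sup>+x. ennreal (K powr (Q / 2)) * indicator {of_int l..of_int l + 1} x +
         ennreal (K powr (Q / 2) / K) * (ennreal ((norm (A x))\<^sup>2) * indicator {of_int l..of_int l + 1} x) \<partial>lborel)"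
    proof (rule nn_integral_mono)
      fix x
      define y where "y = norm (A x) / sqrt K"
      have y0: "y \<ge> 0" using K by (simp add: y_def)
      have "y powr Q \<le> 1 + y\<^sup>2"
      proof (cases "y \<le> 1")
        case True
        then have "y powr Q \<le> 1" using Q y0 by (intro powr_le1) auto
        then show ?thesis by (simp add: add_increasing2)
      next
        case False
        then have "y powr Q \<le> y powr 2" using Q2 by (intro powr_mono) auto
        then show ?thesis using False by (simp add: add_increasing)
      qed
      then have "K powr (Q / 2) * y powr Q \<le> K powr (Q / 2) * (1 + y\<^sup>2)" by (intro mult_left_mono) auto
      moreover have "K powr (Q / 2) * y powr Q = norm (A x) powr Q"
      proof -
        have "K powr (Q / 2) = sqrt K powr Q" using K by (simp add: powr_half_sqrt[symmetric] powr_powr)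
        then show ?thesis using K by (simp add: y_def powr_divide)
      qed
      moreover have "y\<^sup>2 = (norm (A x))\<^sup>2 / K" using K by (simp add: y_def power_divide)
      ultimately have "norm (A x) powr Q \<le> K powr (Q / 2) + K powr (Q / 2) / K * (norm (A x))\<^sup>2"
        by (simp add: distrib_left)
      then have "ennreal (norm (A x) powr Q) \<le> ennreal (K powr (Q / 2)) + ennreal (K powr (Q / 2) / K) * ennreal ((norm (A x))\<^sup>2)"
        using K by (simp add: ennreal_leI flip: ennreal_plus ennreal_mult del: times_divide_eq_left)
      then show "ennreal (norm (A x) powr Q) * indicator {of_int l..of_int l + 1} x
          \<le> ennreal (K powr (Q / 2)) * indicator {of_int l..of_int l + 1} x +
         ennreal (K powr (Q / 2) / K) * (ennreal ((norm (A x))\<^sup>2) * indicator {of_int l..of_int l + 1} x)"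
        by (auto simp: indicator_def)
    qed
    also have "\<dots> = ennreal (K powr (Q / 2)) + ennreal (K powr (Q / 2) / K) *
        (\<integral>\<^sup>+x. ennreal ((norm (A x))\<^sup>2) * indicator {of_int l..of_int l + 1} x \<partial>lborel)"
      by (simp add: nn_integral_add nn_integral_cmult)
    also have "\<dots> \<le> ennreal (K powr (Q / 2)) + ennreal (K powr (Q / 2) / K) * ennreal K"
      using sq by (intro add_left_mono mult_left_mono) auto
    also have "\<dots> = ennreal (2 * K powr (Q / 2))"
      using K by (simp flip: ennreal_mult ennreal_plus)
    also have "K powr (Q / 2) = (K powr max t (1 / 2)) powr Q"
      using False by (simp add: powr_powr)
    finally show ?thesis unfolding A_def K_def Q_def .
  qed
qed

text \<open>Below frequency 1 the zero of order \<open>n >= beta\<close> supplies the whole weight.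
  Above, only \<open>b'\<close> powers of \<open>|xi|\<close> are spent to gain
  \<open>H powr b'\<close>; the other \<open>beta - b'\<close> survive as decay, needed to integrate
  a periodic sum over the line.\<close>

lemma high_multiplier_bound:
  fixes \<xi> H :: real
  assumes "\<xi> \<noteq> 0" "0 < H" "H \<le> 1" "real n \<ge> \<beta>" "0 \<le> b'" "b' \<le> \<beta>"
  shows "min 1 (H * \<bar>\<xi>\<bar>) ^ n \<le> H powr b' * (\<bar>\<xi>\<bar> powr \<beta> * (2 powr (\<beta> - b') * (1 + \<bar>\<xi>\<bar>) powr (- (\<beta> - b'))))"
proof (cases "\<bar>\<xi>\<bar> \<le> 1")
  case True
  have "min 1 (H * \<bar>\<xi>\<bar>) ^ n \<le> (H * \<bar>\<xi>\<bar>) ^ n" using assms by (intro power_mono) auto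
  also have "\<dots> = H powr real n * \<bar>\<xi>\<bar> powr real n"
    using assms by (simp add: powr_realpow power_mult_distrib)
  also have "\<dots> \<le> H powr b' * \<bar>\<xi>\<bar> powr \<beta>"
    using assms True by (intro mult_mono powr_mono') auto
  also have "\<dots> \<le> H powr b' * (\<bar>\<xi>\<bar> powr \<beta> * (2 powr (\<beta> - b') * (1 + \<bar>\<xi>\<bar>) powr (- (\<beta> - b'))))"
  proof -
    have "(1 + \<bar>\<xi>\<bar>) powr (\<beta> - b') \<le> 2 powr (\<beta> - b')" using True assms by (intro powr_mono2) auto
    then have "1 \<le> 2 powr (\<beta> - b') * (1 + \<bar>\<xi>\<bar>) powr (- (\<beta> - b'))"
      unfolding powr_minus by (simp add: field_simps)
    then have "\<bar>\<xi>\<bar> powr \<beta> * 1 \<le> \<bar>\<xi>\<bar> powr \<beta> * (2 powr (\<beta> - b') * (1 + \<bar>\<xi>\<bar>) powr (- (\<beta> - b')))"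
      by (intro mult_left_mono) auto
    then show ?thesis by (intro mult_left_mono) auto
  qed
  finally show ?thesis .
next
  case False
  have m: "0 < min 1 (H * \<bar>\<xi>\<bar>)" using assms by auto
  then have "min 1 (H * \<bar>\<xi>\<bar>) ^ n = min 1 (H * \<bar>\<xi>\<bar>) powr real n" by (simp add: powr_realpow)
  also have "\<dots> \<le> min 1 (H * \<bar>\<xi>\<bar>) powr b'" using assms m by (intro powr_mono') auto
  also have "\<dots> \<le> (H * \<bar>\<xi>\<bar>) powr b'" using assms m by (intro powr_mono2) auto
  also have "\<dots> = H powr b' * (\<bar>\<xi>\<bar> powr \<beta> * \<bar>\<xi>\<bar> powr (- (\<beta> - b')))"
    using assms by (simp add: powr_mult flip: powr_add)
  also have "\<dots> \<le> H powr b' * (\<bar>\<xi>\<bar> powr \<beta> * (2 powr (\<beta> - b') * (1 + \<bar>\<xi>\<bar>) powr (- (\<beta> - b'))))"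
    using False assms by (intro mult_left_mono powr_minus_le_shift) auto
  finally show ?thesis .
qed

text \<open>Linearisation: multiplying each term by the conjugate of its sign makes the sum of
  moduli a single integral against a trigonometric sum with coefficients of modulus at most
  1.\<close>

lemma norm_sum_to_integral:
  assumes F: "integrable lborel F" and "finite B" "B \<noteq> {}" and h: "0 \<le> h" "h \<le> H" and H: "0 < H"
  shows "\<exists>a. (\<forall>k. norm (a k) \<le> 1) \<and>
    ennreal (\<Sum>k\<in>B. norm (difference_ift F h n (real k)))
     \<le> (\<integral>\<^sup>+\<xi>. ennreal ((2 * pi) ^ n * (norm (F \<xi>) * min 1 (H * \<bar>\<xi>\<bar>) ^ n * norm (\<Sum>k\<in>B. a k * ee (real k * \<xi>)))) \<partial>lborel)"
proof -
  have [measurable]: "F \<in> borel_measurable borel" using F by auto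
  define D where "D = (\<lambda>k. \<integral>\<xi>. F \<xi> * (1 - ee (h * \<xi>)) ^ n * ee (real k * \<xi>) \<partial>lborel)"
  define a where "a = (\<lambda>k. cnj (sgn (D k)))"
  have a: "norm (a k) \<le> 1" for k by (simp add: a_def norm_sgn)
  have aD: "a k * D k = of_real (norm (D k))" for k
  proof (cases "D k = 0")
    case False
    have "D k * cnj (D k) = of_real ((norm (D k))\<^sup>2)" by (rule complex_norm_square[symmetric])
    then show ?thesis using False
      by (simp add: a_def sgn_div_norm scaleR_conv_of_real field_simps power2_eq_square)
  qed (simp add: a_def)
  have i0: "integrable lborel (\<lambda>\<xi>. F \<xi> * (1 - ee (h * \<xi>)) ^ n)"
  proof (rule Bochner_Integration.integrable_bound)
    show "integrable lborel (\<lambda>\<xi>. F \<xi> * 2 ^ n)" using F by simp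
    have "norm (1 - ee x) \<le> 2" for x using norm_triangle_ineq4[of 1 "ee x"] by simp
    then show "AE \<xi> in lborel. norm (F \<xi> * (1 - ee (h * \<xi>)) ^ n) \<le> norm (F \<xi> * 2 ^ n)"
      by (intro AE_I2) (auto simp: norm_mult norm_power intro!: mult_left_mono power_mono)
  qed simp
  have "complex_of_real (\<Sum>k\<in>B. norm (D k)) = (\<Sum>k\<in>B. a k * D k)" by (simp add: aD)
  also have "\<dots> = (\<integral>\<xi>. (\<Sum>k\<in>B. a k * (F \<xi> * (1 - ee (h * \<xi>)) ^ n * ee (real k * \<xi>))) \<partial>lborel)"
    unfolding D_def using i0
    by (subst Bochner_Integration.integral_sum) (auto intro!: integrable_mult_right integrable_times_ee)
  finally have eq: "complex_of_real (\<Sum>k\<in>B. norm (D k)) = \<dots>" .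
  have "(\<Sum>k\<in>B. norm (D k)) = norm (complex_of_real (\<Sum>k\<in>B. norm (D k)))"
    unfolding norm_of_real by (simp add: sum_nonneg)
  then have "ennreal (\<Sum>k\<in>B. norm (D k)) = ennreal (norm (\<integral>\<xi>. (\<Sum>k\<in>B. a k * (F \<xi> * (1 - ee (h * \<xi>)) ^ n * ee (real k * \<xi>))) \<partial>lborel))"
    by (simp only: eq)
  also have "\<dots> \<le> (\<integral>\<^sup>+\<xi>. norm (\<Sum>k\<in>B. a k * (F \<xi> * (1 - ee (h * \<xi>)) ^ n * ee (real k * \<xi>))) \<partial>lborel)"
    using i0 by (intro integral_norm_bound_ennreal Bochner_Integration.integrable_sum integrable_mult_right integrable_times_ee)
  also have "\<dots> \<le> (\<integral>\<^sup>+\<xi>. ennreal ((2 * pi) ^ n * (norm (F \<xi>) * min 1 (H * \<bar>\<xi>\<bar>) ^ n * norm (\<Sum>k\<in>B. a k * ee (real k * \<xi>)))) \<partial>lborel)"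
  proof (intro nn_integral_mono ennreal_leI)
    fix \<xi>
    have "(\<Sum>k\<in>B. a k * (F \<xi> * (1 - ee (h * \<xi>)) ^ n * ee (real k * \<xi>)))
        = F \<xi> * (1 - ee (h * \<xi>)) ^ n * (\<Sum>k\<in>B. a k * ee (real k * \<xi>))"
      by (simp add: sum_distrib_left mult_ac)
    then have "norm (\<Sum>k\<in>B. a k * (F \<xi> * (1 - ee (h * \<xi>)) ^ n * ee (real k * \<xi>)))
        = norm (F \<xi>) * norm (1 - ee (h * \<xi>)) ^ n * norm (\<Sum>k\<in>B. a k * ee (real k * \<xi>))"
      by (simp add: norm_mult norm_power)
    also have "\<dots> \<le> norm (F \<xi>) * (2 * pi * min 1 (H * \<bar>\<xi>\<bar>)) ^ n * norm (\<Sum>k\<in>B. a k * ee (real k * \<xi>))"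
      using h by (intro mult_right_mono mult_left_mono power_mono norm_one_minus_ee_le_min) auto
    finally show "norm (\<Sum>k\<in>B. a k * (F \<xi> * (1 - ee (h * \<xi>)) ^ n * ee (real k * \<xi>)))
        \<le> (2 * pi) ^ n * (norm (F \<xi>) * min 1 (H * \<bar>\<xi>\<bar>) ^ n * norm (\<Sum>k\<in>B. a k * ee (real k * \<xi>)))"
      by (simp add: power_mult_distrib mult_ac)
  qed
  finally show ?thesis using a unfolding D_def by blast
qed

text \<open>The integrand is at most a constant times \<open>S * H powr b'\<close> times
  \<open>u * (W |A| / S)\<close>, where \<open>S\<close> is the size of the sum \<open>A\<close>.
  The norm of \<open>u\<close> is finite by hypothesis and the dual norm of the other factor is
  bounded uniformly in \<open>B\<close> and the signs; \<open>beta - b' > 1 - t\<close> makes the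
  \<open>Q\<close>-th powers of \<open>W\<close> summable over the periods.\<close>

lemma high_part_bound:
  fixes F :: "real \<Rightarrow> complex"
  assumes F: "integrable lborel F" and t: "0 \<le> t" "t < 1"
    and w: "wfin t \<beta> F" and n: "real n \<ge> \<beta>" and b': "0 \<le> b'" "\<beta> - b' > 1 - t"
  shows "\<exists>C\<ge>0. \<forall>B H h. finite B \<longrightarrow> B \<noteq> {} \<longrightarrow> 0 \<le> h \<longrightarrow> h \<le> H \<longrightarrow> 0 < H \<longrightarrow> H \<le> 1 \<longrightarrow>
    (\<Sum>k\<in>B. norm (difference_ift F h n (real k)))
      \<le> C * real (card B) powr max t (1 / 2) * H powr b'"
proof -
  have [measurable]: "F \<in> borel_measurable borel" using F by auto
  define Q where "Q = 1 / (1 - t)"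
  have Q: "Q \<ge> 1" using t by (simp add: Q_def)
  define \<gamma> where "\<gamma> = \<beta> - b'"
  have \<gamma>Q: "\<gamma> * Q > 1" "\<gamma> > 0" using b' t by (auto simp: \<gamma>_def Q_def field_simps)
  define W where "W = (\<lambda>\<xi>. 2 powr \<gamma> * (1 + \<bar>\<xi>\<bar>) powr (- \<gamma>))"
  have [measurable]: "W \<in> borel_measurable borel" unfolding W_def by measurable
  have W0: "W \<xi> \<ge> 0" for \<xi> by (simp add: W_def)
  define u where "u = (\<lambda>\<xi>. norm (F \<xi>) * \<bar>\<xi>\<bar> powr \<beta>)"
  have [measurable]: "u \<in> borel_measurable borel" unfolding u_def by measurable
  have u0: "u \<xi> \<ge> 0" for \<xi> by (simp add: u_def)
  have summ: "summable (\<lambda>n. (1 + real n) powr (- (\<gamma> * Q)))"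
  proof -
    have "summable (\<lambda>n. real (Suc n) powr (- (\<gamma> * Q)))"
      using \<gamma>Q by (subst summable_Suc_iff) (simp add: summable_real_powr_iff)
    then show ?thesis by (simp add: add.commute)
  qed
  define C1 where "C1 = 2 powr (\<gamma> * Q) * (4 * (\<Sum>n. (1 + real n) powr (- (\<gamma> * Q))))"
  have C1: "C1 \<ge> 0" unfolding C1_def by (intro mult_nonneg_nonneg suminf_nonneg summ) auto
  have dual: "(\<integral>\<^sup>+\<xi>. ennreal ((W \<xi> * norm (\<Sum>k\<in>B. a k * ee (real k * \<xi>)) / real (card B) powr max t (1 / 2)) powr Q) \<partial>lborel) \<le> ennreal C1"
    if B: "finite B" "B \<noteq> {}" and a: "\<forall>k. norm (a k) \<le> 1" for B a
  proof -
    define A where "A = (\<lambda>\<xi>. \<Sum>k\<in>B. a k * ee (real k * \<xi>))"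
    have [measurable]: "A \<in> borel_measurable borel" unfolding A_def by measurable
    define S where "S = real (card B) powr max t (1 / 2)"
    have S: "S > 0" using B by (simp add: S_def card_gt_0_iff)
    have "(W \<xi> * norm (A \<xi>) / S) powr Q = (2 powr (\<gamma> * Q) / S powr Q) * (norm (A \<xi>) powr Q * (1 + \<bar>\<xi>\<bar>) powr (- (\<gamma> * Q)))" for \<xi>
      using S by (simp add: W_def powr_mult powr_divide powr_powr)
    then have "(\<integral>\<^sup>+\<xi>. ennreal ((W \<xi> * norm (A \<xi>) / S) powr Q) \<partial>lborel)
        = ennreal (2 powr (\<gamma> * Q) / S powr Q) * (\<integral>\<^sup>+\<xi>. ennreal (norm (A \<xi>) powr Q * (1 + \<bar>\<xi>\<bar>) powr (- (\<gamma> * Q))) \<partial>lborel)"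
      by (subst nn_integral_cmult[symmetric]) (auto simp: ennreal_mult[symmetric])
    also have "(\<integral>\<^sup>+\<xi>. ennreal (norm (A \<xi>) powr Q * (1 + \<bar>\<xi>\<bar>) powr (- (\<gamma> * Q))) \<partial>lborel)
        \<le> ennreal (2 * (2 * S powr Q) * (\<Sum>n. (1 + real n) powr (- (\<gamma> * Q))))"
    proof (rule nn_integral_weight_le)
      show "(\<integral>\<^sup>+x. ennreal (norm (A x) powr Q) * indicator {real_of_int l..real_of_int l + 1} x \<partial>lborel) \<le> ennreal (2 * S powr Q)" for l
        unfolding A_def S_def Q_def using B a t by (intro nn_integral_trig_sum_powr) auto
    qed (use summ \<gamma>Q Q in \<open>auto intro!: powr_mono2'\<close>)
    also have "ennreal (2 powr (\<gamma> * Q) / S powr Q) * ennreal (2 * (2 * S powr Q) * (\<Sum>n. (1 + real n) powr (- (\<gamma> * Q)))) = ennreal C1"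
      using S by (subst ennreal_mult[symmetric])
        (auto simp: C1_def intro!: mult_nonneg_nonneg suminf_nonneg summ)
    finally show ?thesis unfolding A_def S_def by (simp add: mult_left_mono)
  qed
  \<comment> \<open>Duality between \<open>u\<close> and the normalised sum: sup norm against the
    \<open>L^1\<close> norm if \<open>t = 0\<close>, where \<open>Q = 1\<close>, and Young's
    inequality otherwise.\<close>
  have "\<exists>C2\<ge>0. \<forall>B a. finite B \<longrightarrow> B \<noteq> {} \<longrightarrow> (\<forall>k. norm (a k) \<le> 1) \<longrightarrow>
     (\<integral>\<^sup>+\<xi>. ennreal (u \<xi> * (W \<xi> * norm (\<Sum>k\<in>B. a k * ee (real k * \<xi>)) / real (card B) powr max t (1 / 2))) \<partial>lborel) \<le> ennreal C2"
  proof (cases "t = 0")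
    case True
    then obtain M where M: "AE x in lborel. u x \<le> M" using w by (auto simp: wfin_def u_def)
    show ?thesis
    proof (intro exI[of _ "\<bar>M\<bar> * C1"] conjI allI impI)
      fix B :: "nat set" and a :: "nat \<Rightarrow> complex"
      assume B: "finite B" "B \<noteq> {}" and a: "\<forall>k. norm (a k) \<le> 1"
      define v where "v = (\<lambda>\<xi>. W \<xi> * norm (\<Sum>k\<in>B. a k * ee (real k * \<xi>)) / real (card B) powr max t (1 / 2))"
      have v0: "v \<xi> \<ge> 0" for \<xi> using W0 by (simp add: v_def)
      have [measurable]: "v \<in> borel_measurable borel" unfolding v_def by measurable
      have "(\<integral>\<^sup>+\<xi>. ennreal (u \<xi> * v \<xi>) \<partial>lborel) \<le> (\<integral>\<^sup>+\<xi>. ennreal \<bar>M\<bar> * ennreal (v \<xi> powr Q) \<partial>lborel)"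
        using M
      proof (intro nn_integral_mono_AE, eventually_elim)
        case (elim \<xi>)
        have "u \<xi> * v \<xi> \<le> \<bar>M\<bar> * v \<xi>" using elim v0 by (intro mult_right_mono) auto
        then show ?case using True v0 by (simp add: Q_def ennreal_leI flip: ennreal_mult)
      qed
      also have "\<dots> \<le> ennreal \<bar>M\<bar> * ennreal C1"
        using dual[OF B a] unfolding v_def by (subst nn_integral_cmult) (auto intro: mult_left_mono)
      finally show "(\<integral>\<^sup>+\<xi>. ennreal (u \<xi> * (W \<xi> * norm (\<Sum>k\<in>B. a k * ee (real k * \<xi>)) / real (card B) powr max t (1 / 2))) \<partial>lborel) \<le> ennreal (\<bar>M\<bar> * C1)"
        unfolding v_def using C1 by (simp add: ennreal_mult)
    qed (use C1 in auto)
  next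
    case False
    define U where "U = (\<integral>\<^sup>+\<xi>. ennreal (u \<xi> powr (1 / t)) \<partial>lborel)"
    have U: "U < \<infinity>" using w False by (simp add: wfin_def U_def u_def)
    show ?thesis
    proof (intro exI[of _ "enn2real U + C1"] conjI allI impI)
      fix B :: "nat set" and a :: "nat \<Rightarrow> complex"
      assume B: "finite B" "B \<noteq> {}" and a: "\<forall>k. norm (a k) \<le> 1"
      define v where "v = (\<lambda>\<xi>. W \<xi> * norm (\<Sum>k\<in>B. a k * ee (real k * \<xi>)) / real (card B) powr max t (1 / 2))"
      have v0: "v \<xi> \<ge> 0" for \<xi> using W0 by (simp add: v_def)
      have [measurable]: "v \<in> borel_measurable borel" unfolding v_def by measurable
      have "(\<integral>\<^sup>+\<xi>. ennreal (u \<xi> * v \<xi>) \<partial>lborel) \<le> (\<integral>\<^sup>+\<xi>. ennreal (u \<xi> powr (1 / t)) + ennreal (v \<xi> powr Q) \<partial>lborel)"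
        unfolding Q_def using t False u0 v0
        by (intro nn_integral_mono) (auto intro!: ennreal_leI young_powr simp flip: ennreal_plus)
      also have "\<dots> = U + (\<integral>\<^sup>+\<xi>. ennreal (v \<xi> powr Q) \<partial>lborel)"
        unfolding U_def by (subst nn_integral_add) auto
      also have "\<dots> \<le> U + ennreal C1"
        using dual[OF B a] unfolding v_def by (intro add_left_mono) auto
      also have "U = ennreal (enn2real U)" using U by (simp add: less_top)
      also have "ennreal (enn2real U) + ennreal C1 = ennreal (enn2real U + C1)" using C1 by simp
      finally show "(\<integral>\<^sup>+\<xi>. ennreal (u \<xi> * (W \<xi> * norm (\<Sum>k\<in>B. a k * ee (real k * \<xi>)) / real (card B) powr max t (1 / 2))) \<partial>lborel) \<le> ennreal (enn2real U + C1)"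
        unfolding v_def .
    qed (use C1 in auto)
  qed
  then obtain C2 where C2: "C2 \<ge> 0" and bound: "\<And>B a. finite B \<Longrightarrow> B \<noteq> {} \<Longrightarrow> (\<forall>k. norm (a k) \<le> 1) \<Longrightarrow>
     (\<integral>\<^sup>+\<xi>. ennreal (u \<xi> * (W \<xi> * norm (\<Sum>k\<in>B. a k * ee (real k * \<xi>)) / real (card B) powr max t (1 / 2))) \<partial>lborel) \<le> ennreal C2"
    by blast
  show ?thesis
  proof (intro exI[of _ "(2 * pi) ^ n * C2"] conjI allI impI)
    fix B :: "nat set" and H h :: real
    assume B: "finite B" "B \<noteq> {}" and h: "0 \<le> h" "h \<le> H" and H: "0 < H" "H \<le> 1"
    define S where "S = real (card B) powr max t (1 / 2)"
    have S: "S > 0" using B by (simp add: S_def card_gt_0_iff)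
    obtain a where a: "\<forall>k. norm (a k) \<le> 1" and le:
      "ennreal (\<Sum>k\<in>B. norm (difference_ift F h n (real k)))
     \<le> (\<integral>\<^sup>+\<xi>. ennreal ((2 * pi) ^ n * (norm (F \<xi>) * min 1 (H * \<bar>\<xi>\<bar>) ^ n * norm (\<Sum>k\<in>B. a k * ee (real k * \<xi>)))) \<partial>lborel)"
      using norm_sum_to_integral[OF F B h H(1)] by blast
    define A where "A = (\<lambda>\<xi>. \<Sum>k\<in>B. a k * ee (real k * \<xi>))"
    have [measurable]: "A \<in> borel_measurable borel" unfolding A_def by measurable
    have A_eq: "(\<Sum>k\<in>B. a k * ee (real k * \<xi>)) = A \<xi>" for \<xi> by (simp add: A_def)
    note le
    also have "(\<integral>\<^sup>+\<xi>. ennreal ((2 * pi) ^ n * (norm (F \<xi>) * min 1 (H * \<bar>\<xi>\<bar>) ^ n * norm (\<Sum>k\<in>B. a k * ee (real k * \<xi>)))) \<partial>lborel)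
        \<le> (\<integral>\<^sup>+\<xi>. ennreal ((2 * pi) ^ n * (S * H powr b')) * ennreal (u \<xi> * (W \<xi> * norm (A \<xi>) / S)) \<partial>lborel)"
      unfolding A_eq
    proof (rule nn_integral_mono_AE)
      show "AE \<xi> in lborel. ennreal ((2 * pi) ^ n * (norm (F \<xi>) * min 1 (H * \<bar>\<xi>\<bar>) ^ n * norm (A \<xi>)))
          \<le> ennreal ((2 * pi) ^ n * (S * H powr b')) * ennreal (u \<xi> * (W \<xi> * norm (A \<xi>) / S))"
        using AE_lborel_singleton[of "0::real"]
      proof eventually_elim
        case (elim \<xi>)
        have "min 1 (H * \<bar>\<xi>\<bar>) ^ n \<le> H powr b' * (\<bar>\<xi>\<bar> powr \<beta> * W \<xi>)"
          unfolding W_def \<gamma>_def using elim H n b' t by (intro high_multiplier_bound) auto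
        then have "(2 * pi) ^ n * (norm (F \<xi>) * min 1 (H * \<bar>\<xi>\<bar>) ^ n * norm (A \<xi>))
            \<le> (2 * pi) ^ n * (norm (F \<xi>) * (H powr b' * (\<bar>\<xi>\<bar> powr \<beta> * W \<xi>)) * norm (A \<xi>))"
          by (intro mult_left_mono mult_right_mono) auto
        also have "\<dots> = ((2 * pi) ^ n * (S * H powr b')) * (u \<xi> * (W \<xi> * norm (A \<xi>) / S))"
          using S by (simp add: u_def mult_ac)
        finally show ?case
          using S u0 W0 by (subst ennreal_mult[symmetric]) (auto intro!: ennreal_leI)
      qed
    qed
    also have "\<dots> \<le> ennreal ((2 * pi) ^ n * (S * H powr b')) * ennreal C2"
      using bound[OF B a] unfolding A_def S_def by (subst nn_integral_cmult) (auto intro: mult_left_mono)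
    also have "\<dots> = ennreal ((2 * pi) ^ n * C2 * S * H powr b')"
      using S C2 by (simp add: mult_ac flip: ennreal_mult)
    finally show "(\<Sum>k\<in>B. norm (difference_ift F h n (real k)))
      \<le> (2 * pi) ^ n * C2 * real (card B) powr max t (1 / 2) * H powr b'"
      using C2 unfolding S_def by (subst (asm) ennreal_le_iff) auto
  qed (use C2 in auto)
qed

section \<open>Summation over the positive integers\<close>

text \<open>About \<open>T\<close> terms equal 1, and the tail of \<open>T^2 / k^2\<close> again
  sums to order \<open>T\<close>. The inequality \<open>min 1 (T / k) * (T + k) <= 2 * T\<close>
  merges both ranges into one telescoping majorant.\<close>

lemma suminf_min_square_le:
  fixes T :: real
  assumes "T \<ge> 0"
  shows "(\<Sum>k. ennreal ((min 1 (T / real (Suc k)))\<^sup>2)) \<le> ennreal (4 * T)"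
proof (cases "T = 0")
  case False
  with assms have T: "T > 0" by simp
  have tele: "(\<Sum>k<N. (min 1 (T / real (Suc k)))\<^sup>2) \<le> 4 * T - 4 * T\<^sup>2 / (T + real N)" for N
  proof (induction N)
    case (Suc N)
    have "(min 1 (T / real (Suc N)))\<^sup>2 \<le> 4 * T\<^sup>2 / ((T + real N) * (T + real (Suc N)))"
    proof -
      have "(min 1 (T / real (Suc N))) * (T + real (Suc N)) \<le> 2 * T"
      proof (cases "T \<le> real (Suc N)")
        case True
        then have "T / real (Suc N) * T \<le> 1 * T" using T by (intro mult_right_mono) auto
        moreover have "T / real (Suc N) * real (Suc N) = T" by simp
        moreover have "min 1 (T / real (Suc N)) = T / real (Suc N)" using True by (simp add: min_def)
        ultimately show ?thesis by (simp only: distrib_left)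
      next
        case False
        then have "min 1 (T / real (Suc N)) = 1" by (simp add: min_def field_simps)
        then show ?thesis using False by simp
      qed
      then have "((min 1 (T / real (Suc N))) * (T + real (Suc N)))\<^sup>2 \<le> (2 * T)\<^sup>2"
        using T by (intro power_mono) auto
      then have "(min 1 (T / real (Suc N)))\<^sup>2 \<le> (2 * T)\<^sup>2 / (T + real (Suc N))\<^sup>2"
        using T by (subst pos_le_divide_eq) (auto simp only: power_mult_distrib zero_less_power2)
      also have "\<dots> \<le> (2 * T)\<^sup>2 / ((T + real N) * (T + real (Suc N)))"
        using T by (intro divide_left_mono) (auto simp: power2_eq_square intro!: mult_mono)
      finally show ?thesis by (simp add: power_mult_distrib)
    qed
    also have "\<dots> = 4 * T\<^sup>2 / (T + real N) - 4 * T\<^sup>2 / (T + real (Suc N))"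
      using T by (simp add: field_simps)
    finally show ?case using Suc.IH by simp
  qed (use T in \<open>simp add: power2_eq_square\<close>)
  have le: "(\<Sum>k<N. (min 1 (T / real (Suc k)))\<^sup>2) \<le> 4 * T" for N
  proof -
    have "0 \<le> 4 * T\<^sup>2 / (T + real N)" using T by simp
    then show ?thesis using tele[of N] by linarith
  qed
  show ?thesis
  proof (rule suminf_le_const)
    fix N
    have "(\<Sum>k<N. ennreal ((min 1 (T / real (Suc k)))\<^sup>2)) = ennreal (\<Sum>k<N. (min 1 (T / real (Suc k)))\<^sup>2)"
      by (intro sum_ennreal) auto
    also have "\<dots> \<le> ennreal (4 * T)" by (intro ennreal_leI le)
    finally show "(\<Sum>k<N. ennreal ((min 1 (T / real (Suc k)))\<^sup>2)) \<le> ennreal (4 * T)" .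
  qed simp
qed simp

lemma low_part_obtain:
  fixes g :: "real \<Rightarrow> complex"
  assumes "g \<in> borel_measurable borel" "0 \<le> r" "r \<le> 1" "wfin r \<alpha> g" "\<alpha> > 0" "\<eta> > 0"
    "r < 1 \<Longrightarrow> \<alpha> > 1 - r + c * r" "r = 1 \<Longrightarrow> c \<le> \<alpha>"
  obtains Z :: "nat \<Rightarrow> ennreal" where "(\<Sum>k. Z (Suc k)) < \<infinity>"
    "\<And>k H. k \<ge> 1 \<Longrightarrow> \<eta> * real k powr (- c) \<le> H \<Longrightarrow> real n * H < 1 \<Longrightarrow>
     scaled_mean g n H k \<le> Z k"
  using low_part_summable[OF assms, where n = n] by blast

text \<open>Here \<open>q = 1\<close>, so \<open>b\<close> is the weight exponent itself. The
  multipliers are summed over \<open>k\<close> at fixed \<open>xi\<close>: with \<open>H k\<close>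
  of order \<open>k powr (- 1 / b)\<close> they are at most \<open>(min 1 (|xi|^b / k))^2\<close>,
  with sum at most \<open>4 |xi|^b\<close>. This is a multiple of the weight, so nothing is lost at
  the end point.\<close>

lemma summable_ift_dual_one:
  assumes F: "integrable lborel F" and r: "0 \<le> r" "r \<le> 1"
    and wg: "wfin r \<alpha> (ift F)" and wF: "wfin 1 b F"
    and \<alpha>: "\<alpha> > 1 - r" and b: "b > 0"
    and c1: "r < 1 \<Longrightarrow> \<alpha> > 1 - r + 1 / b * r" and c2: "r = 1 \<Longrightarrow> 1 / b \<le> \<alpha>"
  shows "summable (\<lambda>k. norm (ift F (real k)))"
proof -
  have [measurable]: "F \<in> borel_measurable borel" using F by auto
  define g where "g = ift F"
  \<comment> \<open>As the truncated multiplier is at most 1, \<open>n >= 2 * b\<close> bounds its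
    \<open>n\<close>-th power by its power \<open>2 * b\<close>, which is the square in
    \<open>suminf_min_square_le\<close>.\<close>
  define n where "n = Suc (nat \<lceil>2 * b\<rceil>)"
  have n: "real n \<ge> 2 * b" "n \<ge> 1" unfolding n_def by linarith+
  \<comment> \<open>This gives \<open>n * H k <= 1 / 2\<close>, so the means stay within unit
    cells.\<close>
  define \<eta> where "\<eta> = 1 / (2 * real n)"
  have \<eta>: "\<eta> > 0" "\<eta> \<le> 1" using n by (auto simp: \<eta>_def divide_le_eq)
  define H where "H = (\<lambda>k::nat. \<eta> * real k powr (- (1 / b)))"
  have H: "H k > 0" "H k \<le> real k powr (- (1 / b))" "real n * H k < 1" if "k \<ge> 1" for k
  proof -
    have k: "real k powr (- (1 / b)) > 0" "real k powr (- (1 / b)) \<le> 1"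
      using that b by (auto simp: powr_minus divide_simps ge_one_powr_ge_zero)
    then show "H k > 0" "H k \<le> real k powr (- (1 / b))" using \<eta> by (auto simp: H_def mult_le_cancel_right1)
    have "real n * H k = 1 / 2 * real k powr (- (1 / b))" using n by (simp add: H_def \<eta>_def)
    then show "real n * H k < 1" using k by linarith
  qed
  obtain Z :: "nat \<Rightarrow> ennreal" where Z: "(\<Sum>k. Z (Suc k)) < \<infinity>" and
    Zle: "\<And>k H. k \<ge> 1 \<Longrightarrow> \<eta> * real k powr (- (1 / b)) \<le> H \<Longrightarrow> real n * H < 1 \<Longrightarrow>
     scaled_mean g n H k \<le> Z k"
  proof -
    have p: "g \<in> borel_measurable borel" "wfin r \<alpha> g" "\<alpha> > 0"
      using F \<alpha> r wg by (auto simp: g_def)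
    show ?thesis by (rule low_part_obtain[OF p(1) r p(2,3) \<eta>(1) c1 c2]) (assumption | rule that)+
  qed
  define e where "e = (\<lambda>k. \<integral>\<^sup>+\<xi>. ennreal ((2 * pi) ^ n * (norm (F \<xi>) * min 1 (H k * \<bar>\<xi>\<bar>) ^ n)) \<partial>lborel)"
  have e_sum: "(\<Sum>k. e (Suc k)) < \<infinity>"
  proof -
    have "(\<Sum>k. e (Suc k)) = (\<integral>\<^sup>+\<xi>. (\<Sum>k. ennreal ((2 * pi) ^ n * (norm (F \<xi>) * min 1 (H (Suc k) * \<bar>\<xi>\<bar>) ^ n))) \<partial>lborel)"
      unfolding e_def by (subst nn_integral_suminf) auto
    also have "\<dots> \<le> (\<integral>\<^sup>+\<xi>. ennreal ((2 * pi) ^ n * 4) * ennreal ((norm (F \<xi>) * \<bar>\<xi>\<bar> powr b) powr (1 / 1)) \<partial>lborel)"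
    proof (rule nn_integral_mono)
      fix \<xi> :: real
      define T where "T = \<bar>\<xi>\<bar> powr b"
      have m: "min 1 (H (Suc k) * \<bar>\<xi>\<bar>) ^ n \<le> (min 1 (T / real (Suc k)))\<^sup>2" for k
      proof -
        define m where "m = min 1 (H (Suc k) * \<bar>\<xi>\<bar>)"
        have m01: "0 \<le> m" "m \<le> 1" using H(1)[of "Suc k"] by (auto simp: m_def)
        show ?thesis
        proof (cases "m = 0")
          case False
          with m01 have m0: "m > 0" by simp
          have "m ^ n = m powr real n" using m0 by (simp add: powr_realpow)
          also have "\<dots> \<le> m powr (2 * b)" using m01 m0 n by (intro powr_mono') auto
          also have "\<dots> = (m powr b)\<^sup>2" by (simp add: power2_eq_square flip: powr_add)
          also have "\<dots> \<le> (min 1 (T / real (Suc k)))\<^sup>2"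
          proof (intro power_mono)
            have "m powr b \<le> 1" using m01 b by (intro powr_le1) auto
            moreover have "m powr b \<le> (real (Suc k) powr (- (1 / b)) * \<bar>\<xi>\<bar>) powr b"
            proof (rule powr_mono2)
              have "m \<le> H (Suc k) * \<bar>\<xi>\<bar>" by (simp add: m_def)
              also have "\<dots> \<le> real (Suc k) powr (- (1 / b)) * \<bar>\<xi>\<bar>" using H(2)[of "Suc k"] by (intro mult_right_mono) auto
              finally show "m \<le> real (Suc k) powr (- (1 / b)) * \<bar>\<xi>\<bar>" .
            qed (use b m01 in auto)
            moreover have "(real (Suc k) powr (- (1 / b)) * \<bar>\<xi>\<bar>) powr b = T / real (Suc k)"
              using b by (subst powr_mult) (auto simp: powr_powr T_def)
            ultimately show "m powr b \<le> min 1 (T / real (Suc k))" by simp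
          qed simp
          finally show ?thesis by (simp add: m_def)
        qed (use n in \<open>auto simp: m_def power_0_left\<close>)
      qed
      have "(\<Sum>k. ennreal ((2 * pi) ^ n * (norm (F \<xi>) * min 1 (H (Suc k) * \<bar>\<xi>\<bar>) ^ n)))
          \<le> (\<Sum>k. ennreal ((2 * pi) ^ n * norm (F \<xi>)) * ennreal ((min 1 (T / real (Suc k)))\<^sup>2))"
        using m by (intro suminf_le) (auto simp: mult.assoc intro!: ennreal_leI mult_left_mono simp flip: ennreal_mult)
      also have "\<dots> \<le> ennreal ((2 * pi) ^ n * norm (F \<xi>)) * ennreal (4 * T)"
        unfolding ennreal_suminf_cmult
        by (intro mult_left_mono suminf_min_square_le) (simp_all only: T_def powr_ge_zero zero_le)
      also have "\<dots> = ennreal ((2 * pi) ^ n * 4) * ennreal ((norm (F \<xi>) * \<bar>\<xi>\<bar> powr b) powr (1 / 1))"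
        by (simp add: T_def mult_ac flip: ennreal_mult)
      finally show "(\<Sum>k. ennreal ((2 * pi) ^ n * (norm (F \<xi>) * min 1 (H (Suc k) * \<bar>\<xi>\<bar>) ^ n))) \<le> \<dots>" .
    qed
    also have "\<dots> = ennreal ((2 * pi) ^ n * 4) * (\<integral>\<^sup>+\<xi>. ennreal ((norm (F \<xi>) * \<bar>\<xi>\<bar> powr b) powr (1 / 1)) \<partial>lborel)"
      by (rule nn_integral_cmult) measurable
    also have "\<dots> < \<infinity>"
      using wF by (simp add: wfin_def ennreal_mult_less_top)
    finally show ?thesis .
  qed
  have each: "ennreal (norm (g (real k))) \<le> e k + 2 ^ n * Z k" if k: "k \<ge> 1" for k
  proof -
    have fin: "e k < \<infinity>"
    proof -
      obtain j where j: "k = Suc j" using k by (cases k) auto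
      have "e (Suc j) \<le> (\<Sum>k. e (Suc k))" using sum_le_suminf[of "\<lambda>k. e (Suc k)" "{j}"] by simp
      then show ?thesis using e_sum j by (simp add: le_less_trans)
    qed
    \<comment> \<open>The difference bound is applied to the single integer \<open>k\<close>, whose
      trigonometric sum has modulus at most 1.\<close>
    have "ennreal (\<Sum>i\<in>{k}. norm (ift F (real i))) \<le> ennreal (enn2real (e k)) + 2 ^ n * (\<Sum>i\<in>{k}. scaled_mean (ift F) n (H k) i)"
    proof (rule averaged_difference_bound[OF F])
      fix h assume h: "0 \<le> h" "h \<le> H k"
      obtain a :: "nat \<Rightarrow> complex" where a: "\<forall>i. norm (a i) \<le> 1" and le:
      "ennreal (\<Sum>i\<in>{k}. norm (difference_ift F h n (real i)))
        \<le> (\<integral>\<^sup>+\<xi>. ennreal ((2 * pi) ^ n * (norm (F \<xi>) * min 1 (H k * \<bar>\<xi>\<bar>) ^ n * norm (\<Sum>i\<in>{k}. a i * ee (real i * \<xi>)))) \<partial>lborel)"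
        using norm_sum_to_integral[OF F _ _ h H(1)[OF k], of "{k}" n] by blast
      note le
      also have "(\<integral>\<^sup>+\<xi>. ennreal ((2 * pi) ^ n * (norm (F \<xi>) * min 1 (H k * \<bar>\<xi>\<bar>) ^ n * norm (\<Sum>i\<in>{k}. a i * ee (real i * \<xi>)))) \<partial>lborel) \<le> e k"
        unfolding e_def using a H(1)[OF k]
        by (intro nn_integral_mono ennreal_leI mult_left_mono) (auto simp: norm_mult intro!: mult_left_le)
      also have "e k = ennreal (enn2real (e k))" using fin by (simp add: less_top)
      finally show "(\<Sum>i\<in>{k}. norm (difference_ift F h n (real i))) \<le> enn2real (e k)"
        by (subst (asm) ennreal_le_iff) auto
    qed (use H k in auto)
    also have "\<dots> \<le> e k + 2 ^ n * Z k"
      using fin Zle[OF k _ H(3)[OF k]] unfolding g_def H_def by (intro add_mono mult_left_mono) (auto simp: less_top)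
    finally show ?thesis by (simp add: g_def)
  qed
  have "(\<Sum>k. ennreal (norm (g (real (Suc k))))) \<le> (\<Sum>k. e (Suc k) + 2 ^ n * Z (Suc k))"
    by (intro suminf_le each) auto
  also have "\<dots> = (\<Sum>k. e (Suc k)) + 2 ^ n * (\<Sum>k. Z (Suc k))"
    by (simp add: suminf_add[symmetric])
  also have "\<dots> < \<infinity>" using e_sum Z by (simp add: ennreal_mult_less_top power_less_top_ennreal)
  finally have "summable (\<lambda>k. norm (g (real (Suc k))))"
    by (intro summable_suminf_not_top) auto
  then show ?thesis unfolding g_def by (subst (asm) summable_Suc_iff)
qed

text \<open>The strict inequality leaves room twice: for \<open>c\<close> above
  \<open>s / b0\<close> with \<open>c * r < alpha - (1 - r)\<close>, and for \<open>b'\<close>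
  between \<open>s / c\<close> and \<open>b0\<close>. The high frequency bound
  \<open>K powr s * H powr b'\<close> for the block of \<open>K = 2^j\<close> integers is then of
  order \<open>2 powr (j * (s - c * b'))\<close>, a convergent geometric series.\<close>

lemma summable_ift_dual_gt_one:
  assumes F: "integrable lborel F" and r: "0 \<le> r" "r \<le> 1" and t: "0 \<le> t" "t < 1"
    and wg: "wfin r \<alpha> (ift F)" and wF: "wfin t \<beta> F"
    and a: "\<alpha> - (1 - r) > 0" and b: "\<beta> - (1 - t) > 0"
    and ab: "(\<alpha> - (1 - r)) * (\<beta> - (1 - t)) > r * max t (1 / 2)"
  shows "summable (\<lambda>k. norm (ift F (real k)))"
proof -
  define g where "g = ift F"
  define s where "s = max t (1 / 2)"
  define b0 where "b0 = \<beta> - (1 - t)"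
  have s: "s > 0" by (simp add: s_def)
  have b0: "b0 > 0" using b by (simp add: b0_def)
  obtain c where c: "c > s / b0" "c * r < \<alpha> - (1 - r)"
  proof (cases "r = 0")
    case True
    then show ?thesis using a that[of "s / b0 + 1"] by simp
  next
    case False
    with r have "r > 0" by simp
    with ab b0 have "s / b0 < (\<alpha> - (1 - r)) / r" by (simp add: s_def b0_def field_simps)
    from dense[OF this] obtain c where "s / b0 < c" "c < (\<alpha> - (1 - r)) / r" by blast
    then show ?thesis using that[of c] \<open>r > 0\<close> by (simp add: field_simps)
  qed
  have "s / b0 > 0" using s b0 by simp
  then have c0: "c > 0" using c by linarith
  have "s / c < b0" using c c0 b0 by (simp add: field_simps)
  from dense[OF this] obtain b' where b': "s / c < b'" "b' < b0" by blast
  have b'0: "b' > 0" using b' s c0 by (meson divide_pos_pos less_trans)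
  have scb: "s - c * b' < 0" using b' c0 by (simp add: field_simps)
  define n where "n = Suc (nat \<lceil>\<beta>\<rceil>)"
  have n: "real n \<ge> \<beta>" "n \<ge> 1" unfolding n_def by linarith+
  define \<eta> where "\<eta> = 1 / (2 * real n)"
  have \<eta>: "\<eta> > 0" "\<eta> \<le> 1" using n by (auto simp: \<eta>_def divide_le_eq)
  obtain Z :: "nat \<Rightarrow> ennreal" where Z: "(\<Sum>k. Z (Suc k)) < \<infinity>" and
    Zle: "\<And>k H. k \<ge> 1 \<Longrightarrow> \<eta> * real k powr (- c) \<le> H \<Longrightarrow> real n * H < 1 \<Longrightarrow>
     scaled_mean g n H k \<le> Z k"
  proof -
    have p: "g \<in> borel_measurable borel" "wfin r \<alpha> g" "\<alpha> > 0" "\<alpha> > 1 - r + c * r" "r = 1 \<Longrightarrow> c \<le> \<alpha>"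
      using F a r wg c by (auto simp: g_def)
    show ?thesis by (rule low_part_obtain[OF p(1) r p(2,3) \<eta>(1) p(4,5)]) (assumption | rule that)+
  qed
  obtain C where C: "C \<ge> 0" and Cle: "\<And>B H h. finite B \<Longrightarrow> B \<noteq> {} \<Longrightarrow> 0 \<le> h \<Longrightarrow> h \<le> H \<Longrightarrow> 0 < H \<Longrightarrow> H \<le> 1 \<Longrightarrow>
    (\<Sum>k\<in>B. norm (difference_ift F h n (real k)))
      \<le> C * real (card B) powr s * H powr b'"
    using high_part_bound[OF F t wF n(1), of b'] b'0 b' unfolding b0_def s_def by auto
  \<comment> \<open>One \<open>H\<close> for the whole block, taken at its left end, where
    \<open>\<eta> * k powr (- c)\<close> is largest; hence it is admissible in \<open>Zle\<close>
    for every \<open>k\<close> of the block.\<close>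
  define H where "H = (\<lambda>j::nat. \<eta> * (2 ^ j) powr (- c))"
  have H: "H j > 0" "H j \<le> 1" "real n * H j < 1" for j
  proof -
    have p: "(2 ^ j) powr (- c) > (0::real)" "(2 ^ j) powr (- c) \<le> (1::real)"
      using c0 by (auto simp: powr_minus divide_simps ge_one_powr_ge_zero)
    then show "H j > 0" "H j \<le> 1" using \<eta> by (auto simp: H_def mult_le_one)
    have "real n * H j = 1 / 2 * (2 ^ j) powr (- c)" using n by (simp add: H_def \<eta>_def)
    then show "real n * H j < 1" using p by linarith
  qed
  define e where "e = (\<lambda>j::nat. C * \<eta> powr b' * (2 powr (s - c * b')) ^ j)"
  have e0: "e j \<ge> 0" for j using C by (simp add: e_def)
  have e_summable: "summable e"
  proof -
    have "2 powr (s - c * b') < (1::real)" using powr_less_mono[OF scb, of 2] by simp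
    then show ?thesis unfolding e_def by (intro summable_mult summable_geometric) auto
  qed
  have block: "(\<Sum>k\<in>{2 ^ j..<2 ^ Suc j}. ennreal (norm (g (real k)))) \<le> ennreal (e j) + 2 ^ n * (\<Sum>k\<in>{2 ^ j..<2 ^ Suc j}. Z k)" for j :: nat
  proof -
    let ?B = "{2 ^ j..<2 ^ Suc j} :: nat set"
    have "ennreal (\<Sum>k\<in>?B. norm (ift F (real k))) \<le> ennreal (e j) + 2 ^ n * (\<Sum>k\<in>?B. scaled_mean (ift F) n (H j) k)"
    proof (rule averaged_difference_bound[OF F])
      fix h assume h: "0 \<le> h" "h \<le> H j"
      have "(\<Sum>k\<in>?B. norm (difference_ift F h n (real k)))
          \<le> C * real (card ?B) powr s * H j powr b'"
        using h H by (intro Cle) auto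
      also have "\<dots> = e j"
      proof -
        have "real (card ?B) = 2 ^ j" by simp
        moreover have "(2 ^ j :: real) = 2 powr real j" by (simp add: powr_realpow)
        ultimately show ?thesis
          using \<eta> unfolding e_def H_def
          by (simp add: powr_mult powr_powr powr_power algebra_simps flip: powr_add)
      qed
      finally show "(\<Sum>k\<in>?B. norm (difference_ift F h n (real k))) \<le> e j" .
    qed (use H e0 in auto)
    also have "\<dots> \<le> ennreal (e j) + 2 ^ n * (\<Sum>k\<in>?B. Z k)"
    proof (intro add_left_mono mult_left_mono sum_mono)
      fix k assume k: "k \<in> ?B"
      then have k1: "real k \<ge> 2 ^ j" by (metis atLeastLessThan_iff of_nat_le_iff of_nat_numeral of_nat_power)
      then have k2: "k \<ge> 1" using k by (metis One_nat_def Suc_leI atLeastLessThan_iff le_trans nat_zero_less_power_iff pos2 less_le_trans)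
      have "\<eta> * real k powr (- c) \<le> H j"
        unfolding H_def using k1 c0 \<eta> by (intro mult_left_mono powr_mono2') auto
      then show "scaled_mean (ift F) n (H j) k \<le> Z k"
        using Zle[OF k2 _ H(3)] by (simp add: g_def)
    qed auto
    finally show ?thesis by (simp add: g_def sum_ennreal)
  qed
  have partial: "(\<Sum>k\<in>{1..<2 ^ J}. ennreal (norm (g (real k)))) \<le> (\<Sum>j<J. ennreal (e j)) + 2 ^ n * (\<Sum>k\<in>{1..<2 ^ J}. Z k)" for J :: nat
  proof (induction J)
    case (Suc J)
    have split: "{1..<2 ^ Suc J} = {1..<2 ^ J} \<union> {2 ^ J..<2 ^ Suc J :: nat}" by auto
    have "(\<Sum>k\<in>{1..<2 ^ Suc J}. ennreal (norm (g (real k)))) = (\<Sum>k\<in>{1..<2 ^ J}. ennreal (norm (g (real k)))) + (\<Sum>k\<in>{2 ^ J..<2 ^ Suc J}. ennreal (norm (g (real k))))"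
      unfolding split by (rule sum.union_disjoint) auto
    also have "\<dots> \<le> ((\<Sum>j<J. ennreal (e j)) + 2 ^ n * (\<Sum>k\<in>{1..<2 ^ J}. Z k)) + (ennreal (e J) + 2 ^ n * (\<Sum>k\<in>{2 ^ J..<2 ^ Suc J}. Z k))"
      by (intro add_mono Suc.IH block)
    also have "\<dots> = (\<Sum>j<Suc J. ennreal (e j)) + 2 ^ n * ((\<Sum>k\<in>{1..<2 ^ J}. Z k) + (\<Sum>k\<in>{2 ^ J..<2 ^ Suc J}. Z k))"
      by (simp add: distrib_left add_ac)
    also have "(\<Sum>k\<in>{1..<2 ^ J}. Z k) + (\<Sum>k\<in>{2 ^ J..<2 ^ Suc J}. Z k) = (\<Sum>k\<in>{1..<2 ^ Suc J}. Z k)"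
      unfolding split by (rule sum.union_disjoint[symmetric]) auto
    finally show ?case .
  qed simp
  have "(\<Sum>k. ennreal (norm (g (real (Suc k))))) \<le> (\<Sum>j. ennreal (e j)) + 2 ^ n * (\<Sum>k. Z (Suc k))"
  proof (rule suminf_le_const)
    fix N
    have "(\<Sum>k<N. ennreal (norm (g (real (Suc k))))) = (\<Sum>k\<in>{1..<Suc N}. ennreal (norm (g (real k))))"
      by (rule sum.reindex_bij_witness[of _ "\<lambda>k. k - 1" Suc]) auto
    also have "\<dots> \<le> (\<Sum>k\<in>{1..<2 ^ N}. ennreal (norm (g (real k))))"
    proof (intro sum_mono2)
      have "Suc N \<le> 2 ^ N" by (rule Suc_leI) (rule less_exp)
      then show "{1..<Suc N} \<subseteq> {1..<2 ^ N}" by auto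
    qed auto
    also have "\<dots> \<le> (\<Sum>j<N. ennreal (e j)) + 2 ^ n * (\<Sum>k\<in>{1..<2 ^ N}. Z k)" by (rule partial)
    also have "(\<Sum>k\<in>{1..<2 ^ N}. Z k) = (\<Sum>k<2 ^ N - 1. Z (Suc k))"
      by (rule sum.reindex_bij_witness[of _ Suc "\<lambda>k. k - 1"]) auto
    also have "(\<Sum>j<N. ennreal (e j)) + 2 ^ n * (\<Sum>k<2 ^ N - 1. Z (Suc k)) \<le> (\<Sum>j. ennreal (e j)) + 2 ^ n * (\<Sum>k. Z (Suc k))"
      by (intro add_mono mult_left_mono sum_le_suminf) auto
    finally show "(\<Sum>k<N. ennreal (norm (g (real (Suc k))))) \<le> (\<Sum>j. ennreal (e j)) + 2 ^ n * (\<Sum>k. Z (Suc k))" .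
  qed simp
  also have "\<dots> < \<infinity>" using e_summable e0 Z
    by (subst suminf_ennreal2) (auto simp: ennreal_mult_less_top power_less_top_ennreal)
  finally have "summable (\<lambda>k. norm (g (real (Suc k))))"
    by (intro summable_suminf_not_top) auto
  then show ?thesis unfolding g_def by (subst (asm) summable_Suc_iff)
qed

lemma summable_ift:
  assumes F: "integrable lborel F" and r: "0 \<le> r" "r \<le> 1" and t: "0 \<le> t" "t \<le> 1"
    and wg: "wfin r \<alpha> (ift F)" and wF: "wfin t \<beta> F"
    and a: "\<alpha> - (1 - r) > 0" and b: "\<beta> - (1 - t) > 0"
    and ab: "(\<alpha> - (1 - r)) * (\<beta> - (1 - t)) > r * max t (1 / 2) \<or>
      r = 1 \<and> t = 1 \<and> (\<alpha> - (1 - r)) * (\<beta> - (1 - t)) = 1"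
  shows "summable (\<lambda>k. norm (ift F (real k)))"
proof (cases "t = 1")
  case True
  then have ab': "(\<alpha> - (1 - r)) * \<beta> > r \<or> r = 1 \<and> (\<alpha> - (1 - r)) * \<beta> = 1"
    using ab by (simp add: max_def)
  have b': "\<beta> > 0" using b True by simp
  show ?thesis
  proof (rule summable_ift_dual_one[OF F r wg])
    show "wfin 1 \<beta> F" using wF True by simp
    show "\<alpha> > 1 - r + 1 / \<beta> * r" if "r < 1"
    proof -
      have "r / \<beta> < \<alpha> - (1 - r)" using ab' that b' by (simp add: field_simps)
      then show ?thesis by simp
    qed
    show "1 / \<beta> \<le> \<alpha>" if "r = 1"
      using ab' that b' by (auto simp: field_simps)
  qed (use a b' in auto)
next
  case False
  then show ?thesis using assms by (intro summable_ift_dual_gt_one) auto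
qed

section \<open>Reflection, and the sums over all integers\<close>

lemma AE_lborel_uminus:
  assumes "AE x in lborel. P (x :: real)" and [measurable]: "Measurable.pred borel P"
  shows "AE x in lborel. P (- x)"
proof -
  have "AE x in distr lborel borel uminus. P x"
    using assms unfolding lborel_distr_uminus by simp
  then show ?thesis by (subst (asm) AE_distr_iff) auto
qed

lemma wfin_uminus:
  assumes [measurable]: "u \<in> borel_measurable borel" and w: "wfin r \<alpha> u"
  shows "wfin r \<alpha> (\<lambda>x. u (- x))"
proof (cases "r = 0")
  case True
  then obtain M where "AE x in lborel. norm (u x) * \<bar>x\<bar> powr \<alpha> \<le> M" using w by (auto simp: wfin_def)
  from AE_lborel_uminus[OF this] show ?thesis using True by (auto simp: wfin_def)
next
  case False
  then show ?thesis
    using w nn_integral_real_affine[of "\<lambda>x. ennreal ((norm (u x) * \<bar>x\<bar> powr \<alpha>) powr (1 / r))" "-1" 0]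
    by (simp add: wfin_def)
qed

lemma ift_uminus: "ift (\<lambda>\<xi>. F (- \<xi>)) x = ift F (- x)"
  unfolding ift_def
  by (subst lborel_integral_real_affine[where c = "-1" and t = 0]) auto

lemma P_N_eq_sums: "P_N N G = (\<Sum>k<Suc N. G (real k)) + (\<Sum>k<N. G (- real (Suc k)))"
proof (induction N)
  case (Suc N)
  have "{- int (Suc N)..int (Suc N)} = insert (int (Suc N)) (insert (- int (Suc N)) {- int N..int N})"
    by auto
  then have "P_N (Suc N) G = G (real (Suc N)) + (G (- real (Suc N)) + P_N N G)"
    unfolding P_N_def by simp
  then show ?case using Suc.IH by simp
qed (simp add: P_N_def)

text \<open>\<open>ft f\<close> is bounded, hence locally integrable, so the integrability criterion
  applies to it just as to \<open>f\<close>, and inversion supplies the continuous representative.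
  The negative integers are handled as the positive ones of the reflected transform.\<close>

theorem convergent_of_wfin:
  assumes [measurable]: "f \<in> borel_measurable borel"
    and loc: "(\<integral>\<^sup>+x. ennreal (norm (f x)) * indicator {-1..1} x \<partial>lborel) < \<infinity>"
    and r: "0 \<le> r" "r \<le> 1" and t: "0 \<le> t" "t \<le> 1"
    and wf: "wfin r \<alpha> f" and wF: "wfin t \<beta> (ft f)"
    and a: "\<alpha> - (1 - r) > 0" and b: "\<beta> - (1 - t) > 0"
    and ab: "(\<alpha> - (1 - r)) * (\<beta> - (1 - t)) > r * max t (1 / 2) \<or>
      r = 1 \<and> t = 1 \<and> (\<alpha> - (1 - r)) * (\<beta> - (1 - t)) = 1"
  shows "\<exists>g. continuous_on UNIV g \<and> (AE x in lborel. f x = g x) \<and> convergent (\<lambda>N. P_N N (\<lambda>x. norm (g x)))"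
proof -
  have f: "integrable lborel f"
    using integrable_of_wfin[OF _ loc r _ wf] a by simp
  have bound: "norm (ft f x) \<le> (\<integral>x. norm (f x) \<partial>lborel)" for x
    unfolding ft_conv_ift by (rule norm_ift_le)
  have F: "integrable lborel (ft f)"
  proof (rule integrable_of_wfin[OF _ _ t _ wF])
    have "(\<integral>\<^sup>+x. ennreal (norm (ft f x)) * indicator {-1..1} x \<partial>lborel)
      \<le> (\<integral>\<^sup>+x. ennreal (\<integral>x. norm (f x) \<partial>lborel) * indicator {-1..1::real} x \<partial>lborel)"
      using bound by (intro nn_integral_mono mult_right_mono ennreal_leI) auto
    also have "\<dots> < \<infinity>" by (subst nn_integral_cmult) (auto simp: ennreal_mult_less_top)
    finally show "(\<integral>\<^sup>+x. ennreal (norm (ft f x)) * indicator {-1..1} x \<partial>lborel) < \<infinity>" .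
  qed (use f b in auto)
  define g where "g = ift (ft f)"
  have eq: "AE x in lborel. f x = g x" unfolding g_def by (rule fourier_inversion[OF f F])
  have [measurable]: "g \<in> borel_measurable borel" unfolding g_def using F by auto
  have [measurable]: "ft f \<in> borel_measurable borel" using f by auto
  have wg: "wfin r \<alpha> g"
  proof (cases "r = 0")
    case True
    then obtain M where "AE x in lborel. norm (f x) * \<bar>x\<bar> powr \<alpha> \<le> M" using wf by (auto simp: wfin_def)
    then have "AE x in lborel. norm (g x) * \<bar>x\<bar> powr \<alpha> \<le> M" using eq by eventually_elim simp
    then show ?thesis using True by (auto simp: wfin_def)
  next
    case False
    have "(\<integral>\<^sup>+x. ennreal ((norm (f x) * \<bar>x\<bar> powr \<alpha>) powr (1 / r)) \<partial>lborel) = (\<integral>\<^sup>+x. ennreal ((norm (g x) * \<bar>x\<bar> powr \<alpha>) powr (1 / r)) \<partial>lborel)"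
      using eq by (intro nn_integral_cong_AE) (auto elim!: eventually_mono)
    then show ?thesis using wf False by (simp add: wfin_def)
  qed
  have s1: "summable (\<lambda>k. norm (g (real k)))"
    using summable_ift[OF F r t _ wF a b ab] wg by (simp add: g_def)
  have "summable (\<lambda>k. norm (ift (\<lambda>\<xi>. ft f (- \<xi>)) (real k)))"
  proof (rule summable_ift[OF _ r t _ _ a b ab])
    show "integrable lborel (\<lambda>\<xi>. ft f (- \<xi>))"
      using lborel_integrable_real_affine[OF F, of "-1" 0] by simp
    have "ift (\<lambda>\<xi>. ft f (- \<xi>)) = (\<lambda>x. g (- x))" by (simp add: g_def ift_uminus fun_eq_iff)
    then show "wfin r \<alpha> (ift (\<lambda>\<xi>. ft f (- \<xi>)))" using wfin_uminus[OF _ wg] by simp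
    show "wfin t \<beta> (\<lambda>\<xi>. ft f (- \<xi>))" using wfin_uminus[OF _ wF] by simp
  qed
  then have s2: "summable (\<lambda>k. norm (g (- real (Suc k))))"
    by (subst (asm) summable_Suc_iff[symmetric]) (simp add: ift_uminus g_def)
  have "(\<lambda>N. P_N N (\<lambda>x. norm (g x))) \<longlonglongrightarrow> (\<Sum>k. norm (g (real k))) + (\<Sum>k. norm (g (- real (Suc k))))"
    unfolding P_N_eq_sums
    by (intro tendsto_add summable_LIMSEQ s2 LIMSEQ_Suc[OF summable_LIMSEQ[OF s1]])
  then have "convergent (\<lambda>N. P_N N (\<lambda>x. norm (g x)))" by (rule convergentI)
  moreover have "continuous_on UNIV g" unfolding g_def by (rule continuous_ift[OF F])
  ultimately show ?thesis using eq by blast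
qed

section \<open>Divergent Gaussian combs\<close>

text \<open>Hoelder's inequality for the masses \<open>u i\<close>, where the total mass enters only
  through the bound \<open>U\<close>. It lets overlapping bumps and layers contribute separately to
  a \<open>P\<close>-th power.\<close>

lemma jensen_powr:
  fixes a u :: "'i \<Rightarrow> real"
  assumes "finite I" and u: "\<And>i. i \<in> I \<Longrightarrow> 0 \<le> u i" and a: "\<And>i. i \<in> I \<Longrightarrow> 0 \<le> a i"
    and U: "(\<Sum>i\<in>I. u i) \<le> U" and P: "1 \<le> P"
  shows "(\<Sum>i\<in>I. a i * u i) powr P \<le> U powr (P - 1) * (\<Sum>i\<in>I. a i powr P * u i)"
proof -
  define S where "S = (\<Sum>i\<in>I. u i)"
  define X where "X = (\<Sum>i\<in>I. a i * u i)"
  define Y where "Y = (\<Sum>i\<in>I. a i powr P * u i)"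
  have S0: "S \<ge> 0" unfolding S_def using u by (intro sum_nonneg)
  have Y0: "Y \<ge> 0" unfolding Y_def using u by (intro sum_nonneg) auto
  have X0: "X \<ge> 0" unfolding X_def using u a by (intro sum_nonneg) auto
  have "X powr P \<le> S powr (P - 1) * Y"
  proof (cases "P = 1 \<or> X = 0")
    case True
    then show ?thesis
    proof
      assume "P = 1"
      have "S = 0 \<Longrightarrow> X = 0"
        using sum_nonneg_eq_0_iff[OF assms(1), of u] u unfolding S_def X_def by simp
      moreover have "X = Y"
        using a \<open>P = 1\<close> unfolding X_def Y_def by (intro sum.cong) auto
      ultimately show ?thesis using \<open>P = 1\<close> S0 X0 by (cases "S = 0") auto
    qed (use S0 Y0 in simp)
  next
    case False
    then have P1: "P > 1" and X1: "X > 0" using P X0 by auto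
    have S1: "S > 0"
    proof (rule ccontr)
      assume "\<not> S > 0"
      then have "S = 0" using S0 by simp
      then have "X = 0"
        using sum_nonneg_eq_0_iff[OF assms(1), of u] u unfolding S_def X_def by simp
      then show False using X1 by simp
    qed
    \<comment> \<open>\<open>M\<close> is the mean of \<open>a\<close> with respect to
      \<open>u\<close>. Young's inequality for \<open>a i\<close> and \<open>M powr (P - 1)\<close>
      is the tangent line inequality of the power function at \<open>M\<close>; summed against
      \<open>u\<close> it gives Jensen's inequality.\<close>
    define M where "M = X / S"
    have M: "M > 0" using X1 S1 by (simp add: M_def)
    have "a i * M powr (P - 1) \<le> a i powr P / P + (1 - 1 / P) * M powr P" if "i \<in> I" for i
    proof -
      have "a i * M powr (P - 1) \<le> a i powr P / P + (M powr (P - 1)) powr (P / (P - 1)) / (P / (P - 1))"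
        using P1 a[OF that] by (intro Youngs_inequality) (auto simp: field_simps)
      also have "(M powr (P - 1)) powr (P / (P - 1)) / (P / (P - 1)) = (1 - 1 / P) * M powr P"
      proof -
        have "(P - 1) * (P / (P - 1)) = P" using P1 by simp
        then show ?thesis using P1 by (simp only: powr_powr) (simp add: field_simps)
      qed
      finally show ?thesis .
    qed
    then have "(\<Sum>i\<in>I. (a i * M powr (P - 1)) * u i) \<le> (\<Sum>i\<in>I. (a i powr P / P + (1 - 1 / P) * M powr P) * u i)"
      using u by (intro sum_mono mult_right_mono) auto
    also have "\<dots> = Y / P + (1 - 1 / P) * M powr P * S"
      unfolding Y_def S_def distrib_right sum.distrib
      by (simp add: sum_divide_distrib sum_distrib_left[symmetric])
    also have "(\<Sum>i\<in>I. (a i * M powr (P - 1)) * u i) = X * M powr (P - 1)"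
      unfolding X_def sum_distrib_right by (simp add: mult_ac)
    also have "X * M powr (P - 1) = S * M powr P"
      using S1 X1 by (simp add: M_def powr_diff)
    finally have "S * M powr P \<le> Y"
      using P1 by (simp add: field_simps)
    then have "S powr (P - 1) * (S * M powr P) \<le> S powr (P - 1) * Y" by (intro mult_left_mono) auto
    moreover have "X powr P = S powr (P - 1) * (S * M powr P)"
      using S1 X1 by (simp add: M_def powr_divide powr_diff)
    ultimately show ?thesis by simp
  qed
  also have "\<dots> \<le> U powr (P - 1) * Y"
    using U S0 Y0 P unfolding S_def[symmetric] by (intro mult_right_mono powr_mono2) auto
  finally show ?thesis unfolding X_def Y_def .
qed

lemma sum_power_sparse_le:
  fixes \<omega> :: real
  assumes "0 \<le> \<omega>" "\<omega> < 1" "finite I" "inj_on g I"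
  shows "(\<Sum>i\<in>I. \<omega> ^ g i) \<le> 1 / (1 - \<omega>)"
proof -
  have "(\<Sum>i\<in>I. \<omega> ^ g i) = (\<Sum>l\<in>g ` I. \<omega> ^ l)" using assms by (simp add: sum.reindex)
  also have "\<dots> \<le> (\<Sum>l. \<omega> ^ l)" using assms by (intro sum_le_suminf) (auto intro: summable_geometric)
  also have "\<dots> = 1 / (1 - \<omega>)" using assms by (intro suminf_geometric) auto
  finally show ?thesis .
qed

text \<open>On either side of \<open>x\<close> the points, counted from the nearest one, have
  distances at least \<open>0, tau, 2 tau, ...\<close>, which gives one geometric series per side.
  It is applied to the integers and to the logarithms of the frequencies \<open>R n\<close>.\<close>

lemma sum_exp_separated_le:
  fixes t :: "nat \<Rightarrow> real"
  assumes sep: "\<And>i. t i + \<tau> \<le> t (Suc i)" and "\<tau> > 0" "\<delta> > 0" and I: "finite I"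
  shows "(\<Sum>i\<in>I. exp (- (\<delta> * \<bar>x - t i\<bar>))) \<le> 2 / (1 - exp (- (\<delta> * \<tau>)))"
proof -
  define \<omega> where "\<omega> = exp (- (\<delta> * \<tau>))"
  have \<omega>: "0 \<le> \<omega>" "\<omega> < 1" using assms by (auto simp: \<omega>_def)
  have gap: "t i + real (j - i) * \<tau> \<le> t j" if "i \<le> j" for i j
    using that
  proof (induction j rule: dec_induct)
    case (step n)
    then show ?case using sep[of n] by (simp add: Suc_diff_le algebra_simps)
  qed simp
  have le: "exp (- (\<delta> * y)) \<le> \<omega> ^ n" if "real n * \<tau> \<le> y" for n y
  proof -
    have "\<delta> * (real n * \<tau>) \<le> \<delta> * y" using that assms by (intro mult_left_mono) auto
    then show ?thesis by (simp add: \<omega>_def mult_ac flip: exp_of_nat_mult)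
  qed
  define I1 I2 where "I1 = {i \<in> I. t i \<le> x}" and "I2 = {i \<in> I. \<not> t i \<le> x}"
  have "(\<Sum>i\<in>I1. exp (- (\<delta> * \<bar>x - t i\<bar>))) \<le> 1 / (1 - \<omega>)"
  proof (cases "I1 = {}")
    case False
    define m where "m = Max I1"
    have fin: "finite I1" using I by (simp add: I1_def)
    have m: "m \<in> I1" "\<And>i. i \<in> I1 \<Longrightarrow> i \<le> m" using fin False by (auto simp: m_def)
    have "(\<Sum>i\<in>I1. exp (- (\<delta> * \<bar>x - t i\<bar>))) \<le> (\<Sum>i\<in>I1. \<omega> ^ (m - i))"
    proof (intro sum_mono le)
      fix i assume i: "i \<in> I1"
      show "real (m - i) * \<tau> \<le> \<bar>x - t i\<bar>"
        using gap[OF m(2)[OF i]] m(1) i by (auto simp: I1_def)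
    qed
    also have "\<dots> \<le> 1 / (1 - \<omega>)"
    proof (rule sum_power_sparse_le[OF \<omega> fin])
      show "inj_on ((-) m) I1" using m(2) by (auto simp: inj_on_def) (metis diff_diff_cancel)
    qed
    finally show ?thesis .
  qed (use \<omega> in simp)
  moreover have "(\<Sum>i\<in>I2. exp (- (\<delta> * \<bar>x - t i\<bar>))) \<le> 1 / (1 - \<omega>)"
  proof (cases "I2 = {}")
    case False
    define m where "m = Min I2"
    have fin: "finite I2" using I by (simp add: I2_def)
    have m: "m \<in> I2" "\<And>i. i \<in> I2 \<Longrightarrow> m \<le> i" using fin False by (auto simp: m_def)
    have "(\<Sum>i\<in>I2. exp (- (\<delta> * \<bar>x - t i\<bar>))) \<le> (\<Sum>i\<in>I2. \<omega> ^ (i - m))"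
    proof (intro sum_mono le)
      fix i assume i: "i \<in> I2"
      show "real (i - m) * \<tau> \<le> \<bar>x - t i\<bar>"
        using gap[OF m(2)[OF i]] m(1) i by (auto simp: I2_def)
    qed
    also have "\<dots> \<le> 1 / (1 - \<omega>)"
    proof (rule sum_power_sparse_le[OF \<omega> fin])
      show "inj_on (\<lambda>i. i - m) I2" using m(2) by (auto simp: inj_on_def) (metis le_add_diff_inverse)
    qed
    finally show ?thesis .
  qed (use \<omega> in simp)
  moreover have "(\<Sum>i\<in>I. exp (- (\<delta> * \<bar>x - t i\<bar>))) = (\<Sum>i\<in>I1. exp (- (\<delta> * \<bar>x - t i\<bar>))) + (\<Sum>i\<in>I2. exp (- (\<delta> * \<bar>x - t i\<bar>)))"
  proof -
    have "I = I1 \<union> I2" "I1 \<inter> I2 = {}" by (auto simp: I1_def I2_def)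
    then show ?thesis using I by (metis finite_Un sum.union_disjoint)
  qed
  ultimately show ?thesis by (simp add: \<omega>_def)
qed

definition exp_sum_bound :: real where "exp_sum_bound = 2 / (1 - exp (- 1))"

lemma exp_sum_bound_pos: "exp_sum_bound > 0"
  by (simp add: exp_sum_bound_def)

lemma sum_exp_nat_le:
  assumes "finite I"
  shows "(\<Sum>k\<in>I. exp (- \<bar>x - real k\<bar>)) \<le> exp_sum_bound"
  using sum_exp_separated_le[of real 1 1 I x] assms by (simp add: exp_sum_bound_def)

section \<open>Gaussian tails and moments\<close>

lemma gauss_le_exp: "gauss t \<le> exp 1 * exp (- \<bar>t\<bar>)"
proof -
  have "0 \<le> (\<bar>t\<bar> - 1)\<^sup>2 + \<bar>t\<bar> + 2 * \<bar>t\<bar>\<^sup>2" by simp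
  then have "\<bar>t\<bar> - 1 \<le> 3 * t\<^sup>2" by (simp add: power2_eq_square algebra_simps)
  also have "\<dots> \<le> pi * t\<^sup>2" using pi_gt3 by (intro mult_right_mono) auto
  finally show ?thesis by (simp add: gauss_def flip: exp_add)
qed

lemma gauss_mono: "\<bar>s\<bar> \<le> \<bar>t\<bar> \<Longrightarrow> gauss t \<le> gauss s"
  unfolding gauss_def by (simp add: abs_le_square_iff)

lemma sum_gauss_nat_le:
  assumes "finite I"
  shows "(\<Sum>k\<in>I. gauss (x - real k)) \<le> exp 1 * exp_sum_bound"
proof -
  have "(\<Sum>k\<in>I. gauss (x - real k)) \<le> (\<Sum>k\<in>I. exp 1 * exp (- \<bar>x - real k\<bar>))"
    by (intro sum_mono gauss_le_exp)
  also have "\<dots> = exp 1 * (\<Sum>k\<in>I. exp (- \<bar>x - real k\<bar>))" by (simp add: sum_distrib_left)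
  also have "\<dots> \<le> exp 1 * exp_sum_bound" using sum_exp_nat_le[OF assms] by (intro mult_left_mono) auto
  finally show ?thesis .
qed

lemma powr_gauss_bounded:
  fixes e :: real
  obtains C where "C > 0" "\<And>t. t \<ge> 0 \<Longrightarrow> (1 + t) powr e * gauss t \<le> C"
proof -
  have "((\<lambda>t. (1 + t) powr e * gauss t) \<longlongrightarrow> 0) at_top"
    unfolding gauss_def by real_asymp
  then have "\<forall>\<^sub>F t in at_top. (1 + t) powr e * gauss t < 1"
    by (rule order_tendstoD) simp
  then obtain N where N: "\<And>t. t \<ge> N \<Longrightarrow> (1 + t) powr e * gauss t < 1"
    by (auto simp: eventually_at_top_linorder)
  have "continuous_on {0..max 0 N} (\<lambda>t. (1 + t) powr e * gauss t)"
    by (intro continuous_intros) auto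
  from continuous_attains_sup[OF compact_Icc _ this] obtain x where
    x: "\<forall>t\<in>{0..max 0 N}. (1 + t) powr e * gauss t \<le> (1 + x) powr e * gauss x" by fastforce
  show thesis
  proof (rule that[of "max 1 ((1 + x) powr e * gauss x)"])
    fix t :: real assume "t \<ge> 0"
    then show "(1 + t) powr e * gauss t \<le> max 1 ((1 + x) powr e * gauss x)"
      using N[of t] bspec[OF x, of t] by (cases "t \<ge> N") (auto simp: max_def split: if_splits)
  qed auto
qed

lemma nn_integral_powr_gauss_finite:
  assumes "e \<ge> 0"
  shows "(\<integral>\<^sup>+t. ennreal ((1 + \<bar>t\<bar>) powr e * gauss t) \<partial>lborel) < \<infinity>"
proof -
  obtain C where C: "C > 0" "\<And>t. t \<ge> 0 \<Longrightarrow> (1 + t) powr (e + 2) * gauss t \<le> C"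
    using powr_gauss_bounded[of "e + 2"] by blast
  have "(\<integral>\<^sup>+t. ennreal ((1 + \<bar>t\<bar>) powr e * gauss t) \<partial>lborel) \<le> (\<integral>\<^sup>+t. ennreal C * ennreal ((1 + \<bar>t\<bar>) powr (- 2)) \<partial>lborel)"
  proof (rule nn_integral_mono)
    fix t :: real
    have g: "gauss \<bar>t\<bar> = gauss t" by (simp add: gauss_def)
    have "(1 + \<bar>t\<bar>) powr e * gauss t = ((1 + \<bar>t\<bar>) powr (e + 2) * gauss t) * (1 + \<bar>t\<bar>) powr (- 2)"
      by (simp add: mult_ac flip: powr_add)
    also have "\<dots> \<le> C * (1 + \<bar>t\<bar>) powr (- 2)"
      using C(2)[of "\<bar>t\<bar>"] g by (intro mult_right_mono) auto
    finally show "ennreal ((1 + \<bar>t\<bar>) powr e * gauss t) \<le> ennreal C * ennreal ((1 + \<bar>t\<bar>) powr (- 2))"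
      using C(1) by (simp add: ennreal_leI flip: ennreal_mult)
  qed
  also have "\<dots> = ennreal C * (\<integral>\<^sup>+t. ennreal ((1 + \<bar>t\<bar>) powr (- 2)) \<partial>lborel)"
    by (rule nn_integral_cmult) measurable
  also have "\<dots> < \<infinity>" using nn_integral_powr_tail_finite[of 2] by (simp add: ennreal_mult_less_top)
  finally show ?thesis .
qed

lemma has_bochner_integral_gauss_translate:
  assumes "R > 0"
  shows "integrable lborel (\<lambda>x. gauss (R * (x - k)))"
    and "(\<integral>x. gauss (R * (x - k)) \<partial>lborel) = 1 / R"
    and "(\<integral>x. gauss (R * (x - k)) * ee (- (x * \<xi>)) \<partial>lborel) = gauss (\<xi> / R) / R * ee (- (k * \<xi>))"
proof -
  have arg: "R * (x - k) = - (R * k) + R * x" for x by (simp add: algebra_simps)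
  show "integrable lborel (\<lambda>x. gauss (R * (x - k)))"
    unfolding arg using assms by (intro integrable_gauss_scaled) auto
  show "(\<integral>x. gauss (R * (x - k)) \<partial>lborel) = 1 / R"
    using assms by (subst lborel_integral_real_affine[where c = "1 / R" and t = k]) (auto simp: integral_gauss)
  have "(\<integral>x. gauss (R * (x - k)) * ee (- (x * \<xi>)) \<partial>lborel)
      = (1 / R) *\<^sub>R (\<integral>x. gauss (R * (k + 1 / R * x - k)) * ee (- ((k + 1 / R * x) * \<xi>)) \<partial>lborel)"
    using assms by (subst lborel_integral_real_affine[where c = "1 / R" and t = k]) auto
  also have "(\<lambda>x. complex_of_real (gauss (R * (k + 1 / R * x - k))) * ee (- ((k + 1 / R * x) * \<xi>)))
      = (\<lambda>x. (gauss x * ee (x * (- \<xi> / R))) * ee (- (k * \<xi>)))"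
  proof
    fix x
    have "- ((k + 1 / R * x) * \<xi>) = x * (- \<xi> / R) + - (k * \<xi>)" by (simp add: algebra_simps)
    moreover have "R * (k + 1 / R * x - k) = x" using assms by (simp add: field_simps)
    ultimately show "complex_of_real (gauss (R * (k + 1 / R * x - k))) * ee (- ((k + 1 / R * x) * \<xi>))
        = (gauss x * ee (x * (- \<xi> / R))) * ee (- (k * \<xi>))"
      by (simp only: ee_add mult.assoc)
  qed
  also have "(\<integral>x. (gauss x * ee (x * (- \<xi> / R))) * ee (- (k * \<xi>)) \<partial>lborel) = gauss (\<xi> / R) * ee (- (k * \<xi>))"
    using has_bochner_integral_gauss[of "- \<xi> / R"] by (simp add: has_bochner_integral_iff)
  finally show "(\<integral>x. gauss (R * (x - k)) * ee (- (x * \<xi>)) \<partial>lborel) = gauss (\<xi> / R) / R * ee (- (k * \<xi>))"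
    by (simp add: scaleR_conv_of_real)
qed

text \<open>In the variable \<open>t\<close> with \<open>x = k + t / R\<close> the weight is at most
  \<open>k^e * (1 + |t|)^e\<close>, as \<open>k\<close> and \<open>R\<close> are at least 1. A
  narrow bump at \<open>k\<close> therefore sees the weight \<open>k^e\<close> up to a fixed
  Gaussian moment.\<close>

lemma nn_integral_powr_gauss_translate_le:
  assumes R: "R \<ge> 1" and k: "k \<ge> 1" and e: "e \<ge> 0"
  shows "(\<integral>\<^sup>+x. ennreal (\<bar>x\<bar> powr e * gauss (R * (x - k))) \<partial>lborel)
    \<le> ennreal (k powr e / R) * (\<integral>\<^sup>+t. ennreal ((1 + \<bar>t\<bar>) powr e * gauss t) \<partial>lborel)"
proof -
  have "(\<integral>\<^sup>+x. ennreal (\<bar>x\<bar> powr e * gauss (R * (x - k))) \<partial>lborel)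
     = ennreal \<bar>1 / R\<bar> * (\<integral>\<^sup>+t. ennreal (\<bar>k + 1 / R * t\<bar> powr e * gauss (R * (k + 1 / R * t - k))) \<partial>lborel)"
    using R by (intro nn_integral_real_affine) auto
  also have "(\<integral>\<^sup>+t. ennreal (\<bar>k + 1 / R * t\<bar> powr e * gauss (R * (k + 1 / R * t - k))) \<partial>lborel)
      \<le> (\<integral>\<^sup>+t. ennreal (k powr e) * ennreal ((1 + \<bar>t\<bar>) powr e * gauss t) \<partial>lborel)"
  proof (rule nn_integral_mono)
    fix t
    have "\<bar>k + 1 / R * t\<bar> \<le> k + \<bar>t\<bar> / R"
      using R k by (metis abs_divide abs_of_nonneg abs_triangle_ineq mult_1 order_trans times_divide_eq_left zero_le_one)
    also have "\<dots> \<le> k + k * \<bar>t\<bar>"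
    proof -
      have "\<bar>t\<bar> / R \<le> \<bar>t\<bar> / 1" using R by (intro divide_left_mono) auto
      also have "\<dots> \<le> k * \<bar>t\<bar>" using k mult_right_mono[of 1 k "\<bar>t\<bar>"] by simp
      finally show ?thesis by simp
    qed
    finally have "\<bar>k + 1 / R * t\<bar> powr e \<le> (k * (1 + \<bar>t\<bar>)) powr e"
      using e by (intro powr_mono2) (auto simp: algebra_simps)
    also have "\<dots> = k powr e * (1 + \<bar>t\<bar>) powr e" using k by (simp add: powr_mult)
    finally have "\<bar>k + 1 / R * t\<bar> powr e * gauss t \<le> k powr e * (1 + \<bar>t\<bar>) powr e * gauss t"
      by (intro mult_right_mono) auto
    then show "ennreal (\<bar>k + 1 / R * t\<bar> powr e * gauss (R * (k + 1 / R * t - k))) \<le> ennreal (k powr e) * ennreal ((1 + \<bar>t\<bar>) powr e * gauss t)"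
      using R by (simp add: ennreal_leI mult.assoc flip: ennreal_mult)
  qed
  also have "\<dots> = ennreal (k powr e) * (\<integral>\<^sup>+t. ennreal ((1 + \<bar>t\<bar>) powr e * gauss t) \<partial>lborel)"
    by (rule nn_integral_cmult) measurable
  finally show ?thesis
    using R by (simp add: mult_left_mono mult.assoc[symmetric] flip: ennreal_mult)
qed

section \<open>The layers of the comb\<close>

text \<open>Only the layers \<open>n \<ge> 1\<close> enter \<open>f\<close>; \<open>w 0\<close> is a division by zero.\<close>

locale gauss_comb =
  fixes c \<theta> :: real and d :: "nat \<Rightarrow> nat \<Rightarrow> complex"
  assumes c_pos: "c > 0" and \<theta>_ge: "\<theta> \<ge> - c" and d_le: "\<And>n k. norm (d n k) \<le> 1"
begin

definition B :: "nat \<Rightarrow> nat set" where "B n = {4 ^ n..<4 ^ Suc n}"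

definition R :: "nat \<Rightarrow> real" where "R n = (4 ^ n) powr c * real n powr \<theta>"

definition w :: "nat \<Rightarrow> real" where "w n = 1 / (real n * 4 ^ n)"

definition T :: "nat \<Rightarrow> real \<Rightarrow> complex" where
  "T n x = w n * (\<Sum>k\<in>B n. d n k * gauss (R n * (x - real k)))"

definition D :: "nat \<Rightarrow> real \<Rightarrow> complex" where
  "D n \<xi> = (\<Sum>k\<in>B n. d n k * ee (- (real k * \<xi>)))"

definition f :: "real \<Rightarrow> complex" where "f x = (\<Sum>n. T (Suc n) x)"

lemma finite_B [simp]: "finite (B n)"
  by (simp add: B_def)

lemma card_B: "real (card (B n)) = 3 * 4 ^ n"
  by (simp add: B_def)

lemma B_ge: "k \<in> B n \<Longrightarrow> real k \<ge> 4 ^ n" "k \<in> B n \<Longrightarrow> real k \<le> 4 * 4 ^ n" "k \<in> B n \<Longrightarrow> real k \<ge> 1"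
proof -
  assume k: "k \<in> B n"
  then have "real (4 ^ n) \<le> real k" "real k \<le> real (4 ^ Suc n)"
    unfolding of_nat_le_iff by (auto simp: B_def)
  then show "real k \<ge> 4 ^ n" "real k \<le> 4 * 4 ^ n" by auto
  moreover have "(4::real) ^ n \<ge> 1" by simp
  ultimately show "real k \<ge> 1" by linarith
qed

lemma B_disjoint:
  assumes "k \<in> B m" "k \<in> B n"
  shows "m = n"
proof (rule ccontr)
  have *: False if "k \<in> B m" "k \<in> B n" "m < n" for m n
  proof -
    have "(4::nat) ^ Suc m \<le> 4 ^ n" using that by (intro power_increasing) auto
    then show False using that by (auto simp: B_def)
  qed
  assume "m \<noteq> n"
  then show False using *[of m n] *[of n m] assms by (auto simp: neq_iff)
qed

lemma sum_B: "(\<Sum>n<N. \<Sum>k\<in>B (Suc n). h k) = (\<Sum>k\<in>{4..<4 ^ Suc N}. h k)"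
proof (induction N)
  case (Suc N)
  have "(4::nat) \<le> 4 ^ Suc N" "(4::nat) ^ Suc N \<le> 4 ^ Suc (Suc N)" by auto
  then have "(\<Sum>k\<in>{4..<4 ^ Suc (Suc N)}. h k) = (\<Sum>k\<in>{4..<4 ^ Suc N}. h k) + (\<Sum>k\<in>{4 ^ Suc N..<4 ^ Suc (Suc N)}. h k)"
    by (intro sum.atLeastLessThan_concat[symmetric])
  then show ?case using Suc.IH by (simp add: B_def)
qed simp

text \<open>With \<open>m = Suc n\<close>,
  \<open>m powr theta >= m powr (- c) >= 2 powr (- c * m)\<close>: the logarithmic factor costs at
  most half of the exponent in \<open>4 powr (c * m)\<close>.\<close>

lemma R_ge: "R (Suc n) \<ge> (2 powr c) ^ Suc n"
proof -
  have le: "real (Suc n) \<le> 2 ^ Suc n"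
    using less_exp[of "Suc n"] by (metis less_imp_le of_nat_le_iff of_nat_numeral of_nat_power)
  have "(2 powr c) ^ Suc n = (2 ^ Suc n) powr c"
    by (simp add: powr_powr powr_mult mult.commute flip: powr_realpow powr_add)
  also have "\<dots> = (4 ^ Suc n) powr c * (2 ^ Suc n) powr (- c)"
  proof -
    have "(4::real) ^ Suc n = 2 ^ Suc n * 2 ^ Suc n" by (simp flip: power_mult_distrib)
    then show ?thesis by (simp only: powr_mult) (simp add: powr_minus field_simps)
  qed
  also have "\<dots> \<le> (4 ^ Suc n) powr c * real (Suc n) powr (- c)"
    using c_pos le by (intro mult_left_mono powr_mono2') auto
  also have "\<dots> \<le> R (Suc n)"
    unfolding R_def using \<theta>_ge by (intro mult_left_mono powr_mono) auto
  finally show ?thesis .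
qed

lemma two_powr_c: "2 powr c > 1"
  using c_pos by simp

lemma R_ge_1: "R (Suc n) \<ge> 1"
  using R_ge[of n] one_le_power[of "2 powr c" "Suc n"] two_powr_c by linarith

lemma R_pos: "R (Suc n) > 0"
  using R_ge_1[of n] by linarith

text \<open>Consecutive indices have a ratio between 1 and 2, so the logarithmic factor loses at
  most \<open>2 powr (- c)\<close> while the other factor gains \<open>4 powr c\<close>. This growth
  keeps the frequency bands of the layers apart.\<close>

lemma R_step: "R (Suc (Suc n)) \<ge> 2 powr c * R (Suc n)"
proof -
  define x where "x = real (Suc (Suc n)) / real (Suc n)"
  have x: "1 \<le> x" "x \<le> 2" by (auto simp: x_def field_simps)
  have "2 powr (- c) \<le> x powr (- c)" using x c_pos by (intro powr_mono2') auto
  also have "\<dots> \<le> x powr \<theta>" using x \<theta>_ge by (intro powr_mono) auto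
  finally have le: "2 powr (- c) \<le> x powr \<theta>" .
  have "2 powr c = 4 powr c * 2 powr (- c)"
  proof -
    have "(4::real) powr c = 2 powr c * 2 powr c" using powr_mult[of 2 2 c] by simp
    then show ?thesis by (simp add: powr_minus)
  qed
  then have "2 powr c * R (Suc n) \<le> 4 powr c * x powr \<theta> * R (Suc n)"
    using le R_pos[of n] by (intro mult_right_mono) auto
  also have "\<dots> = (4 * 4 ^ Suc n) powr c * (x * real (Suc n)) powr \<theta>"
  proof -
    have "4 powr c * x powr \<theta> * (K powr c * m powr \<theta>) = (4 * K) powr c * (x * m) powr \<theta>"
      if "K \<ge> 0" "m \<ge> 0" for K m :: real
      using x that by (simp add: powr_mult mult_ac)
    from this[of "4 ^ Suc n" "real (Suc n)"] show ?thesis by (simp add: R_def)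
  qed
  also have "\<dots> = R (Suc (Suc n))" by (simp add: R_def x_def)
  finally show ?thesis .
qed

lemma w_pos: "w (Suc n) > 0" and w_le_1: "w (Suc n) \<le> 1"
proof -
  show "w (Suc n) > 0" by (simp add: w_def)
  have "1 * 1 \<le> real (Suc n) * 4 ^ Suc n" by (intro mult_mono one_le_power) auto
  then show "w (Suc n) \<le> 1" by (simp add: w_def divide_le_eq)
qed

text \<open>Number of bumps times height times width bounds the \<open>L^1\<close> mass of a layer.
  Its geometric decay serves for the integrability of \<open>f\<close> and for the errors at the
  integers.\<close>

lemma card_w_R_le: "3 * 4 ^ Suc n * w (Suc n) / R (Suc n) \<le> 3 * (1 / 2 powr c) ^ n"
proof -
  have "3 * 4 ^ Suc n * w (Suc n) / R (Suc n) = (3 / real (Suc n)) / R (Suc n)" by (simp add: w_def del: power_Suc)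
  also have "\<dots> \<le> (3 / 1) / R (Suc n)"
    using R_pos[of n] by (intro divide_right_mono divide_left_mono) auto
  also have "\<dots> \<le> 3 / (2 powr c) ^ n"
  proof -
    have "(2 powr c) ^ n \<le> (2 powr c) ^ Suc n" using two_powr_c by (intro power_increasing) auto
    then have "(2 powr c) ^ n \<le> R (Suc n)" using R_ge[of n] by linarith
    then show ?thesis using R_pos[of n] by (simp add: frac_le)
  qed
  finally show ?thesis by (simp add: power_divide)
qed

lemma summable_geom: "summable (\<lambda>n. 3 * (1 / 2 powr c) ^ n)"
  using two_powr_c by (intro summable_mult summable_geometric) auto

lemma summable_card_w_R: "summable (\<lambda>n. 3 * 4 ^ Suc n * w (Suc n) / R (Suc n))"
  by (rule summable_comparison_test'[OF summable_geom, of 0])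
    (use card_w_R_le w_pos R_pos in \<open>auto simp: less_imp_le\<close>)

lemma norm_T_le: "norm (T (Suc n) x) \<le> (\<Sum>k\<in>B (Suc n). w (Suc n) * gauss (R (Suc n) * (x - real k)))"
proof -
  have "norm (T (Suc n) x) \<le> w (Suc n) * (\<Sum>k\<in>B (Suc n). norm (d (Suc n) k * gauss (R (Suc n) * (x - real k))))"
  proof -
    have "norm (T (Suc n) x) = w (Suc n) * norm (\<Sum>k\<in>B (Suc n). d (Suc n) k * gauss (R (Suc n) * (x - real k)))"
      unfolding T_def norm_mult using w_pos[of n] by simp
    also have "\<dots> \<le> w (Suc n) * (\<Sum>k\<in>B (Suc n). norm (d (Suc n) k * gauss (R (Suc n) * (x - real k))))"
      using w_pos[of n] by (intro mult_left_mono norm_sum) auto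
    finally show ?thesis .
  qed
  also have "\<dots> \<le> w (Suc n) * (\<Sum>k\<in>B (Suc n). gauss (R (Suc n) * (x - real k)))"
    using w_pos[of n] d_le by (intro mult_left_mono sum_mono) (auto simp: norm_mult intro: mult_left_le_one_le)
  finally show ?thesis by (simp add: sum_distrib_left)
qed

lemma gauss_R_le: "gauss (R (Suc n) * y) \<le> gauss y"
proof (rule gauss_mono)
  have "1 * \<bar>y\<bar> \<le> R (Suc n) * \<bar>y\<bar>" using R_ge_1[of n] by (intro mult_right_mono) auto
  then show "\<bar>y\<bar> \<le> \<bar>R (Suc n) * y\<bar>" using R_pos[of n] by (simp add: abs_mult)
qed

abbreviation "G \<equiv> exp 1 * exp_sum_bound"

text \<open>The centres are distinct integers and no bump is wider than the one with
  \<open>R = 1\<close>, so the overlap is bounded uniformly in \<open>x\<close> and in the number of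
  layers. This is the mass bound for Jensen's inequality in the spatial norm.\<close>

lemma sum_gauss_le: "(\<Sum>n<N. \<Sum>k\<in>B (Suc n). gauss (R (Suc n) * (x - real k))) \<le> G"
proof -
  have "(\<Sum>n<N. \<Sum>k\<in>B (Suc n). gauss (R (Suc n) * (x - real k))) \<le> (\<Sum>n<N. \<Sum>k\<in>B (Suc n). gauss (x - real k))"
    by (intro sum_mono gauss_R_le)
  also have "\<dots> = (\<Sum>k\<in>{4..<4 ^ Suc N}. gauss (x - real k))" by (rule sum_B)
  also have "\<dots> \<le> G" by (intro sum_gauss_nat_le) auto
  finally show ?thesis .
qed

lemma summable_norm_T: "summable (\<lambda>n. norm (T (Suc n) x))"
proof (rule summableI_nonneg_bounded)
  fix N
  have "(\<Sum>n<N. norm (T (Suc n) x)) \<le> (\<Sum>n<N. \<Sum>k\<in>B (Suc n). gauss (R (Suc n) * (x - real k)))"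
  proof (intro sum_mono)
    fix n
    have "norm (T (Suc n) x) \<le> (\<Sum>k\<in>B (Suc n). w (Suc n) * gauss (R (Suc n) * (x - real k)))" by (rule norm_T_le)
    also have "\<dots> \<le> (\<Sum>k\<in>B (Suc n). gauss (R (Suc n) * (x - real k)))"
      using w_pos[of n] w_le_1[of n] by (intro sum_mono mult_left_le_one_le) auto
    finally show "norm (T (Suc n) x) \<le> \<dots>" .
  qed
  also have "\<dots> \<le> G" by (rule sum_gauss_le)
  finally show "(\<Sum>n<N. norm (T (Suc n) x)) \<le> G" .
qed simp

lemma T_sums: "(\<lambda>n. T (Suc n) x) sums f x"
  unfolding f_def by (rule summable_sums[OF summable_norm_cancel[OF summable_norm_T]])

lemma measurable_T [measurable]: "T n \<in> borel_measurable borel"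
  unfolding T_def by measurable

lemma measurable_f [measurable]: "f \<in> borel_measurable borel"
  unfolding f_def by measurable

lemma continuous_T: "continuous_on S (T n)"
  unfolding T_def by (intro continuous_intros)

text \<open>Continuity is local: the bumps of a layer with left end \<open>4 ^ n\<close> have
  distance at least \<open>4 ^ n - M\<close> from \<open>(- M, M)\<close>. By
  \<open>exp y >= y^2 / 2\<close> their tails are summable even after multiplication by their number
  \<open>3 * 4 ^ n\<close>.\<close>

lemma continuous_f: "continuous_on UNIV f"
proof -
  have "continuous_on {- real M<..<real M} f" for M :: nat
  proof -
    define m where "m = (\<lambda>n::nat. exp (1 + real M) * 24 * (1 / 4) ^ n)"
    have "uniform_limit {- real M<..<real M} (\<lambda>N x. \<Sum>n<N. T (Suc n) x) (\<lambda>x. \<Sum>n. T (Suc n) x) sequentially"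
    proof (rule Weierstrass_m_test)
      show "summable m" unfolding m_def by (intro summable_mult summable_geometric) auto
      fix n :: nat and x assume x: "x \<in> {- real M<..<real M}"
      have "norm (T (Suc n) x) \<le> (\<Sum>k\<in>B (Suc n). w (Suc n) * gauss (R (Suc n) * (x - real k)))" by (rule norm_T_le)
      also have "\<dots> \<le> (\<Sum>k\<in>B (Suc n). exp (1 + real M) * (2 / (4 ^ Suc n)\<^sup>2))"
      proof (rule sum_mono)
        fix k assume k: "k \<in> B (Suc n)"
        have "w (Suc n) * gauss (R (Suc n) * (x - real k)) \<le> gauss (R (Suc n) * (x - real k))"
          using w_pos[of n] w_le_1[of n] by (intro mult_left_le_one_le) auto
        also have "\<dots> \<le> gauss (x - real k)" by (rule gauss_R_le)
        also have "\<dots> \<le> exp 1 * exp (- \<bar>x - real k\<bar>)" by (rule gauss_le_exp)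
        also have "\<dots> \<le> exp 1 * exp (real M - 4 ^ Suc n)"
          using x B_ge(1)[OF k] by (intro mult_left_mono) auto
        also have "\<dots> = exp (1 + real M) * (1 / exp (4 ^ Suc n))"
          by (simp add: exp_diff exp_add)
        also have "\<dots> \<le> exp (1 + real M) * (2 / (4 ^ Suc n)\<^sup>2)"
        proof (intro mult_left_mono)
          have "1 + (4 ^ Suc n) + (4 ^ Suc n)\<^sup>2 / 2 \<le> exp (4 ^ Suc n :: real)"
            by (intro exp_lower_Taylor_quadratic) auto
          then have "(4 ^ Suc n)\<^sup>2 / 2 \<le> exp (4 ^ Suc n :: real)"
            by (smt (verit) zero_less_power)
          then show "1 / exp (4 ^ Suc n) \<le> (2 :: real) / (4 ^ Suc n)\<^sup>2"
            by (simp add: field_simps)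
        qed simp
        finally show "w (Suc n) * gauss (R (Suc n) * (x - real k)) \<le> exp (1 + real M) * (2 / (4 ^ Suc n)\<^sup>2)" .
      qed
      also have "\<dots> = exp (1 + real M) * (3 * 4 ^ Suc n * (2 / (4 ^ Suc n)\<^sup>2))"
        by (simp add: card_B)
      also have "\<dots> \<le> m n"
        by (simp add: m_def power2_eq_square field_simps)
      finally show "norm (T (Suc n) x) \<le> m n" .
    qed
    then show ?thesis
      unfolding f_def by (rule uniform_limit_theorem[rotated]) (auto intro!: always_eventually continuous_on_sum continuous_T)
  qed
  then have "continuous_on (\<Union>M. {- real M<..<real M}) f"
    by (intro continuous_on_open_UN) auto
  moreover have "(\<Union>M. {- real M<..<real M}) = UNIV"
  proof -
    have "x \<in> (\<Union>M. {- real M<..<real M})" for x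
    proof -
      obtain M where "\<bar>x\<bar> < real M" using reals_Archimedean2 by blast
      then show ?thesis by (auto intro!: exI[of _ M])
    qed
    then show ?thesis by auto
  qed
  ultimately show ?thesis by simp
qed

section \<open>The norm in space\<close>

text \<open>Jensen's inequality takes the Gaussians as masses, of total at most \<open>G\<close>,
  and the heights \<open>w\<close> as values. The bumps then contribute separately to the
  \<open>P\<close>-th power, each of them of order
  \<open>w powr P * k powr (alpha * P) / R\<close>.\<close>

lemma spatial_norm_finite:
  assumes P: "P \<ge> 1" and \<alpha>: "0 < \<alpha>" "P * \<alpha> \<le> c + P - 1" and P\<theta>: "P + \<theta> > 1"
  shows "wfin (1 / P) \<alpha> f"
proof -
  define J where "J = (\<integral>\<^sup>+t. ennreal ((1 + \<bar>t\<bar>) powr (\<alpha> * P) * gauss t) \<partial>lborel)"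
  have J: "J < \<infinity>" unfolding J_def using P \<alpha> by (intro nn_integral_powr_gauss_finite) auto
  define V where "V = (\<lambda>n x. \<Sum>k\<in>B (Suc n). w (Suc n) powr P * gauss (R (Suc n) * (x - real k)))"
  have V0: "V n x \<ge> 0" for n x unfolding V_def by (intro sum_nonneg) auto
  have [measurable]: "V n \<in> borel_measurable borel" for n unfolding V_def by measurable
  have pw: "ennreal (norm (f x) powr P) \<le> ennreal (G powr (P - 1)) * (\<Sum>n. ennreal (V n x))" for x
  proof (rule LIMSEQ_le_const2)
    show "(\<lambda>N. ennreal (norm (\<Sum>n<N. T (Suc n) x) powr P)) \<longlonglongrightarrow> ennreal (norm (f x) powr P)"
      using T_sums[of x] P unfolding sums_def
      by (intro tendsto_ennrealI tendsto_powr' tendsto_norm tendsto_const) auto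
    have "ennreal (norm (\<Sum>n<N. T (Suc n) x) powr P) \<le> ennreal (G powr (P - 1)) * (\<Sum>n. ennreal (V n x))" for N
    proof -
      define I where "I = (SIGMA n:{..<N}. B (Suc n))"
      define u where "u = (\<lambda>(n, k). gauss (R (Suc n) * (x - real k)))"
      define a where "a = (\<lambda>(n, k :: nat). w (Suc n))"
      have "norm (\<Sum>n<N. T (Suc n) x) \<le> (\<Sum>n<N. \<Sum>k\<in>B (Suc n). w (Suc n) * gauss (R (Suc n) * (x - real k)))"
        by (rule order_trans[OF norm_sum]) (intro sum_mono norm_T_le)
      also have "\<dots> = (\<Sum>i\<in>I. a i * u i)"
        unfolding I_def by (subst sum.Sigma) (auto simp: a_def u_def intro!: sum.cong)
      finally have "norm (\<Sum>n<N. T (Suc n) x) powr P \<le> (\<Sum>i\<in>I. a i * u i) powr P"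
        using P by (intro powr_mono2) auto
      also have "\<dots> \<le> G powr (P - 1) * (\<Sum>i\<in>I. a i powr P * u i)"
      proof (rule jensen_powr)
        show "sum u I \<le> G"
        proof -
          have "sum u I = (\<Sum>n<N. \<Sum>k\<in>B (Suc n). u (n, k))"
            unfolding I_def by (subst sum.Sigma) auto
          then show ?thesis using sum_gauss_le[of x N] by (simp add: u_def)
        qed
      qed (use P w_pos in \<open>auto simp: I_def u_def a_def less_imp_le\<close>)
      also have "(\<Sum>i\<in>I. a i powr P * u i) = (\<Sum>n<N. V n x)"
        unfolding I_def V_def by (subst sum.Sigma) (auto simp: a_def u_def intro!: sum.cong)
      finally have "ennreal (norm (\<Sum>n<N. T (Suc n) x) powr P) \<le> ennreal (G powr (P - 1)) * (\<Sum>n<N. ennreal (V n x))"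
        using V0 by (simp add: ennreal_leI sum_nonneg flip: ennreal_mult)
      also have "\<dots> \<le> ennreal (G powr (P - 1)) * (\<Sum>n. ennreal (V n x))"
        by (intro mult_left_mono sum_le_suminf) auto
      finally show ?thesis .
    qed
    then show "\<exists>N. \<forall>n\<ge>N. ennreal (norm (\<Sum>n<n. T (Suc n) x) powr P) \<le> ennreal (G powr (P - 1)) * (\<Sum>n. ennreal (V n x))"
      by blast
  qed
  define C where "C = 3 * 4 powr (\<alpha> * P)"
  have term_bound: "(\<integral>\<^sup>+x. ennreal (\<bar>x\<bar> powr (\<alpha> * P)) * ennreal (V n x) \<partial>lborel) \<le> J * ennreal (C * real (Suc n) powr (- (P + \<theta>)))" for n
  proof -
    have "(\<integral>\<^sup>+x. ennreal (\<bar>x\<bar> powr (\<alpha> * P)) * ennreal (V n x) \<partial>lborel)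
       = (\<integral>\<^sup>+x. (\<Sum>k\<in>B (Suc n). ennreal (w (Suc n) powr P) * ennreal (\<bar>x\<bar> powr (\<alpha> * P) * gauss (R (Suc n) * (x - real k)))) \<partial>lborel)"
      unfolding V_def
      by (intro nn_integral_cong)
        (simp add: sum_distrib_left mult_ac flip: ennreal_mult sum_ennreal)
    also have "\<dots> = (\<Sum>k\<in>B (Suc n). ennreal (w (Suc n) powr P) * (\<integral>\<^sup>+x. ennreal (\<bar>x\<bar> powr (\<alpha> * P) * gauss (R (Suc n) * (x - real k))) \<partial>lborel))"
      by (simp add: nn_integral_sum nn_integral_cmult)
    also have "\<dots> \<le> (\<Sum>k\<in>B (Suc n). ennreal (w (Suc n) powr P) * (ennreal ((4 * 4 ^ Suc n) powr (\<alpha> * P) / R (Suc n)) * J))"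
    proof (intro sum_mono mult_left_mono)
      fix k assume k: "k \<in> B (Suc n)"
      have "(\<integral>\<^sup>+x. ennreal (\<bar>x\<bar> powr (\<alpha> * P) * gauss (R (Suc n) * (x - real k))) \<partial>lborel) \<le> ennreal (real k powr (\<alpha> * P) / R (Suc n)) * J"
        unfolding J_def using k R_ge_1 B_ge P \<alpha> by (intro nn_integral_powr_gauss_translate_le) auto
      also have "\<dots> \<le> ennreal ((4 * 4 ^ Suc n) powr (\<alpha> * P) / R (Suc n)) * J"
        using B_ge(2)[OF k] R_pos[of n] P \<alpha> by (intro mult_right_mono ennreal_leI divide_right_mono powr_mono2) auto
      finally show "(\<integral>\<^sup>+x. ennreal (\<bar>x\<bar> powr (\<alpha> * P) * gauss (R (Suc n) * (x - real k))) \<partial>lborel) \<le> \<dots>" .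
    qed auto
    also have "\<dots> = ennreal (3 * 4 ^ Suc n) * (ennreal (w (Suc n) powr P) * (ennreal ((4 * 4 ^ Suc n) powr (\<alpha> * P) / R (Suc n)) * J))"
      by (simp only: sum_constant card_B[symmetric] ennreal_of_nat_eq_real_of_nat)
    also have "\<dots> = J * ennreal (3 * 4 ^ Suc n * w (Suc n) powr P * (4 * 4 ^ Suc n) powr (\<alpha> * P) / R (Suc n))"
      using R_pos[of n] by (simp add: ennreal_mult[symmetric] mult.commute[of _ J] mult.left_commute[of _ J]) (simp add: mult.assoc)
    also have "\<dots> \<le> J * ennreal (C * real (Suc n) powr (- (P + \<theta>)))"
    proof (intro mult_left_mono ennreal_leI)
      define K where "K = (4::real) ^ Suc n"
      define m where "m = real (Suc n)"
      have K: "K \<ge> 1" unfolding K_def by (intro one_le_power) auto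
      have m: "m > 0" by (simp add: m_def)
      have wK: "w (Suc n) = 1 / (m * K)" and RK: "R (Suc n) = K powr c * m powr \<theta>"
        unfolding w_def R_def K_def m_def by (rule refl)+
      have "3 * K * w (Suc n) powr P * (4 * K) powr (\<alpha> * P) / R (Suc n)
          = 3 * K * (m powr (- P) * K powr (- P)) * (4 powr (\<alpha> * P) * K powr (\<alpha> * P)) * (K powr (- c) * m powr (- \<theta>))"
        unfolding wK RK using K m by (simp add: powr_divide powr_mult powr_minus field_simps)
      also have "\<dots> = C * m powr (- (P + \<theta>)) * K powr (1 - P + \<alpha> * P - c)"
        using K m by (simp add: C_def powr_add powr_diff powr_minus field_simps)
      \<comment> \<open>The exponent of \<open>K\<close> is at most 0 by
        \<open>P * alpha <= c + P - 1\<close>. What remains is the power of \<open>m\<close>,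
        summable because \<open>P + theta > 1\<close>.\<close>
      also have "\<dots> \<le> C * m powr (- (P + \<theta>)) * K powr 0"
        using K \<alpha> by (intro mult_left_mono powr_mono) (auto simp: C_def mult.commute)
      finally show "3 * 4 ^ Suc n * w (Suc n) powr P * (4 * 4 ^ Suc n) powr (\<alpha> * P) / R (Suc n) \<le> C * real (Suc n) powr (- (P + \<theta>))"
        using K by (simp add: K_def m_def)
    qed auto
    finally show ?thesis .
  qed
  have "(\<integral>\<^sup>+x. ennreal ((norm (f x) * \<bar>x\<bar> powr \<alpha>) powr P) \<partial>lborel)
      \<le> (\<integral>\<^sup>+x. ennreal (G powr (P - 1)) * (\<Sum>n. ennreal (\<bar>x\<bar> powr (\<alpha> * P)) * ennreal (V n x)) \<partial>lborel)"
  proof (rule nn_integral_mono)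
    fix x
    have "ennreal ((norm (f x) * \<bar>x\<bar> powr \<alpha>) powr P) = ennreal (\<bar>x\<bar> powr (\<alpha> * P)) * ennreal (norm (f x) powr P)"
      by (simp add: powr_mult powr_powr mult.commute flip: ennreal_mult)
    also have "\<dots> \<le> ennreal (\<bar>x\<bar> powr (\<alpha> * P)) * (ennreal (G powr (P - 1)) * (\<Sum>n. ennreal (V n x)))"
      by (intro mult_left_mono pw) auto
    finally show "ennreal ((norm (f x) * \<bar>x\<bar> powr \<alpha>) powr P) \<le> ennreal (G powr (P - 1)) * (\<Sum>n. ennreal (\<bar>x\<bar> powr (\<alpha> * P)) * ennreal (V n x))"
      unfolding ennreal_suminf_cmult by (simp add: mult.left_commute)
  qed
  also have "\<dots> = ennreal (G powr (P - 1)) * (\<Sum>n. \<integral>\<^sup>+x. ennreal (\<bar>x\<bar> powr (\<alpha> * P)) * ennreal (V n x) \<partial>lborel)"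
    by (subst nn_integral_cmult, measurable, subst nn_integral_suminf) auto
  also have "\<dots> \<le> ennreal (G powr (P - 1)) * (\<Sum>n. J * ennreal (C * real (Suc n) powr (- (P + \<theta>))))"
    by (intro mult_left_mono suminf_le term_bound) auto
  also have "\<dots> < \<infinity>"
  proof -
    have "summable (\<lambda>n. C * real (Suc n) powr (- (P + \<theta>)))"
      using P\<theta> by (intro summable_mult) (subst summable_Suc_iff, simp add: summable_real_powr_iff)
    then have "(\<Sum>n. ennreal (C * real (Suc n) powr (- (P + \<theta>)))) < \<infinity>"
      by (subst suminf_ennreal2) (auto simp: C_def)
    then show ?thesis using J by (simp add: ennreal_mult_less_top)
  qed
  finally show ?thesis using P by (simp add: wfin_def)
qed

section \<open>The norm in frequency\<close>

lemma integral_norm_T_le: "integrable lborel (T (Suc n))"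
  "(\<integral>x. norm (T (Suc n) x) \<partial>lborel) \<le> 3 * 4 ^ Suc n * w (Suc n) / R (Suc n)"
proof -
  have i: "integrable lborel (\<lambda>x. gauss (R (Suc n) * (x - real k)))" for k
    by (rule has_bochner_integral_gauss_translate(1)[OF R_pos])
  show int: "integrable lborel (T (Suc n))"
    unfolding T_def using i by (intro integrable_mult_right Bochner_Integration.integrable_sum integrable_of_real) auto
  have "(\<integral>x. norm (T (Suc n) x) \<partial>lborel) \<le> (\<integral>x. (\<Sum>k\<in>B (Suc n). w (Suc n) * gauss (R (Suc n) * (x - real k))) \<partial>lborel)"
    using int i norm_T_le by (intro integral_mono) auto
  also have "\<dots> = (\<Sum>k\<in>B (Suc n). w (Suc n) * (1 / R (Suc n)))"
    using i has_bochner_integral_gauss_translate(2)[OF R_pos] by (subst Bochner_Integration.integral_sum) auto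
  also have "\<dots> = 3 * 4 ^ Suc n * w (Suc n) / R (Suc n)"
    by (simp add: card_B)
  finally show "(\<integral>x. norm (T (Suc n) x) \<partial>lborel) \<le> 3 * 4 ^ Suc n * w (Suc n) / R (Suc n)" .
qed

text \<open>The transform separates into a Gaussian envelope of width \<open>R\<close> and the
  1-periodic sum \<open>D\<close>, which alone sees the coefficients.\<close>

lemma ft_T: "ft (T (Suc n)) \<xi> = w (Suc n) / R (Suc n) * gauss (\<xi> / R (Suc n)) * D (Suc n) \<xi>"
proof -
  have i: "integrable lborel (\<lambda>x. complex_of_real (gauss (R (Suc n) * (x - real k))) * ee (- (x * \<xi>)))" for k
    using has_bochner_integral_gauss_translate(1)[OF R_pos, of n "real k"]
    by (intro integrable_times_ee integrable_of_real)
  have "ft (T (Suc n)) \<xi> = (\<integral>x. (\<Sum>k\<in>B (Suc n). (w (Suc n) * d (Suc n) k) * (gauss (R (Suc n) * (x - real k)) * ee (- (x * \<xi>)))) \<partial>lborel)"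
    unfolding ft_def T_def by (simp add: sum_distrib_left sum_distrib_right mult.assoc)
  also have "\<dots> = (\<Sum>k\<in>B (Suc n). (w (Suc n) * d (Suc n) k) * (gauss (\<xi> / R (Suc n)) / R (Suc n) * ee (- (real k * \<xi>))))"
    using i has_bochner_integral_gauss_translate(3)[OF R_pos] by (subst Bochner_Integration.integral_sum) auto
  also have "\<dots> = w (Suc n) / R (Suc n) * gauss (\<xi> / R (Suc n)) * D (Suc n) \<xi>"
    unfolding D_def sum_distrib_left by (intro sum.cong refl) simp
  finally show ?thesis .
qed

lemma integrable_f: "integrable lborel f"
  unfolding f_def
proof (rule integrable_suminf)
  show "summable (\<lambda>n. \<integral>x. norm (T (Suc n) x) \<partial>lborel)"
    by (rule summable_comparison_test'[OF summable_card_w_R, of 0]) (use integral_norm_T_le in auto)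
qed (use integral_norm_T_le summable_norm_T in auto)

lemma ft_f_sums: "(\<lambda>n. ft (T (Suc n)) \<xi>) sums ft f \<xi>"
proof -
  have "(\<lambda>n. \<integral>x. T (Suc n) x * ee (- (x * \<xi>)) \<partial>lborel) sums (\<integral>x. (\<Sum>n. T (Suc n) x * ee (- (x * \<xi>))) \<partial>lborel)"
  proof (rule sums_integral)
    show "summable (\<lambda>n. \<integral>x. norm (T (Suc n) x * ee (- (x * \<xi>))) \<partial>lborel)"
      by (rule summable_comparison_test'[OF summable_card_w_R, of 0]) (use integral_norm_T_le in \<open>auto simp: norm_mult\<close>)
  qed (use integral_norm_T_le summable_norm_T in \<open>auto simp: norm_mult intro: integrable_times_ee\<close>)
  moreover have "(\<Sum>n. T (Suc n) x * ee (- (x * \<xi>))) = f x * ee (- (x * \<xi>))" for x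
    using sums_mult2[OF T_sums[of x], of "ee (- (x * \<xi>))"] by (rule sums_unique[symmetric])
  ultimately show ?thesis by (simp add: ft_def)
qed

text \<open>For nonzero \<open>xi\<close> this is \<open>min (|xi| / R) (R / |xi|) powr beta\<close>
  with \<open>R = R (Suc n)\<close>: it localises a layer at frequencies of size
  \<open>R\<close>.\<close>

definition u :: "real \<Rightarrow> nat \<Rightarrow> real \<Rightarrow> real" where
  "u \<beta> n \<xi> = exp (- (\<beta> * \<bar>ln \<bar>\<xi>\<bar> - ln (R (Suc n))\<bar>))"

text \<open>\<open>R_step\<close> separates the logarithms by \<open>c * ln 2\<close>, so at every
  frequency the layers add up like a geometric series.\<close>

lemma sum_u_le:
  assumes "\<beta> > 0"
  shows "(\<Sum>n<N. u \<beta> n \<xi>) \<le> 2 / (1 - exp (- (\<beta> * (c * ln 2))))"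
  unfolding u_def
proof (rule sum_exp_separated_le)
  fix i
  have "ln (2 powr c * R (Suc i)) \<le> ln (R (Suc (Suc i)))"
    using R_step[of i] R_pos[of i] R_pos[of "Suc i"] by (subst ln_le_cancel_iff) auto
  then show "ln (R (Suc i)) + c * ln 2 \<le> ln (R (Suc (Suc i)))"
    using R_pos[of i] by (simp add: ln_mult ln_powr)
qed (use assms c_pos in auto)

text \<open>In \<open>t = |xi| / R\<close> the claim is that \<open>t powr beta * gauss t\<close> is
  at most a constant times \<open>exp (- beta * |ln t|) / (1 + t)^2\<close>. For
  \<open>t < 1\<close> the exponential equals \<open>t powr beta\<close>; for \<open>t >= 1\<close>
  the Gaussian pays for the extra \<open>t powr (2 * beta)\<close>. It also pays for the quadratic
  decay.\<close>

lemma gauss_times_weight_le: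
  assumes \<beta>: "\<beta> > 0"
  obtains C where "C > 0" "\<And>n \<xi>. \<xi> \<noteq> 0 \<Longrightarrow>
    \<bar>\<xi>\<bar> powr \<beta> * gauss (\<xi> / R (Suc n)) \<le> C * R (Suc n) powr \<beta> / (1 + \<bar>\<xi>\<bar> / R (Suc n))\<^sup>2 * u \<beta> n \<xi>"
proof -
  obtain C where C: "C > 0" "\<And>t. t \<ge> 0 \<Longrightarrow> (1 + t) powr (2 * \<beta> + 2) * gauss t \<le> C"
    using powr_gauss_bounded[of "2 * \<beta> + 2"] by blast
  show thesis
  proof (rule that[of "2 * C"])
    show "2 * C > 0" using C by simp
    fix n :: nat and \<xi> :: real assume \<xi>: "\<xi> \<noteq> 0"
    define t where "t = \<bar>\<xi>\<bar> / R (Suc n)"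
    have t: "t > 0" using \<xi> R_pos[of n] by (simp add: t_def)
    have lnt: "ln \<bar>\<xi>\<bar> - ln (R (Suc n)) = ln t" using \<xi> R_pos[of n] by (simp add: t_def ln_div)
    have "t powr \<beta> \<le> 2 * (1 + t) powr (2 * \<beta>) * exp (- (\<beta> * \<bar>ln t\<bar>))"
    proof (cases "t \<ge> 1")
      case True
      then have "exp (- (\<beta> * \<bar>ln t\<bar>)) = t powr (- \<beta>)" using t by (simp add: powr_def)
      moreover have "t powr \<beta> = t powr (2 * \<beta>) * t powr (- \<beta>)" by (simp flip: powr_add)
      moreover have "t powr (2 * \<beta>) \<le> 2 * (1 + t) powr (2 * \<beta>)"
        using t \<beta> powr_mono2[of "2 * \<beta>" t "1 + t"] powr_ge_zero[of "1 + t" "2 * \<beta>"] by linarith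
      ultimately show ?thesis by (simp add: mult_right_mono)
    next
      case False
      then have "exp (- (\<beta> * \<bar>ln t\<bar>)) = t powr \<beta>" using t by (simp add: powr_def)
      moreover have "1 \<le> (1 + t) powr (2 * \<beta>)" using t \<beta> by (intro ge_one_powr_ge_zero) auto
      then have "1 * t powr \<beta> \<le> (2 * (1 + t) powr (2 * \<beta>)) * t powr \<beta>" by (intro mult_right_mono) auto
      ultimately show ?thesis by simp
    qed
    then have "t powr \<beta> * gauss t \<le> 2 * (1 + t) powr (2 * \<beta>) * exp (- (\<beta> * \<bar>ln t\<bar>)) * gauss t"
      by (intro mult_right_mono) auto
    also have "\<dots> = 2 * ((1 + t) powr (2 * \<beta> + 2) * gauss t) / (1 + t)\<^sup>2 * exp (- (\<beta> * \<bar>ln t\<bar>))"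
      using t by (simp add: powr_add)
    also have "\<dots> \<le> 2 * C / (1 + t)\<^sup>2 * exp (- (\<beta> * \<bar>ln t\<bar>))"
      using C(2)[of t] t by (intro mult_right_mono divide_right_mono mult_left_mono) auto
    finally have "R (Suc n) powr \<beta> * (t powr \<beta> * gauss t) \<le> R (Suc n) powr \<beta> * (2 * C / (1 + t)\<^sup>2 * exp (- (\<beta> * \<bar>ln t\<bar>)))"
      by (intro mult_left_mono) auto
    moreover have p: "R (Suc n) powr \<beta> * t powr \<beta> = \<bar>\<xi>\<bar> powr \<beta>"
      using R_pos[of n] by (simp add: t_def powr_divide)
    moreover have g: "gauss t = gauss (\<xi> / R (Suc n))"
      by (simp add: t_def gauss_def power_divide)
    ultimately show "\<bar>\<xi>\<bar> powr \<beta> * gauss (\<xi> / R (Suc n)) \<le> 2 * C * R (Suc n) powr \<beta> / (1 + \<bar>\<xi>\<bar> / R (Suc n))\<^sup>2 * u \<beta> n \<xi>"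
      unfolding u_def lnt t_def[symmetric] p[symmetric] g[symmetric] by (simp add: mult_ac)
  qed
qed

text \<open>The size of the weighted transform of a layer once the localisation \<open>u\<close> is
  split off. A quadratic envelope replaces the Gaussian; it is enough to integrate a periodic
  function over the line.\<close>

definition a :: "real \<Rightarrow> nat \<Rightarrow> real \<Rightarrow> real" where
  "a \<beta> n \<xi> = w (Suc n) * R (Suc n) powr (\<beta> - 1) * (norm (D (Suc n) \<xi>) / (1 + \<bar>\<xi>\<bar> / R (Suc n))\<^sup>2)"

lemma measurable_D [measurable]: "D n \<in> borel_measurable borel"
  unfolding D_def by measurable

lemma measurable_a [measurable]: "a \<beta> n \<in> borel_measurable borel"
  unfolding a_def by measurable

lemma a_nonneg [simp]: "a \<beta> n \<xi> \<ge> 0"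
  using w_pos[of n] by (simp add: a_def)

lemma norm_ft_partial_le:
  assumes \<beta>: "\<beta> > 0"
  obtains C where "C > 0" "\<And>N \<xi>. \<xi> \<noteq> 0 \<Longrightarrow>
    norm (\<Sum>n<N. ft (T (Suc n)) \<xi>) * \<bar>\<xi>\<bar> powr \<beta> \<le> C * (\<Sum>n<N. a \<beta> n \<xi> * u \<beta> n \<xi>)"
proof -
  obtain C where C: "C > 0" and le: "\<And>n \<xi>. \<xi> \<noteq> 0 \<Longrightarrow>
    \<bar>\<xi>\<bar> powr \<beta> * gauss (\<xi> / R (Suc n)) \<le> C * R (Suc n) powr \<beta> / (1 + \<bar>\<xi>\<bar> / R (Suc n))\<^sup>2 * u \<beta> n \<xi>"
    using gauss_times_weight_le[OF \<beta>] by blast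
  have each: "norm (ft (T (Suc n)) \<xi>) * \<bar>\<xi>\<bar> powr \<beta> \<le> C * (a \<beta> n \<xi> * u \<beta> n \<xi>)" if "\<xi> \<noteq> 0" for n \<xi>
  proof -
    have "norm (ft (T (Suc n)) \<xi>) * \<bar>\<xi>\<bar> powr \<beta> = w (Suc n) / R (Suc n) * norm (D (Suc n) \<xi>) * (\<bar>\<xi>\<bar> powr \<beta> * gauss (\<xi> / R (Suc n)))"
      unfolding ft_T using w_pos[of n] R_pos[of n] by (simp add: norm_mult norm_divide)
    also have "\<dots> \<le> w (Suc n) / R (Suc n) * norm (D (Suc n) \<xi>) * (C * R (Suc n) powr \<beta> / (1 + \<bar>\<xi>\<bar> / R (Suc n))\<^sup>2 * u \<beta> n \<xi>)"
      using w_pos[of n] R_pos[of n] by (intro mult_left_mono le that) auto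
    also have "\<dots> = C * (a \<beta> n \<xi> * u \<beta> n \<xi>)"
      using R_pos[of n] by (simp add: a_def powr_diff)
    finally show ?thesis .
  qed
  show thesis
  proof (rule that[OF C])
    fix N and \<xi> :: real assume \<xi>: "\<xi> \<noteq> 0"
    have "norm (\<Sum>n<N. ft (T (Suc n)) \<xi>) * \<bar>\<xi>\<bar> powr \<beta> \<le> (\<Sum>n<N. norm (ft (T (Suc n)) \<xi>)) * \<bar>\<xi>\<bar> powr \<beta>"
      by (intro mult_right_mono norm_sum) auto
    also have "\<dots> \<le> C * (\<Sum>n<N. a \<beta> n \<xi> * u \<beta> n \<xi>)"
      unfolding sum_distrib_left sum_distrib_right by (intro sum_mono each \<xi>)
    finally show "norm (\<Sum>n<N. ft (T (Suc n)) \<xi>) * \<bar>\<xi>\<bar> powr \<beta> \<le> C * (\<Sum>n<N. a \<beta> n \<xi> * u \<beta> n \<xi>)" .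
  qed
qed

lemma LIMSEQ_norm_ft_partial:
  "(\<lambda>N. norm (\<Sum>n<N. ft (T (Suc n)) \<xi>) * \<bar>\<xi>\<bar> powr \<beta>) \<longlonglongrightarrow> norm (ft f \<xi>) * \<bar>\<xi>\<bar> powr \<beta>"
  using ft_f_sums[of \<xi>] unfolding sums_def by (intro tendsto_mult tendsto_norm tendsto_const)

lemma frequency_norm_finite_infinity:
  assumes b: "b > 0" "b * \<theta> \<le> 1" and c: "c * b = 1 / 2"
    and D: "\<And>n \<xi>. norm (D n \<xi>) \<le> C0 * (4 ^ n) powr (1 / 2)"
  shows "wfin 0 (b + 1) (ft f)"
proof -
  have \<beta>: "b + 1 > 0" using b by simp
  obtain C where C: "C > 0" and le: "\<And>N \<xi>. \<xi> \<noteq> 0 \<Longrightarrow>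
    norm (\<Sum>n<N. ft (T (Suc n)) \<xi>) * \<bar>\<xi>\<bar> powr (b + 1) \<le> C * (\<Sum>n<N. a (b + 1) n \<xi> * u (b + 1) n \<xi>)"
    using norm_ft_partial_le[OF \<beta>] by blast
  define U where "U = 2 / (1 - exp (- ((b + 1) * (c * ln 2))))"
  have "norm (D 0 0) \<ge> 0" by simp
  then have C0: "C0 \<ge> 0" using D[of 0 0] by (simp del: norm_ge_zero)
  have a_le: "a (b + 1) n \<xi> \<le> C0" for n \<xi>
  proof -
    define K where "K = (4::real) ^ Suc n"
    define m where "m = real (Suc n)"
    have K: "K > 0" by (simp add: K_def)
    have m: "m \<ge> 1" by (simp add: m_def)
    have wK: "w (Suc n) = 1 / (m * K)" and RK: "R (Suc n) = K powr c * m powr \<theta>"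
      unfolding w_def R_def K_def m_def by (rule refl)+
    have "norm (D (Suc n) \<xi>) / (1 + \<bar>\<xi>\<bar> / R (Suc n))\<^sup>2 \<le> norm (D (Suc n) \<xi>) / 1"
    proof -
      have "x / y \<le> x / 1" if "1 \<le> y" "0 \<le> x" for x y :: real
        using that by (intro divide_left_mono) auto
      moreover have "1 \<le> (1 + \<bar>\<xi>\<bar> / R (Suc n))\<^sup>2" using R_pos[of n] by (intro one_le_power) auto
      ultimately show ?thesis by simp
    qed
    also have "\<dots> \<le> C0 * K powr (1 / 2)" using D[of "Suc n" \<xi>] by (simp only: K_def div_by_1)
    finally have "(w (Suc n) * R (Suc n) powr b) * (norm (D (Suc n) \<xi>) / (1 + \<bar>\<xi>\<bar> / R (Suc n))\<^sup>2)
        \<le> (w (Suc n) * R (Suc n) powr b) * (C0 * K powr (1 / 2))"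
      by (rule mult_left_mono) (use w_pos[of n] in auto)
    then have "a (b + 1) n \<xi> \<le> w (Suc n) * R (Suc n) powr b * (C0 * K powr (1 / 2))"
      by (simp add: a_def)
    \<comment> \<open>The powers of \<open>K\<close> cancel: \<open>D\<close> gives
      \<open>K powr (1 / 2)\<close>, \<open>R powr b\<close> gives another because
      \<open>c * b = 1 / 2\<close>, and \<open>w\<close> gives \<open>1 / K\<close>.\<close>
    also have "\<dots> = C0 * m powr (b * \<theta> - 1)"
    proof -
      have "R (Suc n) powr b = K powr (c * b) * m powr (b * \<theta>)"
        unfolding RK using K m by (simp add: powr_mult powr_powr mult.commute)
      moreover have "K powr (1 / 2) * K powr (1 / 2) = K" using K by (simp flip: powr_add)
      ultimately have "w (Suc n) * R (Suc n) powr b * (C0 * K powr (1 / 2)) = C0 * (K / (m * K)) * m powr (b * \<theta>)"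
        unfolding wK c by (simp add: mult_ac)
      then show ?thesis using K m by (simp add: powr_diff)
    qed
    also have "\<dots> \<le> C0 * m powr 0"
      using m b C0 by (intro mult_left_mono powr_mono) auto
    also have "\<dots> = C0" using m by simp
    finally show ?thesis .
  qed
  have bound: "norm (ft f \<xi>) * \<bar>\<xi>\<bar> powr (b + 1) \<le> C * (C0 * U)" if "\<xi> \<noteq> 0" for \<xi>
  proof (rule LIMSEQ_le_const2[OF LIMSEQ_norm_ft_partial])
    have "norm (\<Sum>n<N. ft (T (Suc n)) \<xi>) * \<bar>\<xi>\<bar> powr (b + 1) \<le> C * (C0 * U)" for N
    proof -
      have "(\<Sum>n<N. a (b + 1) n \<xi> * u (b + 1) n \<xi>) \<le> (\<Sum>n<N. C0 * u (b + 1) n \<xi>)"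
        by (intro sum_mono mult_right_mono a_le) (simp add: u_def)
      also have "\<dots> \<le> C0 * U"
        unfolding sum_distrib_left[symmetric] U_def by (intro mult_left_mono sum_u_le \<beta> C0)
      finally show ?thesis using le[OF that, of N] C by (meson less_imp_le mult_left_mono order_trans)
    qed
    then show "\<exists>N. \<forall>n\<ge>N. norm (\<Sum>n<n. ft (T (Suc n)) \<xi>) * \<bar>\<xi>\<bar> powr (b + 1) \<le> C * (C0 * U)" by blast
  qed
  have "AE \<xi> in lborel. norm (ft f \<xi>) * \<bar>\<xi>\<bar> powr (b + 1) \<le> C * (C0 * U)"
    using AE_lborel_singleton[of "0::real"] by eventually_elim (rule bound)
  then show ?thesis by (auto simp: wfin_def)
qed

text \<open>The hypothesis on \<open>D\<close> says that its \<open>L^Q\<close> norm over a period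
  is at most of order \<open>K powr (1 - s)\<close> with \<open>K = 4 ^ n\<close>. Jensen's
  inequality with masses \<open>u\<close> separates the layers, and \<open>c * b = s\<close> is what
  makes the powers of \<open>K\<close> cancel in each of them.\<close>

lemma frequency_norm_finite:
  assumes Q: "Q \<ge> 1" and b: "b > 0" and c: "c * b = s" and bQ: "Q * (1 - b * \<theta>) > 1" and C0: "C0 \<ge> 0"
    and D: "\<And>n (l::int). (\<integral>\<^sup>+x. ennreal (norm (D n x) powr Q) * indicator {of_int l..of_int l + 1} x \<partial>lborel)
      \<le> ennreal (C0 * (4 ^ n) powr ((1 - s) * Q))"
  shows "wfin (1 / Q) (b + 1 - 1 / Q) (ft f)"
proof -
  define \<beta> where "\<beta> = b + 1 - 1 / Q"
  have \<beta>: "\<beta> > 0" 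
  proof -
    have "1 / Q \<le> 1" using Q by simp
    then show ?thesis using b unfolding \<beta>_def by linarith
  qed
  obtain C where C: "C > 0" and le: "\<And>N \<xi>. \<xi> \<noteq> 0 \<Longrightarrow>
    norm (\<Sum>n<N. ft (T (Suc n)) \<xi>) * \<bar>\<xi>\<bar> powr \<beta> \<le> C * (\<Sum>n<N. a \<beta> n \<xi> * u \<beta> n \<xi>)"
    using norm_ft_partial_le[OF \<beta>] by blast
  define U where "U = 2 / (1 - exp (- (\<beta> * (c * ln 2))))"
  define C1 where "C1 = C powr Q * U powr (Q - 1)"
  have pw: "ennreal ((norm (ft f \<xi>) * \<bar>\<xi>\<bar> powr \<beta>) powr Q) \<le> ennreal C1 * (\<Sum>n. ennreal (a \<beta> n \<xi> powr Q))" if "\<xi> \<noteq> 0" for \<xi>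
  proof (rule LIMSEQ_le_const2)
    show "(\<lambda>N. ennreal ((norm (\<Sum>n<N. ft (T (Suc n)) \<xi>) * \<bar>\<xi>\<bar> powr \<beta>) powr Q)) \<longlonglongrightarrow> ennreal ((norm (ft f \<xi>) * \<bar>\<xi>\<bar> powr \<beta>) powr Q)"
      using Q by (intro tendsto_ennrealI tendsto_powr'[OF LIMSEQ_norm_ft_partial tendsto_const]) auto
    have "ennreal ((norm (\<Sum>n<N. ft (T (Suc n)) \<xi>) * \<bar>\<xi>\<bar> powr \<beta>) powr Q) \<le> ennreal C1 * (\<Sum>n. ennreal (a \<beta> n \<xi> powr Q))" for N
    proof -
      have "(norm (\<Sum>n<N. ft (T (Suc n)) \<xi>) * \<bar>\<xi>\<bar> powr \<beta>) powr Q \<le> (C * (\<Sum>n<N. a \<beta> n \<xi> * u \<beta> n \<xi>)) powr Q"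
        using Q le[OF that] by (intro powr_mono2) auto
      also have "\<dots> = C powr Q * (\<Sum>n<N. a \<beta> n \<xi> * u \<beta> n \<xi>) powr Q"
        by (rule powr_mult)
      also have "\<dots> \<le> C powr Q * (U powr (Q - 1) * (\<Sum>n<N. a \<beta> n \<xi> powr Q * u \<beta> n \<xi>))"
        using Q sum_u_le[OF \<beta>, of \<xi> N] unfolding U_def
        by (intro mult_left_mono jensen_powr) (auto simp: u_def)
      also have "\<dots> \<le> C1 * (\<Sum>n<N. a \<beta> n \<xi> powr Q)"
        unfolding C1_def mult.assoc using \<beta>
        by (intro mult_left_mono sum_mono mult_left_le) (auto simp: u_def)
      finally have "ennreal ((norm (\<Sum>n<N. ft (T (Suc n)) \<xi>) * \<bar>\<xi>\<bar> powr \<beta>) powr Q) \<le> ennreal C1 * (\<Sum>n<N. ennreal (a \<beta> n \<xi> powr Q))"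
        by (simp add: ennreal_leI C1_def sum_nonneg flip: ennreal_mult)
      also have "\<dots> \<le> ennreal C1 * (\<Sum>n. ennreal (a \<beta> n \<xi> powr Q))"
        by (intro mult_left_mono sum_le_suminf) auto
      finally show ?thesis .
    qed
    then show "\<exists>N. \<forall>n\<ge>N. ennreal ((norm (\<Sum>n<n. ft (T (Suc n)) \<xi>) * \<bar>\<xi>\<bar> powr \<beta>) powr Q) \<le> ennreal C1 * (\<Sum>n. ennreal (a \<beta> n \<xi> powr Q))"
      by blast
  qed
  have a_int: "(\<integral>\<^sup>+\<xi>. ennreal (a \<beta> n \<xi> powr Q) \<partial>lborel) \<le> ennreal (4 * C0 * real (Suc n) powr (- (Q * (1 - b * \<theta>))))" for n
  proof -
    define K where "K = (4::real) ^ Suc n"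
    define m where "m = real (Suc n)"
    have K: "K > 0" by (simp add: K_def)
    have m: "m > 0" by (simp add: m_def)
    have wK: "w (Suc n) = 1 / (m * K)" and RK: "R (Suc n) = K powr c * m powr \<theta>"
      unfolding w_def R_def K_def m_def by (rule refl)+
    define r where "r = R (Suc n)"
    have r: "r \<ge> 1" unfolding r_def by (rule R_ge_1)
    define A where "A = (w (Suc n) * r powr (\<beta> - 1)) powr Q"
    have "(\<integral>\<^sup>+\<xi>. ennreal (a \<beta> n \<xi> powr Q) \<partial>lborel) \<le> (\<integral>\<^sup>+\<xi>. ennreal A * ennreal (norm (D (Suc n) \<xi>) powr Q * (1 / (1 + \<bar>\<xi>\<bar> / r)\<^sup>2)) \<partial>lborel)"
    proof (rule nn_integral_mono)
      fix \<xi> :: real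
      define y where "y = 1 / (1 + \<bar>\<xi>\<bar> / r)\<^sup>2"
      define z where "z = (1 + \<bar>\<xi>\<bar> / r)\<^sup>2"
      have "1 \<le> z" unfolding z_def using r by (intro one_le_power) auto
      then have y: "0 < y" "y \<le> 1" unfolding y_def z_def[symmetric] by (auto simp: divide_le_eq)
      have "a \<beta> n \<xi> powr Q = A * (norm (D (Suc n) \<xi>) powr Q * y powr Q)"
        unfolding a_def A_def r_def[symmetric] using w_pos[of n] y
        by (simp add: powr_mult y_def powr_divide)
      also have "\<dots> \<le> A * (norm (D (Suc n) \<xi>) powr Q * y)"
        using y Q powr_mono'[of 1 Q y] by (intro mult_left_mono) (auto simp: A_def)
      finally show "ennreal (a \<beta> n \<xi> powr Q) \<le> ennreal A * ennreal (norm (D (Suc n) \<xi>) powr Q * (1 / (1 + \<bar>\<xi>\<bar> / r)\<^sup>2))"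
        unfolding y_def by (simp add: ennreal_leI A_def flip: ennreal_mult)
    qed
    also have "\<dots> = ennreal A * (\<integral>\<^sup>+\<xi>. ennreal (norm (D (Suc n) \<xi>) powr Q * (1 / (1 + \<bar>\<xi>\<bar> / r)\<^sup>2)) \<partial>lborel)"
      by (rule nn_integral_cmult) measurable
    also have "\<dots> \<le> ennreal A * ennreal (2 * (C0 * K powr ((1 - s) * Q)) * (\<Sum>l. 1 / (1 + real l / r)\<^sup>2))"
    proof (intro mult_left_mono nn_integral_weight_le)
      show "(\<integral>\<^sup>+x. ennreal (norm (D (Suc n) x) powr Q) * indicator {real_of_int l..real_of_int l + 1} x \<partial>lborel) \<le> ennreal (C0 * K powr ((1 - s) * Q))" for l
        using D[of "Suc n" l] unfolding K_def .
      show "1 / (1 + y / r)\<^sup>2 \<le> 1 / (1 + x / r)\<^sup>2" if "0 \<le> x" "x \<le> y" for x y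
        using that r by (intro divide_left_mono power_mono add_left_mono divide_right_mono mult_pos_pos zero_less_power)
          (auto simp: add_pos_nonneg)
    qed (use C0 suminf_shifted_square_le(1)[OF r] in auto)
    \<comment> \<open>The envelope costs a factor of order \<open>r\<close>. This extra power of
      \<open>r\<close> completes \<open>r powr ((\<beta> - 1) * Q)\<close> to
      \<open>r powr (b * Q)\<close>.\<close>
    also have "\<dots> \<le> ennreal A * ennreal (2 * (C0 * K powr ((1 - s) * Q)) * (2 * r))"
      using suminf_shifted_square_le(2)[OF r] C0 by (intro mult_left_mono ennreal_leI) auto
    also have "\<dots> = ennreal (4 * C0 * (A * K powr ((1 - s) * Q) * r))"
      using C0 r by (simp add: A_def mult_ac flip: ennreal_mult)
    also have "A * K powr ((1 - s) * Q) * r = m powr (- (Q * (1 - b * \<theta>)))"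
    proof -
      have "A = m powr (- Q) * K powr (- Q) * r powr ((\<beta> - 1) * Q)"
        unfolding A_def wK using K m r by (simp add: powr_mult powr_divide powr_powr powr_minus field_simps)
      then have "A * K powr ((1 - s) * Q) * r = m powr (- Q) * K powr (- (s * Q)) * (r powr ((\<beta> - 1) * Q) * r powr 1)"
        using K r by (simp add: mult_ac algebra_simps flip: powr_add)
      also have "r powr ((\<beta> - 1) * Q) * r powr 1 = r powr (b * Q)"
      proof -
        have "(\<beta> - 1) * Q + 1 = b * Q" using Q by (simp add: \<beta>_def field_simps)
        then show ?thesis by (simp only: powr_add[symmetric])
      qed
      also have "r powr (b * Q) = K powr (s * Q) * m powr (\<theta> * (b * Q))"
        unfolding r_def RK c[symmetric] using K m by (simp add: powr_mult powr_powr mult_ac)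
      also have "m powr (- Q) * K powr (- (s * Q)) * (K powr (s * Q) * m powr (\<theta> * (b * Q))) = m powr (- Q) * m powr (\<theta> * (b * Q))"
        using K by (simp add: powr_minus)
      also have "\<dots> = m powr (- (Q * (1 - b * \<theta>)))"
        by (simp add: algebra_simps flip: powr_add)
      finally show ?thesis .
    qed
    finally show ?thesis unfolding m_def .
  qed
  have "(\<integral>\<^sup>+\<xi>. ennreal ((norm (ft f \<xi>) * \<bar>\<xi>\<bar> powr \<beta>) powr Q) \<partial>lborel)
      \<le> (\<integral>\<^sup>+\<xi>. ennreal C1 * (\<Sum>n. ennreal (a \<beta> n \<xi> powr Q)) \<partial>lborel)"
    using AE_lborel_singleton[of "0::real"] by (intro nn_integral_mono_AE, eventually_elim) (rule pw)
  also have "\<dots> = ennreal C1 * (\<Sum>n. \<integral>\<^sup>+\<xi>. ennreal (a \<beta> n \<xi> powr Q) \<partial>lborel)"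
    by (subst nn_integral_cmult, measurable, subst nn_integral_suminf) auto
  also have "\<dots> \<le> ennreal C1 * (\<Sum>n. ennreal (4 * C0 * real (Suc n) powr (- (Q * (1 - b * \<theta>)))))"
    by (intro mult_left_mono suminf_le a_int) auto
  also have "\<dots> < \<infinity>"
  proof -
    have "summable (\<lambda>n. 4 * C0 * real (Suc n) powr (- (Q * (1 - b * \<theta>))))"
      using bQ by (intro summable_mult) (subst summable_Suc_iff, simp add: summable_real_powr_iff)
    then have "(\<Sum>n. ennreal (4 * C0 * real (Suc n) powr (- (Q * (1 - b * \<theta>))))) < \<infinity>"
      using C0 by (subst suminf_ennreal2) auto
    then show ?thesis by (simp add: ennreal_mult_less_top)
  qed
  finally show ?thesis using Q by (simp add: wfin_def \<beta>_def)
qed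

end

section \<open>Rudin--Shapiro and Fejer coefficients\<close>

context gauss_comb
begin

section \<open>Values at the integers\<close>

text \<open>A bound for what the bumps of one layer centred at other integers contribute at
  \<open>k0\<close>.\<close>

definition err :: "nat \<Rightarrow> nat \<Rightarrow> real" where
  "err n k0 = w (Suc n) * (1 / R (Suc n)) * (\<Sum>k\<in>B (Suc n). exp (- \<bar>real k0 - real k\<bar>))"

text \<open>For a nonzero integer \<open>j\<close> and \<open>r >= 1\<close> one has
  \<open>pi * r^2 * j^2 >= r + |j|\<close>. The factor \<open>1 / r\<close>, taken from
  \<open>exp (- r)\<close>, makes the error of a layer comparable to its mass.\<close>

lemma gauss_int_le:
  fixes j :: int
  assumes "j \<noteq> 0" "r \<ge> 1"
  shows "gauss (r * of_int j) \<le> 1 / r * exp (- \<bar>of_int j\<bar>)"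
proof -
  define y where "y = \<bar>real_of_int j\<bar>"
  have y: "y \<ge> 1" using assms by (simp add: y_def)
  have "1 \<le> y\<^sup>2" using y by (intro one_le_power)
  have "y * 1 \<le> y * y" using y by (intro mult_left_mono) auto
  have "r * 1 \<le> r * r" "1 * 1 \<le> r * r" using assms by (intro mult_mono; simp)+
  then have r: "r \<le> r\<^sup>2" "1 \<le> r\<^sup>2" by (auto simp: power2_eq_square)
  have "r + y \<le> r\<^sup>2 * y\<^sup>2 + r\<^sup>2 * y\<^sup>2"
  proof (rule add_mono)
    have "r * 1 \<le> r\<^sup>2 * y\<^sup>2" using assms r \<open>1 \<le> y\<^sup>2\<close> by (intro mult_mono) auto
    then show "r \<le> r\<^sup>2 * y\<^sup>2" by simp
    have "1 * y \<le> r\<^sup>2 * y\<^sup>2" using y r \<open>y * 1 \<le> y * y\<close> by (intro mult_mono) (auto simp: power2_eq_square)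
    then show "y \<le> r\<^sup>2 * y\<^sup>2" by simp
  qed
  also have "\<dots> \<le> pi * (r\<^sup>2 * y\<^sup>2)"
    using pi_gt3 mult_right_mono[of 2 pi "r\<^sup>2 * y\<^sup>2"] by simp
  finally have "r + y \<le> pi * (r * of_int j)\<^sup>2" by (simp add: y_def power_mult_distrib)
  then have "gauss (r * of_int j) \<le> exp (- r) * exp (- y)"
    by (simp add: gauss_def flip: exp_add)
  also have "exp (- r) \<le> 1 / r"
  proof -
    have "r \<le> exp r" using exp_ge_add_one_self[of r] by linarith
    then show ?thesis using assms by (simp add: exp_minus field_simps)
  qed
  finally show ?thesis by (simp add: y_def mult_right_mono)
qed

lemma err_nonneg: "err n k0 \<ge> 0"
  unfolding err_def using w_pos[of n] R_pos[of n] by (intro mult_nonneg_nonneg sum_nonneg) auto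

lemma norm_T_int_le:
  "norm (T (Suc n) (real k0) - (if k0 \<in> B (Suc n) then w (Suc n) * d (Suc n) k0 else 0)) \<le> err n k0"
proof -
  define h where "h = (\<lambda>k. d (Suc n) k * gauss (R (Suc n) * (real k0 - real k)))"
  have "(\<Sum>k\<in>B (Suc n). h k) = (if k0 \<in> B (Suc n) then d (Suc n) k0 else 0) + (\<Sum>k\<in>B (Suc n) - {k0}. h k)"
    by (cases "k0 \<in> B (Suc n)") (auto simp: sum.remove[of _ k0] h_def)
  then have "T (Suc n) (real k0) - (if k0 \<in> B (Suc n) then w (Suc n) * d (Suc n) k0 else 0) = w (Suc n) * (\<Sum>k\<in>B (Suc n) - {k0}. h k)"
    by (simp add: T_def h_def algebra_simps)
  then have "norm (T (Suc n) (real k0) - (if k0 \<in> B (Suc n) then w (Suc n) * d (Suc n) k0 else 0)) = w (Suc n) * norm (\<Sum>k\<in>B (Suc n) - {k0}. h k)"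
    using w_pos[of n] by (simp add: norm_mult)
  also have "norm (\<Sum>k\<in>B (Suc n) - {k0}. h k) \<le> (\<Sum>k\<in>B (Suc n) - {k0}. 1 / R (Suc n) * exp (- \<bar>real k0 - real k\<bar>))"
  proof (rule sum_norm_le)
    fix k assume k: "k \<in> B (Suc n) - {k0}"
    have "norm (h k) \<le> gauss (R (Suc n) * (real k0 - real k))"
      using d_le by (simp add: h_def norm_mult mult_left_le_one_le)
    also have "\<dots> \<le> 1 / R (Suc n) * exp (- \<bar>real k0 - real k\<bar>)"
      using gauss_int_le[of "int k0 - int k" "R (Suc n)"] k R_ge_1 by auto
    finally show "norm (h k) \<le> 1 / R (Suc n) * exp (- \<bar>real k0 - real k\<bar>)" .
  qed
  also have "\<dots> \<le> (\<Sum>k\<in>B (Suc n). 1 / R (Suc n) * exp (- \<bar>real k0 - real k\<bar>))"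
    using R_pos[of n] by (intro sum_mono2) auto
  finally show ?thesis
    using w_pos[of n] by (simp add: err_def sum_distrib_left mult_left_mono mult.assoc)
qed

text \<open>A crude bound at a fixed \<open>k0\<close>: the number of bumps is given away so that
  the majorant is the summable layer mass.\<close>

lemma err_le: "err n k0 \<le> exp_sum_bound * (3 * 4 ^ Suc n * w (Suc n) / R (Suc n))"
proof -
  have pos: "w (Suc n) * (1 / R (Suc n)) \<ge> 0" using w_pos[of n] R_pos[of n] by simp
  have "err n k0 \<le> w (Suc n) * (1 / R (Suc n)) * exp_sum_bound"
    unfolding err_def using pos by (intro mult_left_mono sum_exp_nat_le) auto
  also have "\<dots> \<le> w (Suc n) * (1 / R (Suc n)) * (exp_sum_bound * (3 * 4 ^ Suc n))"
  proof (intro mult_left_mono pos)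
    have "1 \<le> 3 * (4::real) ^ Suc n" using one_le_power[of "4::real" "Suc n"] by linarith
    from mult_left_mono[OF this, of exp_sum_bound] show "exp_sum_bound \<le> exp_sum_bound * (3 * 4 ^ Suc n)"
      using exp_sum_bound_pos by simp
  qed
  finally show ?thesis by (simp add: mult_ac)
qed

lemma summable_err: "summable (\<lambda>n. err n k0)"
  by (rule summable_comparison_test'[OF summable_mult[OF summable_card_w_R, of exp_sum_bound], of 0])
    (use err_le err_nonneg in auto)

text \<open>By disjointness of the blocks exactly one layer has its range of centres around
  \<open>k0\<close>; its bump at \<open>k0\<close> is the main term and everything else is
  error.\<close>

lemma norm_f_int_ge:
  assumes "k0 \<in> B (Suc m)"
  shows "norm (f (real k0)) \<ge> w (Suc m) * norm (d (Suc m) k0) - (\<Sum>n. err n k0)"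
proof -
  define g where "g = (\<lambda>n. if k0 \<in> B (Suc n) then w (Suc n) * d (Suc n) k0 else 0)"
  have "g = (\<lambda>n. if n = m then w (Suc m) * d (Suc m) k0 else 0)"
  proof
    fix n
    have "k0 \<in> B (Suc n) \<longleftrightarrow> n = m" using assms B_disjoint[OF assms, of "Suc n"] by blast
    then show "g n = (if n = m then w (Suc m) * d (Suc m) k0 else 0)" by (simp add: g_def)
  qed
  then have "g sums (w (Suc m) * d (Suc m) k0)"
    using sums_single[of m "\<lambda>n. of_real (w (Suc m)) * d (Suc m) k0"] by simp
  with T_sums[of "real k0"] have s: "(\<lambda>n. T (Suc n) (real k0) - g n) sums (f (real k0) - w (Suc m) * d (Suc m) k0)"
    by (rule sums_diff)
  have le: "norm (T (Suc n) (real k0) - g n) \<le> err n k0" for n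
    unfolding g_def by (rule norm_T_int_le)
  have sn: "summable (\<lambda>n. norm (T (Suc n) (real k0) - g n))"
    using le by (intro summable_comparison_test'[OF summable_err[of k0], of 0]) simp
  have "norm (f (real k0) - w (Suc m) * d (Suc m) k0) \<le> (\<Sum>n. norm (T (Suc n) (real k0) - g n))"
    using summable_norm[OF sn] sums_unique[OF s] by simp
  also have "\<dots> \<le> (\<Sum>n. err n k0)"
    using sn summable_err le by (intro suminf_le) auto
  finally have "norm (w (Suc m) * d (Suc m) k0) - norm (f (real k0)) \<le> (\<Sum>n. err n k0)"
    using norm_triangle_ineq2[of "w (Suc m) * d (Suc m) k0" "f (real k0)"]
    by (simp add: norm_minus_commute)
  then show ?thesis using w_pos[of m] by (simp add: norm_mult)
qed

text \<open>Summed over \<open>k0\<close> first, each bump is counted with total weight at most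
  \<open>exp_sum_bound\<close>. All errors together thus stay below a multiple of the sum of the
  layer masses, uniformly in \<open>S\<close>.\<close>

lemma sum_err_le:
  assumes "finite S"
  shows "(\<Sum>k0\<in>S. \<Sum>n. err n k0) \<le> exp_sum_bound * (\<Sum>n. 3 * 4 ^ Suc n * w (Suc n) / R (Suc n))"
proof -
  have "(\<Sum>k0\<in>S. \<Sum>n. err n k0) = (\<Sum>n. \<Sum>k0\<in>S. err n k0)"
    by (rule suminf_sum[symmetric]) (rule summable_err)
  also have "\<dots> \<le> (\<Sum>n. exp_sum_bound * (3 * 4 ^ Suc n * w (Suc n) / R (Suc n)))"
  proof (rule suminf_le)
    fix n
    have "(\<Sum>k0\<in>S. err n k0) = w (Suc n) * (1 / R (Suc n)) * (\<Sum>k\<in>B (Suc n). \<Sum>k0\<in>S. exp (- \<bar>real k - real k0\<bar>))"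
      unfolding err_def sum_distrib_left[symmetric] by (subst sum.swap) (simp add: abs_minus_commute)
    also have "\<dots> \<le> w (Suc n) * (1 / R (Suc n)) * (\<Sum>k\<in>B (Suc n). exp_sum_bound)"
      using w_pos[of n] R_pos[of n] by (intro mult_left_mono sum_mono sum_exp_nat_le assms) auto
    also have "\<dots> = exp_sum_bound * (3 * 4 ^ Suc n * w (Suc n) / R (Suc n))"
      by (simp only: sum_constant card_B) simp
    finally show "(\<Sum>k0\<in>S. err n k0) \<le> exp_sum_bound * (3 * 4 ^ Suc n * w (Suc n) / R (Suc n))" .
  qed (intro summable_sum summable_err summable_mult summable_card_w_R)+
  also have "\<dots> = exp_sum_bound * (\<Sum>n. 3 * 4 ^ Suc n * w (Suc n) / R (Suc n))"
    by (rule suminf_mult[OF summable_card_w_R])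
  finally show ?thesis .
qed

text \<open>The heights of layer \<open>n\<close> at its centres add up to at least
  \<open>w n * kappa * 4^n = kappa / n\<close>. The errors are bounded in total, so the harmonic
  series prevails.\<close>

lemma P_N_f_at_top:
  assumes \<kappa>: "\<kappa> > 0" and d: "\<And>n. (\<Sum>k\<in>B n. norm (d n k)) \<ge> \<kappa> * 4 ^ n"
  shows "filterlim (\<lambda>N. P_N N (\<lambda>x. norm (f x))) at_top sequentially"
  unfolding filterlim_at_top
proof
  fix Z :: real
  define E where "E = exp_sum_bound * (\<Sum>n. 3 * 4 ^ Suc n * w (Suc n) / R (Suc n))"
  have "\<forall>\<^sub>F M in sequentially. (Z + E) / \<kappa> \<le> harm M"
    using harm_at_top by (simp add: filterlim_at_top)
  then obtain M where M: "(Z + E) / \<kappa> \<le> harm M" by (auto simp: eventually_sequentially)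
  have "Z + E \<le> \<kappa> * harm M" using M \<kappa> by (simp add: field_simps)
  also have "\<dots> = (\<Sum>n<M. \<kappa> / real (Suc n))"
  proof -
    have "harm M = (\<Sum>n<M. inverse (real (Suc n)))"
      unfolding harm_def by (rule sum.reindex_bij_witness[of _ Suc "\<lambda>n. n - 1"]) auto
    then show ?thesis by (simp add: sum_distrib_left divide_inverse)
  qed
  also have "\<dots> \<le> (\<Sum>n<M. \<Sum>k\<in>B (Suc n). norm (f (real k)) + (\<Sum>i. err i k))"
  proof (rule sum_mono)
    fix n
    have "\<kappa> / real (Suc n) = w (Suc n) * (\<kappa> * 4 ^ Suc n)" by (simp add: w_def)
    also have "\<dots> \<le> w (Suc n) * (\<Sum>k\<in>B (Suc n). norm (d (Suc n) k))"
      using w_pos[of n] by (intro mult_left_mono d) auto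
    also have "\<dots> \<le> (\<Sum>k\<in>B (Suc n). norm (f (real k)) + (\<Sum>i. err i k))"
      unfolding sum_distrib_left using norm_f_int_ge[of _ n] by (intro sum_mono) (simp add: algebra_simps)
    finally show "\<kappa> / real (Suc n) \<le> (\<Sum>k\<in>B (Suc n). norm (f (real k)) + (\<Sum>i. err i k))" .
  qed
  also have "\<dots> = (\<Sum>k\<in>{4..<4 ^ Suc M}. norm (f (real k))) + (\<Sum>k\<in>{4..<4 ^ Suc M}. \<Sum>i. err i k)"
    unfolding sum_B by (rule sum.distrib)
  also have "\<dots> \<le> (\<Sum>k\<in>{4..<4 ^ Suc M}. norm (f (real k))) + E"
    unfolding E_def by (intro add_left_mono sum_err_le) auto
  finally have Z: "Z \<le> (\<Sum>k\<in>{4..<4 ^ Suc M}. norm (f (real k)))" by simp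
  have "Z \<le> P_N N (\<lambda>x. norm (f x))" if "N \<ge> 4 ^ Suc M" for N
  proof -
    note Z
    also have "(\<Sum>k\<in>{4..<4 ^ Suc M}. norm (f (real k))) = (\<Sum>k\<in>int ` {4..<4 ^ Suc M}. norm (f (of_int k)))"
      by (subst sum.reindex) auto
    also have "\<dots> \<le> P_N N (\<lambda>x. norm (f x))"
      unfolding P_N_def using that by (intro sum_mono2) auto
    finally show ?thesis .
  qed
  then show "\<forall>\<^sub>F N in sequentially. Z \<le> P_N N (\<lambda>x. norm (f x))"
    unfolding eventually_sequentially by blast
qed

end

text \<open>Rudin--Shapiro coefficients: the pair \<open>P, Q\<close> satisfies
  \<open>P\<^sub>n\<^sub>+\<^sub>1 = P\<^sub>n + z\<^bsup>2^n\<^esup> Q\<^sub>n\<close> and \<open>Q\<^sub>n\<^sub>+\<^sub>1 = P\<^sub>n - z\<^bsup>2^n\<^esup> Q\<^sub>n\<close>,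
  so the parallelogram law gives \<open>|P\<^sub>n|\<^sup>2 + |Q\<^sub>n|\<^sup>2 = 2\<^bsup>n+1\<^esup>\<close> on the unit circle.\<close>

fun rudin_shapiro :: "nat \<Rightarrow> bool \<Rightarrow> nat \<Rightarrow> complex" where
  "rudin_shapiro 0 s k = 1"
| "rudin_shapiro (Suc n) s k =
    (if k < 2 ^ n then rudin_shapiro n True k
     else (if s then 1 else - 1) * rudin_shapiro n False (k - 2 ^ n))"

lemma norm_rudin_shapiro: "norm (rudin_shapiro n s k) = 1"
  by (induction n arbitrary: s k) (auto simp: norm_mult)

lemma rudin_shapiro_sum_Suc:
  "(\<Sum>k<2 ^ Suc n. rudin_shapiro (Suc n) s k * z ^ k) =
   (\<Sum>k<2 ^ n. rudin_shapiro n True k * z ^ k) +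
   (if s then 1 else - 1) * z ^ 2 ^ n * (\<Sum>k<2 ^ n. rudin_shapiro n False k * z ^ k)"
proof -
  have "(\<Sum>k<2 ^ Suc n. rudin_shapiro (Suc n) s k * z ^ k) =
    (\<Sum>k\<in>{0..<2 ^ n}. rudin_shapiro (Suc n) s k * z ^ k) + (\<Sum>k\<in>{2 ^ n..<2 ^ Suc n}. rudin_shapiro (Suc n) s k * z ^ k)"
    unfolding lessThan_atLeast0 by (rule sum.atLeastLessThan_concat[symmetric]) auto
  also have "(\<Sum>k\<in>{0..<2 ^ n}. rudin_shapiro (Suc n) s k * z ^ k) = (\<Sum>k<2 ^ n. rudin_shapiro n True k * z ^ k)"
    unfolding lessThan_atLeast0 by (intro sum.cong) auto
  also have "(\<Sum>k\<in>{2 ^ n..<2 ^ Suc n}. rudin_shapiro (Suc n) s k * z ^ k)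
      = (\<Sum>k<2 ^ n. rudin_shapiro (Suc n) s (k + 2 ^ n) * z ^ (k + 2 ^ n))"
    by (rule sum.reindex_bij_witness[of _ "\<lambda>k. k + 2 ^ n" "\<lambda>k. k - 2 ^ n"]) auto
  also have "\<dots> = (if s then 1 else - 1) * z ^ 2 ^ n * (\<Sum>k<2 ^ n. rudin_shapiro n False k * z ^ k)"
    by (simp add: sum_distrib_left power_add mult_ac)
  finally show ?thesis .
qed

lemma rudin_shapiro_parallelogram:
  assumes "norm z = 1"
  shows "(norm (\<Sum>k<2 ^ n. rudin_shapiro n True k * z ^ k))\<^sup>2 + (norm (\<Sum>k<2 ^ n. rudin_shapiro n False k * z ^ k))\<^sup>2 = 2 ^ Suc n"
proof (induction n)
  case (Suc n)
  define P where "P = (\<Sum>k<2 ^ n. rudin_shapiro n True k * z ^ k)"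
  define Q where "Q = z ^ 2 ^ n * (\<Sum>k<2 ^ n. rudin_shapiro n False k * z ^ k)"
  have "(norm (P + Q))\<^sup>2 + (norm (P - Q))\<^sup>2 = 2 * ((norm P)\<^sup>2 + (norm Q)\<^sup>2)"
    unfolding cmod_power2 by (simp add: power2_eq_square algebra_simps)
  moreover have "norm Q = norm (\<Sum>k<2 ^ n. rudin_shapiro n False k * z ^ k)"
    using assms by (simp add: Q_def norm_mult norm_power)
  ultimately have "(norm (P + Q))\<^sup>2 + (norm (P - Q))\<^sup>2 = 2 * 2 ^ Suc n"
    using Suc.IH by (simp add: P_def)
  then show ?case
    unfolding rudin_shapiro_sum_Suc by (simp add: P_def Q_def)
qed simp

lemma norm_rudin_shapiro_sum_le:
  assumes "norm z = 1"
  shows "norm (\<Sum>k<2 ^ n. rudin_shapiro n True k * z ^ k) \<le> sqrt (2 ^ Suc n)"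
  using rudin_shapiro_parallelogram[OF assms, of n] by (intro real_le_rsqrt) (smt (verit) zero_le_power2)

text \<open>The \<open>4 ^ n = 2 ^ (2 * n)\<close> signs of level \<open>2 * n\<close> fill the
  first third of the block, which starts at \<open>4 ^ n\<close> and has \<open>3 * 4 ^ n\<close>
  elements.\<close>

definition rs_coeff :: "nat \<Rightarrow> nat \<Rightarrow> complex" where
  "rs_coeff n k = (if k \<in> {4 ^ n..<2 * 4 ^ n} then rudin_shapiro (2 * n) True (k - 4 ^ n) else 0)"

lemma norm_rs_coeff_le: "norm (rs_coeff n k) \<le> 1"
  by (simp add: rs_coeff_def norm_rudin_shapiro)

lemma sum_rs_coeff:
  "(\<Sum>k\<in>{4 ^ n..<4 ^ Suc n}. norm (rs_coeff n k)) = 4 ^ n"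
proof -
  have "(\<Sum>k\<in>{4 ^ n..<4 ^ Suc n}. norm (rs_coeff n k)) = (\<Sum>k\<in>{4 ^ n..<2 * 4 ^ n}. norm (rs_coeff n k))"
    by (intro sum.mono_neutral_right) (auto simp: rs_coeff_def)
  also have "\<dots> = (\<Sum>k\<in>{4 ^ n..<2 * 4 ^ n :: nat}. 1)"
    by (intro sum.cong) (auto simp: rs_coeff_def norm_rudin_shapiro)
  finally show ?thesis by simp
qed

lemma norm_rs_trig_le:
  "norm (\<Sum>k\<in>{4 ^ n..<4 ^ Suc n}. rs_coeff n k * ee (- (real k * \<xi>))) \<le> sqrt 2 * (4 ^ n) powr (1 / 2)"
proof -
  define z where "z = ee (- \<xi>)"
  have z: "norm z = 1" by (simp add: z_def)
  have ez: "ee (- (real k * \<xi>)) = z ^ k" for k by (simp add: z_def ee_power)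
  have "(\<Sum>k\<in>{4 ^ n..<4 ^ Suc n}. rs_coeff n k * ee (- (real k * \<xi>))) = (\<Sum>k\<in>{4 ^ n..<2 * 4 ^ n}. rs_coeff n k * z ^ k)"
    unfolding ez by (intro sum.mono_neutral_right) (auto simp: rs_coeff_def)
  also have "\<dots> = (\<Sum>k<2 ^ (2 * n). rs_coeff n (k + 4 ^ n) * z ^ (k + 4 ^ n))"
    by (rule sum.reindex_bij_witness[of _ "\<lambda>k. k + 4 ^ n" "\<lambda>k. k - 4 ^ n"]) (auto simp: power_mult)
  also have "\<dots> = z ^ 4 ^ n * (\<Sum>k<2 ^ (2 * n). rudin_shapiro (2 * n) True k * z ^ k)"
    unfolding sum_distrib_left by (intro sum.cong refl) (auto simp: rs_coeff_def power_add power_mult)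
  finally have "norm (\<Sum>k\<in>{4 ^ n..<4 ^ Suc n}. rs_coeff n k * ee (- (real k * \<xi>)))
      = norm (\<Sum>k<2 ^ (2 * n). rudin_shapiro (2 * n) True k * z ^ k)"
    by (simp add: norm_mult norm_power z)
  also have "\<dots> \<le> sqrt (2 ^ Suc (2 * n))" by (rule norm_rudin_shapiro_sum_le[OF z])
  also have "\<dots> = sqrt 2 * (4 ^ n) powr (1 / 2)"
    by (simp add: power_mult real_sqrt_mult powr_half_sqrt)
  finally show ?thesis .
qed

text \<open>The coefficients of \<open>S\<^sup>2 / 4\<^sup>n\<close>, where \<open>S\<close> is a Dirichlet sum with \<open>4\<^sup>n\<close> terms, shifted by \<open>4\<^sup>n\<close>.\<close>

abbreviation fejer_count :: "nat \<Rightarrow> nat \<Rightarrow> nat" where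
  "fejer_count n k \<equiv> card {(i, j). i < 4 ^ n \<and> j < 4 ^ n \<and> 4 ^ n + i + j = k}"

definition fejer_coeff :: "nat \<Rightarrow> nat \<Rightarrow> complex" where
  "fejer_coeff n k = of_nat (fejer_count n k) / 4 ^ n"

lemma fejer_coeff_alt:
  "fejer_coeff n k = of_real (real (fejer_count n k) / 4 ^ n)"
  by (simp add: fejer_coeff_def)

lemma norm_fejer_coeff:
  "norm (fejer_coeff n k) = real (fejer_count n k) / 4 ^ n"
  unfolding fejer_coeff_alt norm_of_real by simp

lemma norm_fejer_coeff_le: "norm (fejer_coeff n k) \<le> 1"
proof -
  have "{(i, j). i < 4 ^ n \<and> j < 4 ^ n \<and> 4 ^ n + i + j = k} \<subseteq> (\<lambda>i. (i, k - 4 ^ n - i)) ` {..<4 ^ n}" by auto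
  from surj_card_le[OF _ this] have "fejer_count n k \<le> 4 ^ n" by simp
  then have "real (fejer_count n k) \<le> real (4 ^ n)"
    by (rule of_nat_mono)
  then show ?thesis unfolding norm_fejer_coeff by (simp add: divide_le_eq)
qed

lemma sum_fejer:
  fixes h :: "nat \<Rightarrow> 'a :: comm_semiring_1"
  shows "(\<Sum>k\<in>{4 ^ n..<4 ^ Suc n}. of_nat (fejer_count n k) * h k)
       = (\<Sum>i<4 ^ n. \<Sum>j<4 ^ n. h (4 ^ n + i + j))"
proof -
  define X where "X = {..<4 ^ n :: nat} \<times> {..<4 ^ n :: nat}"
  have eq: "{(i, j). i < 4 ^ n \<and> j < 4 ^ n \<and> 4 ^ n + i + j = k} = {x \<in> X. 4 ^ n + fst x + snd x = k}" for k :: nat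
    by (auto simp: X_def)
  have "(\<Sum>i<4 ^ n. \<Sum>j<4 ^ n. h (4 ^ n + i + j)) = (\<Sum>x\<in>X. h (4 ^ n + fst x + snd x))"
    unfolding X_def by (simp add: sum.cartesian_product split_def)
  \<comment> \<open>The pairs are grouped by \<open>4 ^ n + i + j\<close>, which is below
    \<open>3 * 4 ^ n\<close> and so stays inside the block.\<close>
  also have "\<dots> = (\<Sum>k\<in>{4 ^ n..<4 ^ Suc n}. \<Sum>x\<in>{x \<in> X. 4 ^ n + fst x + snd x = k}. h (4 ^ n + fst x + snd x))"
    by (rule sum.group[symmetric]) (auto simp: X_def)
  also have "\<dots> = (\<Sum>k\<in>{4 ^ n..<4 ^ Suc n}. of_nat (card {x \<in> X. 4 ^ n + fst x + snd x = k}) * h k)"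
    by (intro sum.cong refl) simp
  finally show ?thesis unfolding eq ..
qed

lemma sum_fejer_coeff: "(\<Sum>k\<in>{4 ^ n..<4 ^ Suc n}. norm (fejer_coeff n k)) = 4 ^ n"
proof -
  have "(\<Sum>k\<in>{4 ^ n..<4 ^ Suc n}. norm (fejer_coeff n k))
    = (\<Sum>k\<in>{4 ^ n..<4 ^ Suc n :: nat}. real (fejer_count n k) * 1) / 4 ^ n"
    unfolding norm_fejer_coeff by (simp add: sum_divide_distrib)
  also have "\<dots> = 4 ^ n" unfolding sum_fejer by simp
  finally show ?thesis .
qed

text \<open>The coefficients count pairs, so the sum is the square of a Dirichlet sum up to a
  unimodular shift and the factor \<open>4 ^ n\<close>. Conjugation and integer indices bring the
  Dirichlet sum into the form of the Parseval lemma.\<close>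

lemma fejer_trig:
  "norm (\<Sum>k\<in>{4 ^ n..<4 ^ Suc n}. fejer_coeff n k * ee (- (real k * \<xi>)))
   = (norm (\<Sum>k\<in>{0..<4 ^ n}. 1 * ee (of_int k * \<xi>)))\<^sup>2 / 4 ^ n"
proof -
  define z where "z = ee (- \<xi>)"
  have z: "norm z = 1" by (simp add: z_def)
  have ez: "ee (- (real k * \<xi>)) = z ^ k" for k by (simp add: z_def ee_power)
  define S where "S = (\<Sum>i<4 ^ n. z ^ i)"
  have "(\<Sum>k\<in>{4 ^ n..<4 ^ Suc n}. fejer_coeff n k * ee (- (real k * \<xi>)))
     = (\<Sum>k\<in>{4 ^ n..<4 ^ Suc n}. of_nat (fejer_count n k) * z ^ k) / 4 ^ n"
    unfolding fejer_coeff_def ez by (simp add: sum_divide_distrib)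
  also have "\<dots> = z ^ 4 ^ n * S * S / 4 ^ n"
    unfolding sum_fejer S_def by (simp add: sum_product power_add sum_distrib_left mult_ac)
  finally have "norm (\<Sum>k\<in>{4 ^ n..<4 ^ Suc n}. fejer_coeff n k * ee (- (real k * \<xi>))) = (norm S)\<^sup>2 / 4 ^ n"
    by (simp add: norm_mult norm_divide norm_power z power2_eq_square)
  also have "norm S = norm (cnj S)" by simp
  also have "cnj S = (\<Sum>k\<in>{0..<4 ^ n}. 1 * ee (of_int k * \<xi>))"
  proof -
    have "cnj S = (\<Sum>i<4 ^ n. ee (real i * \<xi>))"
      by (simp add: S_def z_def cnj_ee ee_power)
    also have "\<dots> = (\<Sum>k\<in>{0..<4 ^ n}. 1 * ee (of_int k * \<xi>))"
      by (rule sum.reindex_bij_witness[of _ nat int]) auto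
    finally show ?thesis .
  qed
  finally show ?thesis .
qed

text \<open>The modulus is the Fejer kernel \<open>|S|^2 / K\<close> with \<open>K = 4 ^ n\<close>:
  at most \<open>K\<close>, and of integral 1 over a period. Of its \<open>Q\<close>-th power,
  \<open>Q - 1\<close> factors are bounded by the sup and one is integrated.\<close>

lemma nn_integral_fejer_le:
  assumes Q: "Q \<ge> 1"
  shows "(\<integral>\<^sup>+x. ennreal (norm (\<Sum>k\<in>{4 ^ n..<4 ^ Suc n}. fejer_coeff n k * ee (- (real k * x))) powr Q) * indicator {of_int l..of_int l + 1} x \<partial>lborel)
    \<le> ennreal ((4 ^ n) powr (Q - 1))"
proof -
  define K where "K = (4::real) ^ n"
  have K: "K > 0" by (simp add: K_def)
  define S where "S = (\<lambda>x. \<Sum>k\<in>{0..<4 ^ n}. 1 * ee (of_int k * x))"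
  have S_le: "norm (S x) \<le> K" for x
  proof -
    have "norm (S x) \<le> of_nat (card {0..<4 ^ n :: int}) * 1"
      unfolding S_def by (intro order_trans[OF norm_sum] sum_bounded_above) (simp add: norm_mult)
    then show ?thesis by (simp add: K_def nat_power_eq)
  qed
  have "(\<integral>\<^sup>+x. ennreal (norm (\<Sum>k\<in>{4 ^ n..<4 ^ Suc n}. fejer_coeff n k * ee (- (real k * x))) powr Q) * indicator {of_int l..of_int l + 1} x \<partial>lborel)
     \<le> (\<integral>\<^sup>+x. ennreal (K powr (Q - 1) / K) * (ennreal ((norm (S x))\<^sup>2) * indicator {of_int l..of_int l + 1} x) \<partial>lborel)"
  proof (rule nn_integral_mono)
    fix x
    define y where "y = (norm (S x))\<^sup>2 / K"
    have "(norm (S x))\<^sup>2 \<le> K\<^sup>2" using S_le by (intro power_mono) auto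
    then have y: "0 \<le> y" "y \<le> K" using K by (auto simp: y_def power2_eq_square field_simps)
    have "y powr Q = y powr (Q - 1) * y" using y by (cases "y = 0") (auto simp: powr_diff)
    also have "\<dots> \<le> K powr (Q - 1) * y" using y Q by (intro mult_right_mono powr_mono2) auto
    finally have "ennreal (y powr Q) \<le> ennreal (K powr (Q - 1) / K) * ennreal ((norm (S x))\<^sup>2)"
      using K by (simp add: y_def ennreal_leI flip: ennreal_mult)
    then show "ennreal (norm (\<Sum>k\<in>{4 ^ n..<4 ^ Suc n}. fejer_coeff n k * ee (- (real k * x))) powr Q) * indicator {of_int l..of_int l + 1} x
        \<le> ennreal (K powr (Q - 1) / K) * (ennreal ((norm (S x))\<^sup>2) * indicator {of_int l..of_int l + 1} x)"
      unfolding fejer_trig y_def S_def K_def by (auto simp: indicator_def)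
  qed
  also have "\<dots> = ennreal (K powr (Q - 1) / K) * (\<integral>\<^sup>+x. ennreal ((norm (S x))\<^sup>2) * indicator {of_int l..of_int l + 1} x \<partial>lborel)"
    unfolding S_def by (rule nn_integral_cmult) measurable
  also have "(\<integral>\<^sup>+x. ennreal ((norm (S x))\<^sup>2) * indicator {of_int l..of_int l + 1} x \<partial>lborel) = ennreal K"
    unfolding S_def by (subst nn_integral_norm_square_trig_sum) (auto simp: K_def nat_power_eq)
  also have "ennreal (K powr (Q - 1) / K) * ennreal K = ennreal (K powr (Q - 1))"
    using K by (simp flip: ennreal_mult)
  finally show ?thesis by (simp add: K_def)
qed

section \<open>The threshold\<close>

text \<open>If \<open>r < 1\<close>, a slightly negative \<open>theta\<close> is allowed, and this
  suits every \<open>t\<close>. If \<open>r = 1\<close>, \<open>theta\<close> has to be positive,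
  and \<open>t < 1\<close> leaves room for \<open>b * theta = (1 - t) / 2\<close>.\<close>

lemma exists_log_exponent:
  fixes r t b c :: real
  assumes r: "0 < r" "r \<le> 1" and t: "0 \<le> t" "t \<le> 1" and ne: "r \<noteq> 1 \<or> t \<noteq> 1" and b: "b > 0" and c: "c > 0"
  shows "\<exists>\<theta> \<ge> - c. 1 / r + \<theta> > 1 \<and> b * \<theta> \<le> 1 \<and> (t > 0 \<longrightarrow> 1 / t * (1 - b * \<theta>) > 1)"
proof (cases "r = 1")
  case False
  \<comment> \<open>Small enough for both \<open>- m >= - c\<close> and
    \<open>1 / r - m > 1\<close>.\<close>
  define m where "m = min c ((1 / r - 1) / 2)"
  have r1: "1 / r > 1" using r False by simp
  have m: "m > 0" "m \<le> c" using r1 c by (auto simp: m_def)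
  have m2: "m \<le> (1 / r - 1) / 2" unfolding m_def by (rule min.cobounded2)
  have bm: "b * m > 0" using b m by simp
  show ?thesis
  proof (intro exI[of _ "- m"] conjI impI)
    assume "t > 0"
    then have "t * 1 < 1 + b * m" using bm t by linarith
    then show "1 / t * (1 - b * - m) > 1" using \<open>t > 0\<close> by (simp add: field_simps)
  qed (use m m2 bm r1 in auto)
next
  case True
  then have t1: "t < 1" using ne t by simp
  define \<theta> where "\<theta> = (1 - t) / (2 * b)"
  have th: "\<theta> > 0" using t1 b by (simp add: \<theta>_def)
  have bth: "b * \<theta> = (1 - t) / 2" using b by (simp add: \<theta>_def)
  show ?thesis
  proof (intro exI[of _ \<theta>] conjI impI)
    assume "t > 0"
    then show "1 / t * (1 - b * \<theta>) > 1" unfolding bth using t1 by (simp add: field_simps)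
  qed (use th c True t in \<open>auto simp: bth\<close>)
qed

theorem divergent_of_wfin:
  assumes r: "0 < r" "r \<le> 1" and t: "0 \<le> t" "t \<le> 1" and ne: "r \<noteq> 1 \<or> t \<noteq> 1"
    and a: "\<alpha> - (1 - r) > 0" and b: "\<beta> - (1 - t) > 0"
    and ab: "(\<alpha> - (1 - r)) * (\<beta> - (1 - t)) \<le> r * max t (1 / 2)"
  shows "\<exists>f. integrable lborel f \<and> continuous_on UNIV f \<and> wfin r \<alpha> f \<and> wfin t \<beta> (ft f) \<and>
    filterlim (\<lambda>N. P_N N (\<lambda>x. norm (f x))) at_top sequentially"
proof -
  define b0 where "b0 = \<beta> - (1 - t)"
  define s where "s = max t (1 / 2)"
  define c where "c = s / b0"
  have b0: "b0 > 0" using b by (simp add: b0_def)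
  have s: "s > 0" by (simp add: s_def)
  have c: "c > 0" using b0 s by (simp add: c_def)
  have cb: "c * b0 = s" using b0 by (simp add: c_def)
  obtain \<theta> where \<theta>: "\<theta> \<ge> - c" "1 / r + \<theta> > 1" "b0 * \<theta> \<le> 1" "t > 0 \<Longrightarrow> 1 / t * (1 - b0 * \<theta>) > 1"
    using exists_log_exponent[OF r t ne b0 c] by blast
  \<comment> \<open>With \<open>K = 4 ^ n\<close>, the \<open>1 / t\<close>-norm over a period is at
    most of order \<open>K powr (1 - t)\<close> for the Fejer sum and \<open>K powr (1 / 2)\<close>
    for the Rudin--Shapiro sum. The two cross at \<open>t = 1 / 2\<close>, and either way the
    exponent is \<open>1 - s\<close>.\<close>
  define d where "d = (if t < 1 / 2 then rs_coeff else fejer_coeff)"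
  interpret gauss_comb c \<theta> d
    using c \<theta> norm_rs_coeff_le norm_fejer_coeff_le by unfold_locales (auto simp: d_def)
  have sp: "wfin r \<alpha> f"
  proof -
    have "1 / r * \<alpha> \<le> c + 1 / r - 1"
    proof -
      \<comment> \<open>The threshold inequality divided by \<open>r * b0\<close>; it is the
        condition on the powers of \<open>4 ^ n\<close> in the spatial norm.\<close>
      have "(\<alpha> - (1 - r)) / r \<le> c"
        using ab r b0 unfolding b0_def[symmetric] s_def[symmetric] c_def by (simp add: field_simps)
      then show ?thesis using r by (simp add: field_simps)
    qed
    then have "wfin (1 / (1 / r)) \<alpha> f"
      using r a \<theta> by (intro spatial_norm_finite) auto
    then show ?thesis by simp
  qed
  have D_rs: "norm (D n \<xi>) \<le> sqrt 2 * (4 ^ n) powr (1 / 2)" if "t < 1 / 2" for n \<xi>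
    unfolding D_def B_def using norm_rs_trig_le[of n \<xi>] that by (simp add: d_def)
  have fr: "wfin t \<beta> (ft f)"
  proof (cases "t = 0")
    case True
    have "wfin 0 (b0 + 1) (ft f)"
      using True D_rs \<theta> b0 cb by (intro frequency_norm_finite_infinity) (auto simp: s_def)
    then show ?thesis using True by (simp add: b0_def)
  next
    case False
    define Q where "Q = 1 / t"
    have t0: "t > 0" using False t by simp
    have Q: "Q \<ge> 1" using t t0 by (simp add: Q_def)
    define C0 where "C0 = (if t < 1 / 2 then sqrt 2 powr Q else 1)"
    have "wfin (1 / Q) (b0 + 1 - 1 / Q) (ft f)"
    proof (rule frequency_norm_finite[OF Q b0 cb])
      show "Q * (1 - b0 * \<theta>) > 1" using \<theta>(4)[OF t0] by (simp add: Q_def)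
      show "C0 \<ge> 0" by (simp add: C0_def)
      show "(\<integral>\<^sup>+x. ennreal (norm (D n x) powr Q) * indicator {of_int l..of_int l + 1} x \<partial>lborel)
          \<le> ennreal (C0 * (4 ^ n) powr ((1 - s) * Q))" for n l
      proof (cases "t < 1 / 2")
        case True
        have "norm (D n x) powr Q \<le> C0 * (4 ^ n) powr ((1 - s) * Q)" for x
        proof -
          have "norm (D n x) powr Q \<le> (sqrt 2 * (4 ^ n) powr (1 / 2)) powr Q"
            using D_rs[OF True] Q by (intro powr_mono2) auto
          also have "\<dots> = C0 * (4 ^ n) powr ((1 - s) * Q)"
            using True by (simp add: C0_def s_def powr_mult powr_powr max_def)
          finally show ?thesis .
        qed
        then have "(\<integral>\<^sup>+x. ennreal (norm (D n x) powr Q) * indicator {of_int l..of_int l + 1} x \<partial>lborel)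
            \<le> (\<integral>\<^sup>+x. ennreal (C0 * (4 ^ n) powr ((1 - s) * Q)) * indicator {real_of_int l..of_int l + 1} x \<partial>lborel)"
          by (intro nn_integral_mono mult_right_mono ennreal_leI) auto
        also have "\<dots> = ennreal (C0 * (4 ^ n) powr ((1 - s) * Q))"
          by (subst nn_integral_cmult) auto
        finally show ?thesis .
      next
        case False
        have "(1 - s) * Q = Q - 1" using False t0 by (simp add: s_def Q_def field_simps)
        then show ?thesis
          unfolding D_def B_def C0_def using nn_integral_fejer_le[OF Q, of n l] False by (simp add: d_def)
      qed
    qed
    then show ?thesis by (simp add: Q_def b0_def)
  qed
  have "filterlim (\<lambda>N. P_N N (\<lambda>x. norm (f x))) at_top sequentially"
  proof (rule P_N_f_at_top)
    show "(\<Sum>k\<in>B n. norm (d n k)) \<ge> 1 * 4 ^ n" for n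
      unfolding B_def using sum_rs_coeff[of n] sum_fejer_coeff[of n] by (simp add: d_def)
  qed simp
  then show ?thesis using integrable_f continuous_f sp fr by blast
qed

section \<open>Passage to extended exponents and Lebesgue measurable functions\<close>

lemma enn2real_inverse_bounds:
  fixes p :: ennreal
  assumes "1 \<le> p"
  shows "0 \<le> enn2real (1 / p)" "enn2real (1 / p) \<le> 1" "enn2real (1 / p) = 0 \<longleftrightarrow> p = \<infinity>"
    "enn2real (1 / p) = 1 \<longleftrightarrow> p = 1" "p \<noteq> \<infinity> \<Longrightarrow> enn2real (1 / p) = 1 / enn2real p"
proof -
  have "0 \<le> enn2real (1 / p) \<and> enn2real (1 / p) \<le> 1 \<and> (enn2real (1 / p) = 0 \<longleftrightarrow> p = \<infinity>) \<and>
    (enn2real (1 / p) = 1 \<longleftrightarrow> p = 1) \<and> (p \<noteq> \<infinity> \<longrightarrow> enn2real (1 / p) = 1 / enn2real p)"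
  proof (cases p)
    case (real P)
    then have P: "P \<ge> 1" using assms by (metis ennreal_1 ennreal_le_iff)
    have "1 / p = ennreal (1 / P)" using real P by (simp add: divide_ennreal flip: ennreal_1)
    then have r: "enn2real (1 / p) = 1 / P" using P by simp
    have "p = 1 \<longleftrightarrow> P = 1" using real P by (metis ennreal_1 ennreal_inj zero_le_one)
    then show ?thesis using r P real by auto
  qed (auto simp: ennreal_divide_top)
  then show "0 \<le> enn2real (1 / p)" "enn2real (1 / p) \<le> 1" "enn2real (1 / p) = 0 \<longleftrightarrow> p = \<infinity>"
    "enn2real (1 / p) = 1 \<longleftrightarrow> p = 1" "p \<noteq> \<infinity> \<Longrightarrow> enn2real (1 / p) = 1 / enn2real p"
    by auto
qed

text \<open>The bounds \<open>1 <= p\<close> and \<open>1 <= q\<close> exclude the product of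
  infinity and 0.\<close>

lemma enn2real_inverse_mult:
  fixes p q :: ennreal
  assumes "1 \<le> p" "1 \<le> q"
  shows "enn2real (1 / (p * q)) = enn2real (1 / p) * enn2real (1 / q)"
proof (cases "p = \<infinity> \<or> q = \<infinity>")
  case True
  have "p \<noteq> 0" "q \<noteq> 0" using assms by auto
  then have "p * q = \<infinity>" using True by (auto simp: ennreal_mult_eq_top_iff)
  then show ?thesis using True by (auto simp: ennreal_divide_top)
next
  case False
  obtain P where P: "p = ennreal P" "P \<ge> 1" using False assms by (cases p) (auto simp flip: ennreal_1)
  obtain Q where Q: "q = ennreal Q" "Q \<ge> 1" using False assms by (cases q) (auto simp flip: ennreal_1)
  have inv: "enn2real (1 / ennreal x) = 1 / x" if "x \<ge> 1" for x :: real
    using that divide_ennreal[of 1 x] by simp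
  have "P * Q \<ge> 1" using P Q mult_mono[of 1 P 1 Q] by simp
  moreover have "p * q = ennreal (P * Q)" using P Q by (simp add: ennreal_mult)
  ultimately show ?thesis using P Q by (simp add: inv)
qed

lemma enn2real_conjugate:
  fixes p p' :: ennreal
  assumes "1 / p + 1 / p' = 1"
  shows "enn2real (1 / p') = 1 - enn2real (1 / p)"
proof -
  have "1 / p + 1 / p' < \<infinity>" using assms by simp
  then have "1 / p < \<infinity>" "1 / p' < \<infinity>" by auto
  then have "enn2real (1 / p) + enn2real (1 / p') = enn2real (1 / p + 1 / p')" by (simp add: enn2real_plus)
  then show ?thesis using assms by simp
qed

text \<open>Replaces the Lebesgue measurable \<open>h\<close> by a Borel function equal to it almost
  everywhere, and the exponent by its reciprocal. The root in \<open>Lp_norm\<close> does not affect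
  finiteness.\<close>

lemma Lp_norm_finite_iff:
  fixes p :: ennreal
  assumes p: "1 \<le> p" and h[measurable]: "h \<in> borel_measurable lebesgue"
    and [measurable]: "u \<in> borel_measurable borel" and eq: "AE x in lborel. h x = u x"
  shows "Lp_norm p (\<lambda>x. h x * of_real (\<bar>x\<bar> powr \<alpha>)) < \<infinity> \<longleftrightarrow> wfin (enn2real (1 / p)) \<alpha> u"
proof -
  have m[measurable]: "(\<lambda>x::real. \<bar>x\<bar> powr \<alpha>) \<in> borel_measurable lebesgue"
    by (rule measurable_completion) measurable
  have n: "norm (h x * of_real (\<bar>x\<bar> powr \<alpha>)) = norm (h x) * \<bar>x\<bar> powr \<alpha>" for x
    by (simp add: norm_mult)
  show ?thesis
  proof (cases "p = \<infinity>")
    case True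
    have Lp: "Lp_norm p (\<lambda>x. h x * of_real (\<bar>x\<bar> powr \<alpha>)) = esssup lebesgue (\<lambda>x. ennreal (norm (h x) * \<bar>x\<bar> powr \<alpha>))"
      using True by (simp add: Lp_norm_def n)
    have w: "wfin (enn2real (1 / p)) \<alpha> u \<longleftrightarrow> (\<exists>M. AE x in lborel. norm (u x) * \<bar>x\<bar> powr \<alpha> \<le> M)"
      using True by (simp add: wfin_def ennreal_divide_top)
    show ?thesis
    proof
      assume "Lp_norm p (\<lambda>x. h x * of_real (\<bar>x\<bar> powr \<alpha>)) < \<infinity>"
      then obtain M where M: "M \<ge> 0" "esssup lebesgue (\<lambda>x. ennreal (norm (h x) * \<bar>x\<bar> powr \<alpha>)) = ennreal M"
        unfolding Lp by (cases "esssup lebesgue (\<lambda>x. ennreal (norm (h x) * \<bar>x\<bar> powr \<alpha>))") auto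
      have "AE x in lebesgue. ennreal (norm (h x) * \<bar>x\<bar> powr \<alpha>) \<le> ennreal M"
        using esssup_AE[where M = lebesgue and f = "\<lambda>x. ennreal (norm (h x) * \<bar>x\<bar> powr \<alpha>)"] M by simp
      then have "AE x in lborel. ennreal (norm (h x) * \<bar>x\<bar> powr \<alpha>) \<le> ennreal M"
        by (simp add: AE_completion_iff)
      then have "AE x in lborel. norm (u x) * \<bar>x\<bar> powr \<alpha> \<le> M"
        using eq by eventually_elim (use M in auto)
      then show "wfin (enn2real (1 / p)) \<alpha> u" unfolding w by blast
    next
      assume "wfin (enn2real (1 / p)) \<alpha> u"
      then obtain M where M: "AE x in lborel. norm (u x) * \<bar>x\<bar> powr \<alpha> \<le> M" unfolding w by blast
      have "AE x in lborel. ennreal (norm (h x) * \<bar>x\<bar> powr \<alpha>) \<le> ennreal M"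
        using M eq by eventually_elim (auto intro: ennreal_leI)
      then have "AE x in lebesgue. ennreal (norm (h x) * \<bar>x\<bar> powr \<alpha>) \<le> ennreal M"
        by (simp add: AE_completion_iff)
      then have "esssup lebesgue (\<lambda>x. ennreal (norm (h x) * \<bar>x\<bar> powr \<alpha>)) \<le> ennreal M"
        by (intro esssup_I) measurable
      then show "Lp_norm p (\<lambda>x. h x * of_real (\<bar>x\<bar> powr \<alpha>)) < \<infinity>"
        unfolding Lp by (rule le_less_trans) simp
    qed
  next
    case False
    define P where "P = enn2real p"
    define I where "I = (\<integral>\<^sup>+x. ennreal ((norm (h x) * \<bar>x\<bar> powr \<alpha>) powr P) \<partial>lebesgue)"
    have Lp: "Lp_norm p (\<lambda>x. h x * of_real (\<bar>x\<bar> powr \<alpha>)) < \<infinity> \<longleftrightarrow> I < \<infinity>"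
      unfolding Lp_norm_def n I_def[symmetric] P_def[symmetric] Let_def
      using False by (cases "I = \<infinity>") (auto simp: top.not_eq_extremum)
    have "I = (\<integral>\<^sup>+x. ennreal ((norm (u x) * \<bar>x\<bar> powr \<alpha>) powr P) \<partial>lborel)"
      unfolding I_def nn_integral_completion using eq
      by (intro nn_integral_cong_AE) (auto elim!: eventually_mono)
    moreover have "1 / enn2real (1 / p) = P" "enn2real (1 / p) \<noteq> 0"
      using enn2real_inverse_bounds[OF p] False by (auto simp: P_def)
    ultimately show ?thesis unfolding Lp wfin_def by simp
  qed
qed

lemma fourier_eq_ft:
  assumes [measurable]: "f \<in> borel_measurable lebesgue" "f0 \<in> borel_measurable borel"
    and eq: "AE x in lborel. f x = f0 x"
  shows "fourier f = ft f0"
proof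
  fix \<xi>
  have e: "exp (- 2 * of_real pi * \<i> * of_real x * of_real \<xi>) = ee (- (x * \<xi>))" for x
    by (simp add: ee_def cis_conv_exp mult_ac)
  have m[measurable]: "(\<lambda>x. ee (- (x * \<xi>))) \<in> borel_measurable lebesgue"
    by (rule measurable_completion) measurable
  have m0[measurable]: "f0 \<in> borel_measurable lebesgue"
    by (rule measurable_completion) measurable
  have "fourier f \<xi> = (\<integral>x. f0 x * ee (- (x * \<xi>)) \<partial>lebesgue)"
    unfolding fourier_def e using eq
    by (intro integral_cong_AE) (auto simp: AE_completion_iff elim!: eventually_mono)
  also have "\<dots> = ft f0 \<xi>"
    unfolding ft_def by (rule integral_completion) measurable
  finally show "fourier f \<xi> = ft f0 \<xi>" .
qed

text \<open>A pointwise limit of the truncations to \<open>[- n, n]\<close>, each of which is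
  integrable.\<close>

lemma locally_integrable_measurable:
  assumes "locally_integrable f"
  shows "f \<in> borel_measurable lebesgue"
proof (rule borel_measurable_LIMSEQ_metric)
  fix n :: nat
  have "set_integrable lebesgue {- real n..real n} f"
    using assms unfolding locally_integrable_def by blast
  then show "(\<lambda>x. indicat_real {- real n..real n} x *\<^sub>R f x) \<in> borel_measurable lebesgue"
    unfolding set_integrable_def by (rule borel_measurable_integrable)
next
  fix x :: real
  obtain M where M: "\<bar>x\<bar> \<le> real M" using real_arch_simple by blast
  have "\<forall>\<^sub>F n in sequentially. indicat_real {- real n..real n} x *\<^sub>R f x = f x"
    using eventually_ge_at_top[of M]
  proof eventually_elim
    case (elim n)
    then have "real M \<le> real n" by simp
    then show ?case using M by (auto simp: indicator_def)
  qed
  then show "(\<lambda>n. indicat_real {- real n..real n} x *\<^sub>R f x) \<longlonglongrightarrow> f x"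
    by (rule tendsto_eventually)
qed

lemma ex_borel_version:
  fixes f :: "real \<Rightarrow> complex"
  assumes "f \<in> borel_measurable lebesgue"
  shows "\<exists>f0 \<in> borel_measurable borel. AE x in lborel. f x = f0 x"
proof -
  have "(\<lambda>x. Re (f x)) \<in> borel_measurable lebesgue" "(\<lambda>x. Im (f x)) \<in> borel_measurable lebesgue"
    using assms by measurable
  from this[THEN completion_ex_borel_measurable_real]
  obtain g h where m: "g \<in> borel_measurable lborel" "h \<in> borel_measurable lborel"
    and eq: "AE x in lborel. Re (f x) = g x" "AE x in lborel. Im (f x) = h x"
    by (elim bexE)
  have [measurable]: "g \<in> borel_measurable borel" "h \<in> borel_measurable borel" using m by simp_all
  show ?thesis
  proof (rule bexI)
    show "(\<lambda>x. Complex (g x) (h x)) \<in> borel_measurable borel"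
      unfolding Complex_eq by measurable
    show "AE x in lborel. f x = Complex (g x) (h x)"
      using eq by eventually_elim (simp add: complex_eq_iff)
  qed
qed

lemma weighted_norms_finite_iff:
  assumes p: "1 \<le> p" and q: "1 \<le> q" and f: "f \<in> borel_measurable lebesgue"
    and f0: "f0 \<in> borel_measurable borel" "AE x in lborel. f x = f0 x"
    and F: "ft f0 \<in> borel_measurable borel"
  shows "weighted_norms_finite p q \<alpha> \<beta> f \<longleftrightarrow> wfin (enn2real (1 / p)) \<alpha> f0 \<and> wfin (enn2real (1 / q)) \<beta> (ft f0)"
proof -
  have "ft f0 \<in> borel_measurable lebesgue" using F by (intro measurable_completion) simp
  then show ?thesis
    using Lp_norm_finite_iff[OF p f f0] Lp_norm_finite_iff[OF q _ F, of "ft f0"]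
    unfolding weighted_norms_finite_def fourier_eq_ft[OF f f0] by simp
qed

lemma convergent_of_weighted_norms:
  assumes p: "1 \<le> p" and q: "1 \<le> q" and f: "locally_integrable f" "weighted_norms_finite p q \<alpha> \<beta> f"
    and rt: "r = enn2real (1 / p)" "t = enn2real (1 / q)"
    and a: "\<alpha> - (1 - r) > 0" and b: "\<beta> - (1 - t) > 0"
    and ab: "(\<alpha> - (1 - r)) * (\<beta> - (1 - t)) > r * max t (1 / 2) \<or>
      r = 1 \<and> t = 1 \<and> (\<alpha> - (1 - r)) * (\<beta> - (1 - t)) = 1"
  shows "\<exists>g. continuous_rep f g \<and> convergent (\<lambda>N. P_N N (\<lambda>x. norm (g x)))"
proof -
  have fm[measurable]: "f \<in> borel_measurable lebesgue" using f by (intro locally_integrable_measurable)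
  obtain f0 where f0[measurable]: "f0 \<in> borel_measurable borel" and eq: "AE x in lborel. f x = f0 x"
    using ex_borel_version[OF fm] by blast
  have r01: "0 \<le> r" "r \<le> 1" and t01: "0 \<le> t" "t \<le> 1"
    using enn2real_inverse_bounds[OF p] enn2real_inverse_bounds[OF q] rt by auto
  have loc: "(\<integral>\<^sup>+x. ennreal (norm (f0 x)) * indicator {-1..1} x \<partial>lborel) < \<infinity>"
  proof -
    have "set_integrable lebesgue {-1..1} f"
      using f unfolding locally_integrable_def by blast
    then have "(\<integral>\<^sup>+x. ennreal (norm (indicat_real {-1..1} x *\<^sub>R f x)) \<partial>lborel) < \<infinity>"
      unfolding set_integrable_def integrable_iff_bounded nn_integral_completion by simp
    also have "(\<integral>\<^sup>+x. ennreal (norm (indicat_real {-1..1} x *\<^sub>R f x)) \<partial>lborel) = (\<integral>\<^sup>+x. ennreal (norm (f0 x)) * indicator {-1..1} x \<partial>lborel)"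
      using eq by (intro nn_integral_cong_AE) (auto elim!: eventually_mono simp: indicator_def)
    finally show ?thesis .
  qed
  have Lf: "Lp_norm p (\<lambda>x. f x * of_real (\<bar>x\<bar> powr \<alpha>)) < \<infinity>"
    using f(2) unfolding weighted_norms_finite_def by auto
  then have wf0: "wfin r \<alpha> f0" using Lp_norm_finite_iff[OF p fm f0 eq] rt by simp
  have f0i: "integrable lborel f0"
    using integrable_of_wfin[OF _ loc r01 _ wf0] a by simp
  then have "wfin t \<beta> (ft f0)"
    using f(2) weighted_norms_finite_iff[OF p q fm f0 eq] rt by simp
  then obtain g where g: "continuous_on UNIV g" "AE x in lborel. f0 x = g x" "convergent (\<lambda>N. P_N N (\<lambda>x. norm (g x)))"
    using convergent_of_wfin[OF _ loc r01 t01 wf0 _ a b ab] by auto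
  have "AE x in lborel. f x = g x" using eq g(2) by eventually_elim simp
  then show ?thesis using g unfolding continuous_rep_def by (auto simp: AE_completion_iff)
qed

lemma divergent_of_weighted_norms:
  assumes p: "1 \<le> p" and q: "1 \<le> q"
    and rt: "r = enn2real (1 / p)" "t = enn2real (1 / q)"
    and a: "\<alpha> - (1 - r) > 0" and b: "\<beta> - (1 - t) > 0"
    and ab: "(\<alpha> - (1 - r)) * (\<beta> - (1 - t)) \<le> r * max t (1 / 2)" and ne: "(p, q) \<noteq> (1, 1)"
  shows "\<exists>f. locally_integrable f \<and> weighted_norms_finite p q \<alpha> \<beta> f \<and>
     (\<exists>g. continuous_rep f g \<and> filterlim (\<lambda>N. P_N N (\<lambda>x. norm (g x))) at_top sequentially)"
proof -
  have r01: "0 \<le> r" "r \<le> 1" and t01: "0 \<le> t" "t \<le> 1"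
    using enn2real_inverse_bounds[OF p] enn2real_inverse_bounds[OF q] rt by auto
  \<comment> \<open>For infinite \<open>p\<close> the right side of \<open>ab\<close> is 0 while the
    left side is positive, so \<open>r\<close> is positive here.\<close>
  have "(\<alpha> - (1 - r)) * (\<beta> - (1 - t)) > 0" using a b by (rule mult_pos_pos)
  then have "r \<noteq> 0" using ab by auto
  then have r0: "0 < r" using r01 by simp
  have ne': "r \<noteq> 1 \<or> t \<noteq> 1"
    using ne enn2real_inverse_bounds(4)[OF p] enn2real_inverse_bounds(4)[OF q] rt by auto
  obtain f where f: "integrable lborel f" "continuous_on UNIV f" "wfin r \<alpha> f" "wfin t \<beta> (ft f)"
    "filterlim (\<lambda>N. P_N N (\<lambda>x. norm (f x))) at_top sequentially"
    using divergent_of_wfin[OF r0 r01(2) t01 ne' a b ab] by blast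
  have [measurable]: "f \<in> borel_measurable borel" using f by auto
  have fl: "integrable lebesgue f" using f(1) by (subst integrable_completion) auto
  have "locally_integrable f"
    unfolding locally_integrable_def set_integrable_def
    using fl by (auto intro!: integrable_mult_indicator dest: lmeasurable_compact)
  moreover have "weighted_norms_finite p q \<alpha> \<beta> f"
    using weighted_norms_finite_iff[OF p q borel_measurable_integrable[OF fl], of f] f rt by simp
  moreover have "continuous_rep f f" using f by (simp add: continuous_rep_def)
  ultimately show ?thesis using f by blast
qed

theorem theorem2p2:
  fixes p q p' q' :: ennreal and \<alpha> \<beta> :: real
  assumes "1 \<le> p" and "1 \<le> q"
    and "1 / p + 1 / p' = 1" and "1 / q + 1 / q' = 1"
    and "\<alpha> - enn2real (1 / p') > 0" and "\<beta> - enn2real (1 / q') > 0"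
  shows
    "((\<alpha> - enn2real (1 / p')) * (\<beta> - enn2real (1 / q'))
         > max (enn2real (1 / (p * q))) (enn2real (1 / (2 * p))) \<longrightarrow>
       (\<forall>f. locally_integrable f \<and> weighted_norms_finite p q \<alpha> \<beta> f \<longrightarrow>
         (\<exists>g. continuous_rep f g \<and> convergent (\<lambda>N. P_N N (\<lambda>x. norm (g x))))))
     \<and> ((\<alpha> - enn2real (1 / p')) * (\<beta> - enn2real (1 / q')) = enn2real (1 / (p * q))
         \<and> (p, q) = (1, 1) \<longrightarrow>
       (\<forall>f. locally_integrable f \<and> weighted_norms_finite p q \<alpha> \<beta> f \<longrightarrow>
         (\<exists>g. continuous_rep f g \<and> convergent (\<lambda>N. P_N N (\<lambda>x. norm (g x))))))
     \<and> ((\<alpha> - enn2real (1 / p')) * (\<beta> - enn2real (1 / q'))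
         \<le> max (enn2real (1 / (p * q))) (enn2real (1 / (2 * p)))
         \<and> (p, q) \<noteq> (1, 1) \<longrightarrow>
       (\<exists>f. locally_integrable f \<and> weighted_norms_finite p q \<alpha> \<beta> f \<and>
         (\<exists>g. continuous_rep f g \<and>
           filterlim (\<lambda>N. P_N N (\<lambda>x. norm (g x))) at_top sequentially)))"
proof -
  define r t where rt: "r = enn2real (1 / p)" "t = enn2real (1 / q)"
  have r0: "r \<ge> 0" by (simp add: rt)
  have pq': "enn2real (1 / p') = 1 - r" "enn2real (1 / q') = 1 - t"
    unfolding rt using assms enn2real_conjugate by blast+
  have pq: "enn2real (1 / (p * q)) = r * t" unfolding rt using assms by (intro enn2real_inverse_mult)
  have "enn2real (1 / (2 * p)) = enn2real (1 / 2) * r"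
    unfolding rt using assms by (intro enn2real_inverse_mult) auto
  moreover have "enn2real (1 / 2) = 1 / 2"
    using enn2real_inverse_bounds(5)[of 2] by simp
  ultimately have p2: "enn2real (1 / (2 * p)) = r * (1 / 2)" by simp
  \<comment> \<open>\<open>max (1 / (p q)) (1 / (2 p))\<close> factors as \<open>s / p\<close> with
    \<open>s = max (1 / q) (1 / 2)\<close>.\<close>
  have m: "max (r * t) (r * (1 / 2)) = r * max t (1 / 2)"
  proof (cases "t \<le> 1 / 2")
    case True
    then show ?thesis using mult_left_mono[OF True r0] by (simp add: max_absorb2)
  next
    case False
    then have "1 / 2 \<le> t" by simp
    from mult_left_mono[OF this r0] this show ?thesis by (simp add: max_absorb1)
  qed
  have a: "\<alpha> - (1 - r) > 0" and b: "\<beta> - (1 - t) > 0" using assms unfolding pq' by auto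
  show ?thesis
    unfolding pq' pq p2 m
  proof (intro conjI impI allI; (elim conjE)?)
    fix f
    assume "r * max t (1 / 2) < (\<alpha> - (1 - r)) * (\<beta> - (1 - t))"
      and "locally_integrable f" "weighted_norms_finite p q \<alpha> \<beta> f"
    then show "\<exists>g. continuous_rep f g \<and> convergent (\<lambda>N. P_N N (\<lambda>x. norm (g x)))"
      using convergent_of_weighted_norms[OF assms(1,2) _ _ rt a b] by blast
  next
    fix f
    assume eq: "(\<alpha> - (1 - r)) * (\<beta> - (1 - t)) = r * t" "(p, q) = (1, 1)"
      and f: "locally_integrable f" "weighted_norms_finite p q \<alpha> \<beta> f"
    have "r = 1" "t = 1"
      using eq(2) enn2real_inverse_bounds(4)[OF assms(1)] enn2real_inverse_bounds(4)[OF assms(2)] rt by auto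
    then show "\<exists>g. continuous_rep f g \<and> convergent (\<lambda>N. P_N N (\<lambda>x. norm (g x)))"
      using convergent_of_weighted_norms[OF assms(1,2) f rt a b] eq(1) by simp
  next
    assume "(\<alpha> - (1 - r)) * (\<beta> - (1 - t)) \<le> r * max t (1 / 2)" "(p, q) \<noteq> (1, 1)"
    then show "\<exists>f. locally_integrable f \<and> weighted_norms_finite p q \<alpha> \<beta> f \<and>
         (\<exists>g. continuous_rep f g \<and> filterlim (\<lambda>N. P_N N (\<lambda>x. norm (g x))) at_top sequentially)"
      by (rule divergent_of_weighted_norms[OF assms(1,2) rt a b])
  qed
qed

end
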